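(* Let $\Sigma$ be a countable signature (a set of atomic types together with typed function symbols $f:A\to B$). The equational calculus $\mathsf{ME}_\nu$ of the concurrent metalanguage over $\Sigma$ is sound and strongly complete with respect to $\mathsf{ME}_\nu$-models: for every set $\Phi$ of well-typed equations $\Gamma\rhd t=s$, an equation $\Gamma\rhd t=s$ is derivable in $\mathsf{ME}_\nu$ from the equations in $\Phi$ if and only if it is satisfied by every $\mathsf{ME}_\nu$-model that satisfies all equations of $\Phi$.
   Context: Types are generated by $P ::= W \mid 1 \mid P\times P \mid P+P \mid TP \mid T_\nu P$, with $W$ ranging over atomic types of $\Sigma$. A context is a list $\Gamma=(x_1:A_1,\dots,x_n:A_n)$. Terms (programs) $\Gamma\rhd t:A$ are formed by: variables; $f(t):B$ for $f:A\to B$ in $\Sigma$ and $t:A$; $\star:1$; pairing $\langle t,u\rangle:A\times B$, $\mathsf{fst}\,t:A$, $\mathsf{snd}\,t:B$ for $t:A\times B$; $\mathsf{inl}\,t:A+B$, $\mathsf{inr}\,t:A+B$; $\mathsf{case}\ s\ \mathsf{of}\ \mathsf{inl}\,x\mapsto t;\ \mathsf{inr}\,y\mapsto u : C$ for $s:A+B$, $\Gamma,x:A\rhd t:C$, $\Gamma,y:B\rhd u:C$; $\mathsf{ret}\,t:TA$ for $t:A$; $\mathsf{do}\ x\gets p;\ q : TB$ for $p:TA$ and $\Gamma,x:A\rhd q:TB$; $\varnothing:TA$ (deadlock); $p+q:TA$ for $p,q:TA$ (choice); $\mathsf{out}(p):T(T_\nu A+A)$ for $p:T_\nu A$; and $\mathsf{unfold}\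 x:=p\ \mathsf{in}\ q : T_\nu B$ for $\Gamma\rhd p:A$ and $\Gamma,x:A\rhd q:T(A+B)$ (with $x$ bound in $q$). An $\mathsf{ME}_\nu$-model consists of: a distributive category $\mathcal C$ (finite products, binary coproducts, with $\mathit{dist}:X\times(Y+Z)\to X\times Y+X\times Z$ inverse to the canonical map); a strong monad $(T,\eta,(-)^\star,\tau)$ on $\mathcal C$ which is semi-additive, i.e. equipped with natural transformations $\delta:1\to T$ and $\varpi:T\times T\to T$ making each $TA$ an internal bounded join-semilattice such that $f^\star\delta=\delta$, $f^\star\varpi=\varpi\langle f^\star,f^\star\rangle$, $\tau(f\times\delta)=\delta$, $\tau(f\times\varpi)=\varpi\langle\tau(f\times\pi_1),\tau(f\times\pi_2)\rangle$; and for every object $A$ a final coalgebra $\mathsf{out}_A:RA\to T(RA+A)$ of the functor $T(-+A)$ (for a coalgebra $f:X\to T(X+A)$ write $[\![f]\!]:X\to RA$ for the unique coalgebra morphism); plus interpretations of atomic types as objects and of function symbols as morphisms. Types are interpreted by products, coproducts, $[\![TA]\!]=T[\![A]\!]$, $[\![T_\nu A]\!]=R[\![A]\!]$, $[\![\Gamma]\!]=\prod[\![A_i]\!]$. Terms are interpreted as usual for variables, application, pairs, injections; $\mathsf{case}$ by $[\,[\![t]\!],[\![u]\!]\,]\circ\mathit{dist}\circ\langle\mathrm{id},[\![s]\!]\rangle$; $\mathsf{do}$ by $[\![q]\!]^\star\circ\tau\circ\langle\mathrm{id},[\![p]\!]\rangle$; $\mathsf{ret}$ by $\eta$; $+$,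 $\varnothing$ by $\varpi,\delta$; $\mathsf{out}(p)$ by $\mathsf{out}_{[\![A]\!]}\circ[\![p]\!]$; and $[\![\mathsf{unfold}\ x:=p\ \mathsf{in}\ q]\!]=R\pi_2\circ[\![f]\!]\circ\langle\mathrm{id},[\![p]\!]\rangle$ where $f=T(\mathit{dist})\circ\tau\circ\langle\pi_1,g\rangle:[\![\Gamma]\!]\times[\![A]\!]\to T([\![\Gamma]\!]\times[\![A]\!]+[\![\Gamma]\!]\times[\![B]\!])$ and $g=[\![\Gamma,x:A\rhd q]\!]$. A model satisfies $\Gamma\rhd t=s$ if $[\![t]\!]=[\![s]\!]$. $\mathsf{ME}_\nu$ is equational logic (reflexivity, symmetry, transitivity, congruence, substitution) plus the axioms: $\mathsf{case}$ of $\mathsf{inl}\,p$ (resp. $\mathsf{inr}\,p$) reduces to $q[p/x]$ (resp. $r[p/y]$); $\mathsf{case}\ p\ \mathsf{of}\ \mathsf{inl}\,x\mapsto\mathsf{inl}\,x;\ \mathsf{inr}\,y\mapsto\mathsf{inr}\,y = p$; $\mathsf{case}\ p\ \mathsf{of}\ \mathsf{inl}\,x\mapsto t[q/z];\ \mathsf{inr}\,y\mapsto t[r/z] = t[\mathsf{case}\ p\ \mathsf{of}\ \mathsf{inl}\,x\mapsto q;\ \mathsf{inr}\,y\mapsto r/z]$ ($x,y$ not free in $r$); $\mathsf{fst}\langle p,q\rangle=p$, $\mathsf{snd}\langle p,q\rangle=q$, $\langle\mathsf{fst}\,p,\mathsf{snd}\,p\rangle=p$; $p=\star$ for $p:1$;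 $\mathsf{do}\ x\gets p;\ \mathsf{ret}\,x=p$; $\mathsf{do}\ x\gets\mathsf{ret}\,a;\ p=p[a/x]$; $\mathsf{do}\ x\gets(\mathsf{do}\ y\gets p;\ q);\ r=\mathsf{do}\ y\gets p;\ x\gets q;\ r$ ($y$ not free in $r$); $p+\varnothing=p$, $p+q=q+p$, $p+p=p$, $p+(q+r)=(p+q)+r$, $\mathsf{do}\ x\gets\varnothing;\ r=\varnothing$, $\mathsf{do}\ x\gets(p+q);\ r=(\mathsf{do}\ x\gets p;\ r)+(\mathsf{do}\ x\gets q;\ r)$; and the bidirectional co-iteration rule: for $\Gamma,x:A\rhd p:T_\nu B$ and $\Gamma,x:A\rhd q:T(A+B)$, the equation $\Gamma,x:A\rhd \mathsf{out}(p)=\mathsf{do}\ z\gets q;\ \mathsf{case}\ z\ \mathsf{of}\ \mathsf{inl}\,x\mapsto\mathsf{ret}(\mathsf{inl}\,p);\ \mathsf{inr}\,y\mapsto\mathsf{ret}(\mathsf{inr}\,y)$ holds iff $\Gamma,y:A\rhd p[y/x]=\mathsf{unfold}\ x:=y\ \mathsf{in}\ q$ holds (each may be inferred from the other).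
   Formalization: In the axiom moving t[–/z] in and out of a case, the side condition "x, y not free in r" is read as "x, y not free in t" (y may occur in r); the literal condition permits variable capture and makes the calculus unsound. *)

theory Defs
  imports Main "HOL-Library.Countable_Set"
begin

section \<open>Signatures, types, terms\<close>

datatype (ty_atoms: 'w) ty =
    TAtom 'w
  | TOne
  | TProd (lty: "'w ty") (rty: "'w ty")
  | TSum (lty: "'w ty") (rty: "'w ty")
  | TMon (argty: "'w ty")
  | TNu (argty: "'w ty")

record ('w, 'f) signature =
  atoms :: "'w set"
  funs :: "'f set"
  fdom :: "'f \<Rightarrow> 'w ty"
  fcod :: "'f \<Rightarrow> 'w ty"

definition wf_ty :: "('w, 'f) signature \<Rightarrow> 'w ty \<Rightarrow> bool" where
  "wf_ty \<Sigma> A \<longleftrightarrow> ty_atoms A \<subseteq> atoms \<Sigma>"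

definition wf_signature :: "('w, 'f) signature \<Rightarrow> bool" where
  "wf_signature \<Sigma> \<longleftrightarrow> (\<forall>f\<in>funs \<Sigma>. wf_ty \<Sigma> (fdom \<Sigma> f) \<and> wf_ty \<Sigma> (fcod \<Sigma> f))"

definition countable_signature :: "('w, 'f) signature \<Rightarrow> bool" where
  "countable_signature \<Sigma> \<longleftrightarrow> countable (atoms \<Sigma>) \<and> countable (funs \<Sigma>)"

text \<open>
  Contexts are lists of types, the most recently bound variable first, so that
  \<open>A # \<Gamma>\<close> renders the context \<open>\<Gamma>, x : A\<close>.
\<close>

type_synonym 'w ctx = "'w ty list"

definition wf_ctx :: "('w, 'f) signature \<Rightarrow> 'w ctx \<Rightarrow> bool" where
  "wf_ctx \<Sigma> \<Gamma> \<longleftrightarrow> (\<forall>A\<in>set \<Gamma>. wf_ty \<Sigma> A)"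

text \<open>
  Terms modulo renaming of bound variables, in de Bruijn style. \<open>Case s t u\<close> binds one variable
  in \<open>t\<close> and one in \<open>u\<close>; \<open>Do p q\<close> and \<open>Unfold p q\<close> bind one variable in \<open>q\<close>.
  The injections carry the type of the missing summand, and deadlock its value type, so that
  a term has at most one type in a given context.
\<close>

datatype ('w, 'f) tm =
    Var nat
  | Fn 'f "('w, 'f) tm"
  | Star
  | Tup "('w, 'f) tm" "('w, 'f) tm"
  | Fst "('w, 'f) tm"
  | Snd "('w, 'f) tm"
  | InL "'w ty" "('w, 'f) tm"
  | InR "'w ty" "('w, 'f) tm"
  | Case "('w, 'f) tm" "('w, 'f) tm" "('w, 'f) tm"
  | Ret "('w, 'f) tm"
  | Do "('w, 'f) tm" "('w, 'f) tm"
  | Dead "'w ty"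
  | Choice "('w, 'f) tm" "('w, 'f) tm"
  | Out "('w, 'f) tm"
  | Unfold "('w, 'f) tm" "('w, 'f) tm"

inductive typed :: "('w, 'f) signature \<Rightarrow> 'w ctx \<Rightarrow> ('w, 'f) tm \<Rightarrow> 'w ty \<Rightarrow> bool"
  for \<Sigma> :: "('w, 'f) signature" where
  Var: "\<lbrakk>wf_ctx \<Sigma> \<Gamma>; i < length \<Gamma>\<rbrakk> \<Longrightarrow> typed \<Sigma> \<Gamma> (Var i) (\<Gamma> ! i)"
| Fn: "\<lbrakk>f \<in> funs \<Sigma>; typed \<Sigma> \<Gamma> t (fdom \<Sigma> f)\<rbrakk> \<Longrightarrow> typed \<Sigma> \<Gamma> (Fn f t) (fcod \<Sigma> f)"
| Star: "wf_ctx \<Sigma> \<Gamma> \<Longrightarrow> typed \<Sigma> \<Gamma> Star TOne"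
| Tup: "\<lbrakk>typed \<Sigma> \<Gamma> t A; typed \<Sigma> \<Gamma> u B\<rbrakk> \<Longrightarrow> typed \<Sigma> \<Gamma> (Tup t u) (TProd A B)"
| Fst: "typed \<Sigma> \<Gamma> t (TProd A B) \<Longrightarrow> typed \<Sigma> \<Gamma> (Fst t) A"
| Snd: "typed \<Sigma> \<Gamma> t (TProd A B) \<Longrightarrow> typed \<Sigma> \<Gamma> (Snd t) B"
| InL: "\<lbrakk>typed \<Sigma> \<Gamma> t A; wf_ty \<Sigma> B\<rbrakk> \<Longrightarrow> typed \<Sigma> \<Gamma> (InL B t) (TSum A B)"
| InR: "\<lbrakk>typed \<Sigma> \<Gamma> t B; wf_ty \<Sigma> A\<rbrakk> \<Longrightarrow> typed \<Sigma> \<Gamma> (InR A t) (TSum A B)"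
| Case: "\<lbrakk>typed \<Sigma> \<Gamma> s (TSum A B); typed \<Sigma> (A # \<Gamma>) t C; typed \<Sigma> (B # \<Gamma>) u C\<rbrakk>
    \<Longrightarrow> typed \<Sigma> \<Gamma> (Case s t u) C"
| Ret: "typed \<Sigma> \<Gamma> t A \<Longrightarrow> typed \<Sigma> \<Gamma> (Ret t) (TMon A)"
| Do: "\<lbrakk>typed \<Sigma> \<Gamma> p (TMon A); typed \<Sigma> (A # \<Gamma>) q (TMon B)\<rbrakk>
    \<Longrightarrow> typed \<Sigma> \<Gamma> (Do p q) (TMon B)"
| Dead: "\<lbrakk>wf_ctx \<Sigma> \<Gamma>; wf_ty \<Sigma> A\<rbrakk> \<Longrightarrow> typed \<Sigma> \<Gamma> (Dead A) (TMon A)"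
| Choice: "\<lbrakk>typed \<Sigma> \<Gamma> p (TMon A); typed \<Sigma> \<Gamma> q (TMon A)\<rbrakk>
    \<Longrightarrow> typed \<Sigma> \<Gamma> (Choice p q) (TMon A)"
| Out: "typed \<Sigma> \<Gamma> p (TNu A) \<Longrightarrow> typed \<Sigma> \<Gamma> (Out p) (TMon (TSum (TNu A) A))"
| Unfold: "\<lbrakk>typed \<Sigma> \<Gamma> p A; typed \<Sigma> (A # \<Gamma>) q (TMon (TSum A B))\<rbrakk>
    \<Longrightarrow> typed \<Sigma> \<Gamma> (Unfold p q) (TNu B)"

text \<open>The type of a well-typed term, as a function; the interpretation of terms refers to it.\<close>

fun ty_of :: "('w, 'f) signature \<Rightarrow> 'w ctx \<Rightarrow> ('w, 'f) tm \<Rightarrow> 'w ty" where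
  "ty_of \<Sigma> \<Gamma> (Var i) = \<Gamma> ! i"
| "ty_of \<Sigma> \<Gamma> (Fn f t) = fcod \<Sigma> f"
| "ty_of \<Sigma> \<Gamma> Star = TOne"
| "ty_of \<Sigma> \<Gamma> (Tup t u) = TProd (ty_of \<Sigma> \<Gamma> t) (ty_of \<Sigma> \<Gamma> u)"
| "ty_of \<Sigma> \<Gamma> (Fst t) = lty (ty_of \<Sigma> \<Gamma> t)"
| "ty_of \<Sigma> \<Gamma> (Snd t) = rty (ty_of \<Sigma> \<Gamma> t)"
| "ty_of \<Sigma> \<Gamma> (InL B t) = TSum (ty_of \<Sigma> \<Gamma> t) B"
| "ty_of \<Sigma> \<Gamma> (InR A t) = TSum A (ty_of \<Sigma> \<Gamma> t)"
| "ty_of \<Sigma> \<Gamma> (Case s t u) = ty_of \<Sigma> (lty (ty_of \<Sigma> \<Gamma> s) # \<Gamma>) t"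
| "ty_of \<Sigma> \<Gamma> (Ret t) = TMon (ty_of \<Sigma> \<Gamma> t)"
| "ty_of \<Sigma> \<Gamma> (Do p q) = ty_of \<Sigma> (argty (ty_of \<Sigma> \<Gamma> p) # \<Gamma>) q"
| "ty_of \<Sigma> \<Gamma> (Dead A) = TMon A"
| "ty_of \<Sigma> \<Gamma> (Choice p q) = ty_of \<Sigma> \<Gamma> p"
| "ty_of \<Sigma> \<Gamma> (Out p) = TMon (TSum (ty_of \<Sigma> \<Gamma> p) (argty (ty_of \<Sigma> \<Gamma> p)))"
| "ty_of \<Sigma> \<Gamma> (Unfold p q) = TNu (rty (argty (ty_of \<Sigma> (ty_of \<Sigma> \<Gamma> p # \<Gamma>) q)))"

lemma ty_of_typed: "typed \<Sigma> \<Gamma> t A \<Longrightarrow> ty_of \<Sigma> \<Gamma> t = A"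
  by (induction rule: typed.induct) simp_all

definition lift_ren :: "(nat \<Rightarrow> nat) \<Rightarrow> nat \<Rightarrow> nat" where
  "lift_ren r = case_nat 0 (\<lambda>n. Suc (r n))"

primrec ren :: "(nat \<Rightarrow> nat) \<Rightarrow> ('w, 'f) tm \<Rightarrow> ('w, 'f) tm" where
  "ren r (Var i) = Var (r i)"
| "ren r (Fn f t) = Fn f (ren r t)"
| "ren r Star = Star"
| "ren r (Tup t u) = Tup (ren r t) (ren r u)"
| "ren r (Fst t) = Fst (ren r t)"
| "ren r (Snd t) = Snd (ren r t)"
| "ren r (InL B t) = InL B (ren r t)"
| "ren r (InR A t) = InR A (ren r t)"
| "ren r (Case s t u) = Case (ren r s) (ren (lift_ren r) t) (ren (lift_ren r) u)"
| "ren r (Ret t) = Ret (ren r t)"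
| "ren r (Do p q) = Do (ren r p) (ren (lift_ren r) q)"
| "ren r (Dead A) = Dead A"
| "ren r (Choice p q) = Choice (ren r p) (ren r q)"
| "ren r (Out p) = Out (ren r p)"
| "ren r (Unfold p q) = Unfold (ren r p) (ren (lift_ren r) q)"

definition lift_sub :: "(nat \<Rightarrow> ('w, 'f) tm) \<Rightarrow> nat \<Rightarrow> ('w, 'f) tm" where
  "lift_sub \<sigma> = case_nat (Var 0) (\<lambda>n. ren Suc (\<sigma> n))"

primrec sub :: "(nat \<Rightarrow> ('w, 'f) tm) \<Rightarrow> ('w, 'f) tm \<Rightarrow> ('w, 'f) tm" where
  "sub \<sigma> (Var i) = \<sigma> i"
| "sub \<sigma> (Fn f t) = Fn f (sub \<sigma> t)"
| "sub \<sigma> Star = Star"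
| "sub \<sigma> (Tup t u) = Tup (sub \<sigma> t) (sub \<sigma> u)"
| "sub \<sigma> (Fst t) = Fst (sub \<sigma> t)"
| "sub \<sigma> (Snd t) = Snd (sub \<sigma> t)"
| "sub \<sigma> (InL B t) = InL B (sub \<sigma> t)"
| "sub \<sigma> (InR A t) = InR A (sub \<sigma> t)"
| "sub \<sigma> (Case s t u) = Case (sub \<sigma> s) (sub (lift_sub \<sigma>) t) (sub (lift_sub \<sigma>) u)"
| "sub \<sigma> (Ret t) = Ret (sub \<sigma> t)"
| "sub \<sigma> (Do p q) = Do (sub \<sigma> p) (sub (lift_sub \<sigma>) q)"
| "sub \<sigma> (Dead A) = Dead A"
| "sub \<sigma> (Choice p q) = Choice (sub \<sigma> p) (sub \<sigma> q)"
| "sub \<sigma> (Out p) = Out (sub \<sigma> p)"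
| "sub \<sigma> (Unfold p q) = Unfold (sub \<sigma> p) (sub (lift_sub \<sigma>) q)"

text \<open>\<open>inst p q\<close> is \<open>q[p/x]\<close> for the most recently bound variable \<open>x\<close>.\<close>

definition inst :: "('w, 'f) tm \<Rightarrow> ('w, 'f) tm \<Rightarrow> ('w, 'f) tm" where
  "inst p = sub (case_nat p Var)"

text \<open>Weakening from \<open>\<Gamma>, x : A\<close> to \<open>\<Gamma>, y : B, x : A\<close> for a fresh variable \<open>y\<close>.\<close>

definition wk_under :: "('w, 'f) tm \<Rightarrow> ('w, 'f) tm" where
  "wk_under = ren (lift_ren Suc)"

section \<open>The calculus\<close>

text \<open>\<open>(\<Gamma>, t, s, A)\<close> stands for the equation \<open>\<Gamma> \<rhd> t = s\<close> between terms of type \<open>A\<close>.\<close>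

type_synonym ('w, 'f) equation = "'w ctx \<times> ('w, 'f) tm \<times> ('w, 'f) tm \<times> 'w ty"

definition wt_equation :: "('w, 'f) signature \<Rightarrow> ('w, 'f) equation \<Rightarrow> bool" where
  "wt_equation \<Sigma> = (\<lambda>(\<Gamma>, t, s, A). typed \<Sigma> \<Gamma> t A \<and> typed \<Sigma> \<Gamma> s A)"

inductive derivable ::
  "('w, 'f) signature \<Rightarrow> ('w, 'f) equation set \<Rightarrow> 'w ctx \<Rightarrow> ('w, 'f) tm \<Rightarrow> ('w, 'f) tm \<Rightarrow> 'w ty \<Rightarrow> bool"
  for \<Sigma> :: "('w, 'f) signature" and \<Phi> :: "('w, 'f) equation set" where
  hyp: "(\<Gamma>, t, s, A) \<in> \<Phi> \<Longrightarrow> derivable \<Sigma> \<Phi> \<Gamma> t s A"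

| refl: "typed \<Sigma> \<Gamma> t A \<Longrightarrow> derivable \<Sigma> \<Phi> \<Gamma> t t A"
| sym: "derivable \<Sigma> \<Phi> \<Gamma> t s A \<Longrightarrow> derivable \<Sigma> \<Phi> \<Gamma> s t A"
| trans: "\<lbrakk>derivable \<Sigma> \<Phi> \<Gamma> t s A; derivable \<Sigma> \<Phi> \<Gamma> s r A\<rbrakk> \<Longrightarrow> derivable \<Sigma> \<Phi> \<Gamma> t r A"
| subst: "\<lbrakk>derivable \<Sigma> \<Phi> \<Gamma> t s A; wf_ctx \<Sigma> \<Delta>; \<forall>i<length \<Gamma>. typed \<Sigma> \<Delta> (\<sigma> i) (\<Gamma> ! i)\<rbrakk>
    \<Longrightarrow> derivable \<Sigma> \<Phi> \<Delta> (sub \<sigma> t) (sub \<sigma> s) A"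
| cong_Fn: "\<lbrakk>f \<in> funs \<Sigma>; derivable \<Sigma> \<Phi> \<Gamma> t t' (fdom \<Sigma> f)\<rbrakk>
    \<Longrightarrow> derivable \<Sigma> \<Phi> \<Gamma> (Fn f t) (Fn f t') (fcod \<Sigma> f)"
| cong_Tup: "\<lbrakk>derivable \<Sigma> \<Phi> \<Gamma> t t' A; derivable \<Sigma> \<Phi> \<Gamma> u u' B\<rbrakk>
    \<Longrightarrow> derivable \<Sigma> \<Phi> \<Gamma> (Tup t u) (Tup t' u') (TProd A B)"
| cong_Fst: "derivable \<Sigma> \<Phi> \<Gamma> t t' (TProd A B) \<Longrightarrow> derivable \<Sigma> \<Phi> \<Gamma> (Fst t) (Fst t') A"
| cong_Snd: "derivable \<Sigma> \<Phi> \<Gamma> t t' (TProd A B) \<Longrightarrow> derivable \<Sigma> \<Phi> \<Gamma> (Snd t) (Snd t') B"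
| cong_InL: "\<lbrakk>derivable \<Sigma> \<Phi> \<Gamma> t t' A; wf_ty \<Sigma> B\<rbrakk>
    \<Longrightarrow> derivable \<Sigma> \<Phi> \<Gamma> (InL B t) (InL B t') (TSum A B)"
| cong_InR: "\<lbrakk>derivable \<Sigma> \<Phi> \<Gamma> t t' B; wf_ty \<Sigma> A\<rbrakk>
    \<Longrightarrow> derivable \<Sigma> \<Phi> \<Gamma> (InR A t) (InR A t') (TSum A B)"
| cong_Case: "\<lbrakk>derivable \<Sigma> \<Phi> \<Gamma> s s' (TSum A B); derivable \<Sigma> \<Phi> (A # \<Gamma>) t t' C;
      derivable \<Sigma> \<Phi> (B # \<Gamma>) u u' C\<rbrakk>
    \<Longrightarrow> derivable \<Sigma> \<Phi> \<Gamma> (Case s t u) (Case s' t' u') C"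
| cong_Ret: "derivable \<Sigma> \<Phi> \<Gamma> t t' A \<Longrightarrow> derivable \<Sigma> \<Phi> \<Gamma> (Ret t) (Ret t') (TMon A)"
| cong_Do: "\<lbrakk>derivable \<Sigma> \<Phi> \<Gamma> p p' (TMon A); derivable \<Sigma> \<Phi> (A # \<Gamma>) q q' (TMon B)\<rbrakk>
    \<Longrightarrow> derivable \<Sigma> \<Phi> \<Gamma> (Do p q) (Do p' q') (TMon B)"
| cong_Choice: "\<lbrakk>derivable \<Sigma> \<Phi> \<Gamma> p p' (TMon A); derivable \<Sigma> \<Phi> \<Gamma> q q' (TMon A)\<rbrakk>
    \<Longrightarrow> derivable \<Sigma> \<Phi> \<Gamma> (Choice p q) (Choice p' q') (TMon A)"
| cong_Out: "derivable \<Sigma> \<Phi> \<Gamma> p p' (TNu A)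
    \<Longrightarrow> derivable \<Sigma> \<Phi> \<Gamma> (Out p) (Out p') (TMon (TSum (TNu A) A))"
| cong_Unfold: "\<lbrakk>derivable \<Sigma> \<Phi> \<Gamma> p p' A; derivable \<Sigma> \<Phi> (A # \<Gamma>) q q' (TMon (TSum A B))\<rbrakk>
    \<Longrightarrow> derivable \<Sigma> \<Phi> \<Gamma> (Unfold p q) (Unfold p' q') (TNu B)"

| case_InL: "\<lbrakk>typed \<Sigma> \<Gamma> p A; typed \<Sigma> (A # \<Gamma>) q C; typed \<Sigma> (B # \<Gamma>) r C\<rbrakk>
    \<Longrightarrow> derivable \<Sigma> \<Phi> \<Gamma> (Case (InL B p) q r) (inst p q) C"
| case_InR: "\<lbrakk>typed \<Sigma> \<Gamma> p B; typed \<Sigma> (A # \<Gamma>) q C; typed \<Sigma> (B # \<Gamma>) r C\<rbrakk>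
    \<Longrightarrow> derivable \<Sigma> \<Phi> \<Gamma> (Case (InR A p) q r) (inst p r) C"
| case_id: "typed \<Sigma> \<Gamma> p (TSum A B)
    \<Longrightarrow> derivable \<Sigma> \<Phi> \<Gamma> (Case p (InL B (Var 0)) (InR A (Var 0))) p (TSum A B)"
| case_sub: "\<lbrakk>typed \<Sigma> \<Gamma> p (TSum A B); typed \<Sigma> (A # \<Gamma>) q D; typed \<Sigma> (B # \<Gamma>) r D;
      typed \<Sigma> (D # \<Gamma>) t C\<rbrakk>
    \<Longrightarrow> derivable \<Sigma> \<Phi> \<Gamma> (Case p (inst q (wk_under t)) (inst r (wk_under t)))
          (inst (Case p q r) t) C"
| fst: "\<lbrakk>typed \<Sigma> \<Gamma> p A; typed \<Sigma> \<Gamma> q B\<rbrakk> \<Longrightarrow> derivable \<Sigma> \<Phi> \<Gamma> (Fst (Tup p q)) p A"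
| snd: "\<lbrakk>typed \<Sigma> \<Gamma> p A; typed \<Sigma> \<Gamma> q B\<rbrakk> \<Longrightarrow> derivable \<Sigma> \<Phi> \<Gamma> (Snd (Tup p q)) q B"
| pair: "typed \<Sigma> \<Gamma> p (TProd A B) \<Longrightarrow> derivable \<Sigma> \<Phi> \<Gamma> (Tup (Fst p) (Snd p)) p (TProd A B)"
| unit: "typed \<Sigma> \<Gamma> p TOne \<Longrightarrow> derivable \<Sigma> \<Phi> \<Gamma> p Star TOne"

| do_ret: "typed \<Sigma> \<Gamma> p (TMon A) \<Longrightarrow> derivable \<Sigma> \<Phi> \<Gamma> (Do p (Ret (Var 0))) p (TMon A)"
| do_beta: "\<lbrakk>typed \<Sigma> \<Gamma> a A; typed \<Sigma> (A # \<Gamma>) p (TMon B)\<rbrakk>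
    \<Longrightarrow> derivable \<Sigma> \<Phi> \<Gamma> (Do (Ret a) p) (inst a p) (TMon B)"
| do_assoc: "\<lbrakk>typed \<Sigma> \<Gamma> p (TMon A); typed \<Sigma> (A # \<Gamma>) q (TMon B); typed \<Sigma> (B # \<Gamma>) r (TMon C)\<rbrakk>
    \<Longrightarrow> derivable \<Sigma> \<Phi> \<Gamma> (Do (Do p q) r) (Do p (Do q (wk_under r))) (TMon C)"

| choice_dead: "typed \<Sigma> \<Gamma> p (TMon A) \<Longrightarrow> derivable \<Sigma> \<Phi> \<Gamma> (Choice p (Dead A)) p (TMon A)"
| choice_comm: "\<lbrakk>typed \<Sigma> \<Gamma> p (TMon A); typed \<Sigma> \<Gamma> q (TMon A)\<rbrakk>
    \<Longrightarrow> derivable \<Sigma> \<Phi> \<Gamma> (Choice p q) (Choice q p) (TMon A)"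
| choice_idem: "typed \<Sigma> \<Gamma> p (TMon A) \<Longrightarrow> derivable \<Sigma> \<Phi> \<Gamma> (Choice p p) p (TMon A)"
| choice_assoc: "\<lbrakk>typed \<Sigma> \<Gamma> p (TMon A); typed \<Sigma> \<Gamma> q (TMon A); typed \<Sigma> \<Gamma> r (TMon A)\<rbrakk>
    \<Longrightarrow> derivable \<Sigma> \<Phi> \<Gamma> (Choice p (Choice q r)) (Choice (Choice p q) r) (TMon A)"
| do_dead: "\<lbrakk>wf_ty \<Sigma> A; typed \<Sigma> (A # \<Gamma>) r (TMon B)\<rbrakk>
    \<Longrightarrow> derivable \<Sigma> \<Phi> \<Gamma> (Do (Dead A) r) (Dead B) (TMon B)"
| do_choice: "\<lbrakk>typed \<Sigma> \<Gamma> p (TMon A); typed \<Sigma> \<Gamma> q (TMon A); typed \<Sigma> (A # \<Gamma>) r (TMon B)\<rbrakk>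
    \<Longrightarrow> derivable \<Sigma> \<Phi> \<Gamma> (Do (Choice p q) r) (Choice (Do p r) (Do q r)) (TMon B)"

\<comment> \<open>co-iteration, both directions: in the first injection branch the context is
    \<open>\<Gamma>, x : A, z : A + B, x : A\<close> and \<open>p\<close> refers to the inner \<open>x\<close>\<close>
| coit_unfold: "\<lbrakk>typed \<Sigma> (A # \<Gamma>) p (TNu B); typed \<Sigma> (A # \<Gamma>) q (TMon (TSum A B));
      derivable \<Sigma> \<Phi> (A # \<Gamma>) (Out p)
        (Do q (Case (Var 0) (Ret (InL B (wk_under (wk_under p)))) (Ret (InR (TNu B) (Var 0)))))
        (TMon (TSum (TNu B) B))\<rbrakk>
    \<Longrightarrow> derivable \<Sigma> \<Phi> (A # \<Gamma>) p (Unfold (Var 0) (wk_under q)) (TNu B)"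
| unfold_coit: "\<lbrakk>typed \<Sigma> (A # \<Gamma>) p (TNu B); typed \<Sigma> (A # \<Gamma>) q (TMon (TSum A B));
      derivable \<Sigma> \<Phi> (A # \<Gamma>) p (Unfold (Var 0) (wk_under q)) (TNu B)\<rbrakk>
    \<Longrightarrow> derivable \<Sigma> \<Phi> (A # \<Gamma>) (Out p)
        (Do q (Case (Var 0) (Ret (InL B (wk_under (wk_under p)))) (Ret (InR (TNu B) (Var 0)))))
        (TMon (TSum (TNu B) B))"

section \<open>Distributive categories\<close>

text \<open>
  \<open>comp C g f\<close> is composition in the usual (applicative) order. Products and coproducts are chosen;
  mediating morphisms are recovered from the universal properties.
\<close>

record ('o, 'm) cat_data =
  obj :: "'o set"
  arr :: "'m set"
  src :: "'m \<Rightarrow> 'o"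
  trg :: "'m \<Rightarrow> 'o"
  ide :: "'o \<Rightarrow> 'm"
  comp :: "'m \<Rightarrow> 'm \<Rightarrow> 'm" (infixr "\<cdot>\<index>" 70)

record ('o, 'm) dist_data = "('o, 'm) cat_data" +
  one :: 'o
  prd :: "'o \<Rightarrow> 'o \<Rightarrow> 'o"
  pr1 :: "'o \<Rightarrow> 'o \<Rightarrow> 'm"
  pr2 :: "'o \<Rightarrow> 'o \<Rightarrow> 'm"
  cpr :: "'o \<Rightarrow> 'o \<Rightarrow> 'o"
  in1 :: "'o \<Rightarrow> 'o \<Rightarrow> 'm"
  in2 :: "'o \<Rightarrow> 'o \<Rightarrow> 'm"

definition hom :: "('o, 'm, 'x) cat_data_scheme \<Rightarrow> 'o \<Rightarrow> 'o \<Rightarrow> 'm set" where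
  "hom C A B = {f \<in> arr C. src C f = A \<and> trg C f = B}"

locale category =
  fixes C :: "('o, 'm, 'x) cat_data_scheme" (structure)
  assumes arr_obj: "f \<in> arr C \<Longrightarrow> src C f \<in> obj C \<and> trg C f \<in> obj C"
    and ide_hom: "A \<in> obj C \<Longrightarrow> ide C A \<in> hom C A A"
    and comp_hom: "\<lbrakk>f \<in> hom C A B; g \<in> hom C B D\<rbrakk> \<Longrightarrow> g \<cdot> f \<in> hom C A D"
    and comp_ide: "f \<in> hom C A B \<Longrightarrow> f \<cdot> ide C A = f"
    and ide_comp: "f \<in> hom C A B \<Longrightarrow> ide C B \<cdot> f = f"
    and comp_assoc: "\<lbrakk>f \<in> hom C A B; g \<in> hom C B D; h \<in> hom C D E\<rbrakk>
      \<Longrightarrow> (h \<cdot> g) \<cdot> f = h \<cdot> (g \<cdot> f)"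

definition bang :: "('o, 'm, 'x) dist_data_scheme \<Rightarrow> 'o \<Rightarrow> 'm" where
  "bang C A = (THE f. f \<in> hom C A (one C))"

definition pair :: "('o, 'm, 'x) dist_data_scheme \<Rightarrow> 'm \<Rightarrow> 'm \<Rightarrow> 'm" where
  "pair C f g = (THE h. h \<in> hom C (src C f) (prd C (trg C f) (trg C g)) \<and>
     pr1 C (trg C f) (trg C g) \<cdot>\<^bsub>C\<^esub> h = f \<and> pr2 C (trg C f) (trg C g) \<cdot>\<^bsub>C\<^esub> h = g)"

definition cross :: "('o, 'm, 'x) dist_data_scheme \<Rightarrow> 'm \<Rightarrow> 'm \<Rightarrow> 'm" where
  "cross C f g =
     pair C (f \<cdot>\<^bsub>C\<^esub> pr1 C (src C f) (src C g)) (g \<cdot>\<^bsub>C\<^esub> pr2 C (src C f) (src C g))"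

definition copair :: "('o, 'm, 'x) dist_data_scheme \<Rightarrow> 'm \<Rightarrow> 'm \<Rightarrow> 'm" where
  "copair C f g = (THE h. h \<in> hom C (cpr C (src C f) (src C g)) (trg C f) \<and>
     h \<cdot>\<^bsub>C\<^esub> in1 C (src C f) (src C g) = f \<and> h \<cdot>\<^bsub>C\<^esub> in2 C (src C f) (src C g) = g)"

definition cosum :: "('o, 'm, 'x) dist_data_scheme \<Rightarrow> 'm \<Rightarrow> 'm \<Rightarrow> 'm" where
  "cosum C f g =
     copair C (in1 C (trg C f) (trg C g) \<cdot>\<^bsub>C\<^esub> f) (in2 C (trg C f) (trg C g) \<cdot>\<^bsub>C\<^esub> g)"

text \<open>The associator \<open>(A \<times> B) \<times> D \<rightarrow> A \<times> (B \<times> D)\<close>.\<close>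

definition assoc :: "('o, 'm, 'x) dist_data_scheme \<Rightarrow> 'o \<Rightarrow> 'o \<Rightarrow> 'o \<Rightarrow> 'm" where
  "assoc C A B D = pair C (pr1 C A B \<cdot>\<^bsub>C\<^esub> pr1 C (prd C A B) D) (cross C (pr2 C A B) (ide C D))"

text \<open>The canonical map \<open>X \<times> Y + X \<times> Z \<rightarrow> X \<times> (Y + Z)\<close> and its inverse.\<close>

definition codist :: "('o, 'm, 'x) dist_data_scheme \<Rightarrow> 'o \<Rightarrow> 'o \<Rightarrow> 'o \<Rightarrow> 'm" where
  "codist C X Y Z = copair C (cross C (ide C X) (in1 C Y Z)) (cross C (ide C X) (in2 C Y Z))"

definition inverse_pair :: "('o, 'm, 'x) cat_data_scheme \<Rightarrow> 'o \<Rightarrow> 'o \<Rightarrow> 'm \<Rightarrow> 'm \<Rightarrow> bool" where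
  "inverse_pair C A B f g \<longleftrightarrow>
     f \<in> hom C A B \<and> g \<in> hom C B A \<and> g \<cdot>\<^bsub>C\<^esub> f = ide C A \<and> f \<cdot>\<^bsub>C\<^esub> g = ide C B"

definition dist :: "('o, 'm, 'x) dist_data_scheme \<Rightarrow> 'o \<Rightarrow> 'o \<Rightarrow> 'o \<Rightarrow> 'm" where
  "dist C X Y Z = (THE d. inverse_pair C (prd C X (cpr C Y Z)) (cpr C (prd C X Y) (prd C X Z))
     d (codist C X Y Z))"

locale distributive_category = category C
  for C :: "('o, 'm, 'x) dist_data_scheme" (structure) +
  assumes one_obj: "one C \<in> obj C"
    and terminal: "A \<in> obj C \<Longrightarrow> \<exists>!f. f \<in> hom C A (one C)"
    and prd_obj: "\<lbrakk>A \<in> obj C; B \<in> obj C\<rbrakk> \<Longrightarrow> prd C A B \<in> obj C"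
    and pr1_hom: "\<lbrakk>A \<in> obj C; B \<in> obj C\<rbrakk> \<Longrightarrow> pr1 C A B \<in> hom C (prd C A B) A"
    and pr2_hom: "\<lbrakk>A \<in> obj C; B \<in> obj C\<rbrakk> \<Longrightarrow> pr2 C A B \<in> hom C (prd C A B) B"
    and product: "\<lbrakk>f \<in> hom C X A; g \<in> hom C X B\<rbrakk>
      \<Longrightarrow> \<exists>!h. h \<in> hom C X (prd C A B) \<and> pr1 C A B \<cdot> h = f \<and> pr2 C A B \<cdot> h = g"
    and cpr_obj: "\<lbrakk>A \<in> obj C; B \<in> obj C\<rbrakk> \<Longrightarrow> cpr C A B \<in> obj C"
    and in1_hom: "\<lbrakk>A \<in> obj C; B \<in> obj C\<rbrakk> \<Longrightarrow> in1 C A B \<in> hom C A (cpr C A B)"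
    and in2_hom: "\<lbrakk>A \<in> obj C; B \<in> obj C\<rbrakk> \<Longrightarrow> in2 C A B \<in> hom C B (cpr C A B)"
    and coproduct: "\<lbrakk>f \<in> hom C A X; g \<in> hom C B X\<rbrakk>
      \<Longrightarrow> \<exists>!h. h \<in> hom C (cpr C A B) X \<and> h \<cdot> in1 C A B = f \<and> h \<cdot> in2 C A B = g"
    and distributive: "\<lbrakk>X \<in> obj C; Y \<in> obj C; Z \<in> obj C\<rbrakk>
      \<Longrightarrow> \<exists>d. inverse_pair C (prd C X (cpr C Y Z)) (cpr C (prd C X Y) (prd C X Z))
            d (codist C X Y Z)"

section \<open>Strong semi-additive monads with final coalgebras\<close>

text \<open>
  Families of morphisms and operators are indexed by objects, since the object maps
  (for instance \<open>mon\<close>) need not be injective: \<open>ext C A B f\<close> is the Kleisli lifting \<open>T A \<rightarrow> T B\<close> of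
  \<open>f : A \<rightarrow> T B\<close>.
\<close>

record ('o, 'm) monad_data = "('o, 'm) dist_data" +
  mon :: "'o \<Rightarrow> 'o"
  eta :: "'o \<Rightarrow> 'm"
  ext :: "'o \<Rightarrow> 'o \<Rightarrow> 'm \<Rightarrow> 'm"
  tau :: "'o \<Rightarrow> 'o \<Rightarrow> 'm"
  delta :: "'o \<Rightarrow> 'm"
  varpi :: "'o \<Rightarrow> 'm"
  res :: "'o \<Rightarrow> 'o"
  out :: "'o \<Rightarrow> 'm"

definition mmap :: "('o, 'm, 'x) monad_data_scheme \<Rightarrow> 'm \<Rightarrow> 'm" where
  "mmap C f = ext C (src C f) (trg C f) (eta C (trg C f) \<cdot>\<^bsub>C\<^esub> f)"

definition mu :: "('o, 'm, 'x) monad_data_scheme \<Rightarrow> 'o \<Rightarrow> 'm" where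
  "mu C A = ext C (mon C A) A (ide C (mon C A))"

locale strong_monad = distributive_category C
  for C :: "('o, 'm, 'x) monad_data_scheme" (structure) +
  assumes mon_obj: "A \<in> obj C \<Longrightarrow> mon C A \<in> obj C"
    and eta_hom: "A \<in> obj C \<Longrightarrow> eta C A \<in> hom C A (mon C A)"
    and ext_hom: "\<lbrakk>B \<in> obj C; f \<in> hom C A (mon C B)\<rbrakk> \<Longrightarrow> ext C A B f \<in> hom C (mon C A) (mon C B)"
    and ext_eta: "A \<in> obj C \<Longrightarrow> ext C A A (eta C A) = ide C (mon C A)"
    and ext_comp_eta: "\<lbrakk>B \<in> obj C; f \<in> hom C A (mon C B)\<rbrakk> \<Longrightarrow> ext C A B f \<cdot> eta C A = f"
    and ext_comp: "\<lbrakk>B \<in> obj C; D \<in> obj C; f \<in> hom C A (mon C B); g \<in> hom C B (mon C D)\<rbrakk>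
      \<Longrightarrow> ext C A D (ext C B D g \<cdot> f) = ext C B D g \<cdot> ext C A B f"
    and tau_hom: "\<lbrakk>A \<in> obj C; B \<in> obj C\<rbrakk>
      \<Longrightarrow> tau C A B \<in> hom C (prd C A (mon C B)) (mon C (prd C A B))"
    and tau_natural: "\<lbrakk>f \<in> hom C A A'; g \<in> hom C B B'\<rbrakk>
      \<Longrightarrow> tau C A' B' \<cdot> cross C f (mmap C g) = mmap C (cross C f g) \<cdot> tau C A B"
    and tau_unit: "A \<in> obj C
      \<Longrightarrow> mmap C (pr2 C (one C) A) \<cdot> tau C (one C) A = pr2 C (one C) (mon C A)"
    and tau_assoc: "\<lbrakk>A \<in> obj C; B \<in> obj C; D \<in> obj C\<rbrakk>
      \<Longrightarrow> mmap C (assoc C A B D) \<cdot> tau C (prd C A B) D =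
          tau C A (prd C B D) \<cdot> cross C (ide C A) (tau C B D) \<cdot> assoc C A B (mon C D)"
    and tau_eta: "\<lbrakk>A \<in> obj C; B \<in> obj C\<rbrakk>
      \<Longrightarrow> tau C A B \<cdot> cross C (ide C A) (eta C B) = eta C (prd C A B)"
    and tau_mu: "\<lbrakk>A \<in> obj C; B \<in> obj C\<rbrakk>
      \<Longrightarrow> tau C A B \<cdot> cross C (ide C A) (mu C B) =
          mu C (prd C A B) \<cdot> mmap C (tau C A B) \<cdot> tau C A (mon C B)"

text \<open>
  In the last two axioms the subscripts of \<open>\<delta>\<close> and \<open>\<varpi>\<close> and the unique map into the
  terminal object, usually left implicit, are spelled out.
\<close>

locale semi_additive_monad = strong_monad C
  for C :: "('o, 'm, 'x) monad_data_scheme" (structure) +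
  assumes delta_hom: "A \<in> obj C \<Longrightarrow> delta C A \<in> hom C (one C) (mon C A)"
    and delta_natural: "f \<in> hom C A B \<Longrightarrow> mmap C f \<cdot> delta C A = delta C B"
    and varpi_hom: "A \<in> obj C \<Longrightarrow> varpi C A \<in> hom C (prd C (mon C A) (mon C A)) (mon C A)"
    and varpi_natural: "f \<in> hom C A B
      \<Longrightarrow> mmap C f \<cdot> varpi C A = varpi C B \<cdot> cross C (mmap C f) (mmap C f)"
    and varpi_delta: "A \<in> obj C
      \<Longrightarrow> varpi C A \<cdot> pair C (ide C (mon C A)) (delta C A \<cdot> bang C (mon C A)) = ide C (mon C A)"
    and varpi_comm: "A \<in> obj C
      \<Longrightarrow> varpi C A \<cdot> pair C (pr2 C (mon C A) (mon C A)) (pr1 C (mon C A) (mon C A)) = varpi C A"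
    and varpi_idem: "A \<in> obj C
      \<Longrightarrow> varpi C A \<cdot> pair C (ide C (mon C A)) (ide C (mon C A)) = ide C (mon C A)"
    and varpi_assoc: "A \<in> obj C
      \<Longrightarrow> varpi C A \<cdot> cross C (ide C (mon C A)) (varpi C A) \<cdot> assoc C (mon C A) (mon C A) (mon C A) =
          varpi C A \<cdot> cross C (varpi C A) (ide C (mon C A))"
    and ext_delta: "\<lbrakk>B \<in> obj C; f \<in> hom C A (mon C B)\<rbrakk> \<Longrightarrow> ext C A B f \<cdot> delta C A = delta C B"
    and ext_varpi: "\<lbrakk>B \<in> obj C; f \<in> hom C A (mon C B)\<rbrakk>
      \<Longrightarrow> ext C A B f \<cdot> varpi C A =
          varpi C B \<cdot> pair C (ext C A B f \<cdot> pr1 C (mon C A) (mon C A))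
                             (ext C A B f \<cdot> pr2 C (mon C A) (mon C A))"
    and tau_delta: "\<lbrakk>B \<in> obj C; f \<in> hom C X A\<rbrakk>
      \<Longrightarrow> tau C A B \<cdot> cross C f (delta C B) = delta C (prd C A B) \<cdot> bang C (prd C X (one C))"
    and tau_varpi: "\<lbrakk>B \<in> obj C; f \<in> hom C X A\<rbrakk>
      \<Longrightarrow> tau C A B \<cdot> cross C f (varpi C B) =
          varpi C (prd C A B) \<cdot> pair C (tau C A B \<cdot> cross C f (pr1 C (mon C B) (mon C B)))
                                       (tau C A B \<cdot> cross C f (pr2 C (mon C B) (mon C B)))"

text \<open>
  \<open>h\<close> is a morphism from the coalgebra \<open>f : X \<rightarrow> T (X + A)\<close> to \<open>out A : R A \<rightarrow> T (R A + A)\<close>.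
\<close>

definition coalg_mor :: "('o, 'm, 'x) monad_data_scheme \<Rightarrow> 'o \<Rightarrow> 'm \<Rightarrow> 'm \<Rightarrow> bool" where
  "coalg_mor C A f h \<longleftrightarrow> h \<in> hom C (src C f) (res C A) \<and>
     out C A \<cdot>\<^bsub>C\<^esub> h = mmap C (cosum C h (ide C A)) \<cdot>\<^bsub>C\<^esub> f"

definition coit :: "('o, 'm, 'x) monad_data_scheme \<Rightarrow> 'o \<Rightarrow> 'm \<Rightarrow> 'm" where
  "coit C A f = (THE h. coalg_mor C A f h)"

text \<open>The functorial action of \<open>R\<close>.\<close>

definition rmap :: "('o, 'm, 'x) monad_data_scheme \<Rightarrow> 'm \<Rightarrow> 'm" where
  "rmap C g = coit C (trg C g) (mmap C (cosum C (ide C (res C (src C g))) g) \<cdot>\<^bsub>C\<^esub> out C (src C g))"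

locale resumption_category = semi_additive_monad C
  for C :: "('o, 'm, 'x) monad_data_scheme" (structure) +
  assumes res_obj: "A \<in> obj C \<Longrightarrow> res C A \<in> obj C"
    and out_hom: "A \<in> obj C \<Longrightarrow> out C A \<in> hom C (res C A) (mon C (cpr C (res C A) A))"
    and final: "\<lbrakk>A \<in> obj C; X \<in> obj C; f \<in> hom C X (mon C (cpr C X A))\<rbrakk>
      \<Longrightarrow> \<exists>!h. coalg_mor C A f h"

section \<open>Models and satisfaction\<close>

record ('o, 'm, 'w, 'f) model_data = "('o, 'm) monad_data" +
  atom_int :: "'w \<Rightarrow> 'o"
  fun_int :: "'f \<Rightarrow> 'm"

primrec ty_sem :: "('o, 'm, 'w, 'f) model_data \<Rightarrow> 'w ty \<Rightarrow> 'o" where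
  "ty_sem M (TAtom w) = atom_int M w"
| "ty_sem M TOne = one M"
| "ty_sem M (TProd A B) = prd M (ty_sem M A) (ty_sem M B)"
| "ty_sem M (TSum A B) = cpr M (ty_sem M A) (ty_sem M B)"
| "ty_sem M (TMon A) = mon M (ty_sem M A)"
| "ty_sem M (TNu A) = res M (ty_sem M A)"

definition me_nu_model :: "('w, 'f) signature \<Rightarrow> ('o, 'm, 'w, 'f) model_data \<Rightarrow> bool" where
  "me_nu_model \<Sigma> M \<longleftrightarrow> resumption_category M \<and>
     (\<forall>w\<in>atoms \<Sigma>. atom_int M w \<in> obj M) \<and>
     (\<forall>f\<in>funs \<Sigma>. fun_int M f \<in> hom M (ty_sem M (fdom \<Sigma> f)) (ty_sem M (fcod \<Sigma> f)))"

primrec ctx_sem :: "('o, 'm, 'w, 'f) model_data \<Rightarrow> 'w ctx \<Rightarrow> 'o" where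
  "ctx_sem M [] = one M"
| "ctx_sem M (A # \<Gamma>) = prd M (ctx_sem M \<Gamma>) (ty_sem M A)"

fun var_sem :: "('o, 'm, 'w, 'f) model_data \<Rightarrow> 'w ctx \<Rightarrow> nat \<Rightarrow> 'm" where
  "var_sem M [] i = undefined"
| "var_sem M (A # \<Gamma>) 0 = pr2 M (ctx_sem M \<Gamma>) (ty_sem M A)"
| "var_sem M (A # \<Gamma>) (Suc i) = var_sem M \<Gamma> i \<cdot>\<^bsub>M\<^esub> pr1 M (ctx_sem M \<Gamma>) (ty_sem M A)"

fun sem :: "('w, 'f) signature \<Rightarrow> ('o, 'm, 'w, 'f) model_data \<Rightarrow> 'w ctx \<Rightarrow> ('w, 'f) tm \<Rightarrow> 'm" where
  "sem \<Sigma> M \<Gamma> (Var i) = var_sem M \<Gamma> i"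
| "sem \<Sigma> M \<Gamma> (Fn f t) = fun_int M f \<cdot>\<^bsub>M\<^esub> sem \<Sigma> M \<Gamma> t"
| "sem \<Sigma> M \<Gamma> Star = bang M (ctx_sem M \<Gamma>)"
| "sem \<Sigma> M \<Gamma> (Tup t u) = pair M (sem \<Sigma> M \<Gamma> t) (sem \<Sigma> M \<Gamma> u)"
| "sem \<Sigma> M \<Gamma> (Fst t) =
    (let P = ty_of \<Sigma> \<Gamma> t in pr1 M (ty_sem M (lty P)) (ty_sem M (rty P)) \<cdot>\<^bsub>M\<^esub> sem \<Sigma> M \<Gamma> t)"
| "sem \<Sigma> M \<Gamma> (Snd t) =
    (let P = ty_of \<Sigma> \<Gamma> t in pr2 M (ty_sem M (lty P)) (ty_sem M (rty P)) \<cdot>\<^bsub>M\<^esub> sem \<Sigma> M \<Gamma> t)"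
| "sem \<Sigma> M \<Gamma> (InL B t) = in1 M (ty_sem M (ty_of \<Sigma> \<Gamma> t)) (ty_sem M B) \<cdot>\<^bsub>M\<^esub> sem \<Sigma> M \<Gamma> t"
| "sem \<Sigma> M \<Gamma> (InR A t) = in2 M (ty_sem M A) (ty_sem M (ty_of \<Sigma> \<Gamma> t)) \<cdot>\<^bsub>M\<^esub> sem \<Sigma> M \<Gamma> t"
| "sem \<Sigma> M \<Gamma> (Case s t u) =
    (let G = ctx_sem M \<Gamma>; A = lty (ty_of \<Sigma> \<Gamma> s); B = rty (ty_of \<Sigma> \<Gamma> s) in
       copair M (sem \<Sigma> M (A # \<Gamma>) t) (sem \<Sigma> M (B # \<Gamma>) u)
         \<cdot>\<^bsub>M\<^esub> dist M G (ty_sem M A) (ty_sem M B) \<cdot>\<^bsub>M\<^esub> pair M (ide M G) (sem \<Sigma> M \<Gamma> s))"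
| "sem \<Sigma> M \<Gamma> (Ret t) = eta M (ty_sem M (ty_of \<Sigma> \<Gamma> t)) \<cdot>\<^bsub>M\<^esub> sem \<Sigma> M \<Gamma> t"
| "sem \<Sigma> M \<Gamma> (Do p q) =
    (let G = ctx_sem M \<Gamma>; A = argty (ty_of \<Sigma> \<Gamma> p); B = argty (ty_of \<Sigma> (A # \<Gamma>) q) in
       ext M (prd M G (ty_sem M A)) (ty_sem M B) (sem \<Sigma> M (A # \<Gamma>) q)
         \<cdot>\<^bsub>M\<^esub> tau M G (ty_sem M A) \<cdot>\<^bsub>M\<^esub> pair M (ide M G) (sem \<Sigma> M \<Gamma> p))"
| "sem \<Sigma> M \<Gamma> (Dead A) = delta M (ty_sem M A) \<cdot>\<^bsub>M\<^esub> bang M (ctx_sem M \<Gamma>)"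
| "sem \<Sigma> M \<Gamma> (Choice p q) =
    varpi M (ty_sem M (argty (ty_of \<Sigma> \<Gamma> p))) \<cdot>\<^bsub>M\<^esub> pair M (sem \<Sigma> M \<Gamma> p) (sem \<Sigma> M \<Gamma> q)"
| "sem \<Sigma> M \<Gamma> (Out p) = out M (ty_sem M (argty (ty_of \<Sigma> \<Gamma> p))) \<cdot>\<^bsub>M\<^esub> sem \<Sigma> M \<Gamma> p"
| "sem \<Sigma> M \<Gamma> (Unfold p q) =
    (let G = ctx_sem M \<Gamma>; A = ty_of \<Sigma> \<Gamma> p; B = rty (argty (ty_of \<Sigma> (A # \<Gamma>) q));
         a = ty_sem M A; b = ty_sem M B;
         f = mmap M (dist M G a b) \<cdot>\<^bsub>M\<^esub> tau M G (cpr M a b)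
               \<cdot>\<^bsub>M\<^esub> pair M (pr1 M G a) (sem \<Sigma> M (A # \<Gamma>) q) in
       rmap M (pr2 M G b) \<cdot>\<^bsub>M\<^esub> coit M (prd M G b) f \<cdot>\<^bsub>M\<^esub> pair M (ide M G) (sem \<Sigma> M \<Gamma> p))"

definition satisfies ::
  "('w, 'f) signature \<Rightarrow> ('o, 'm, 'w, 'f) model_data \<Rightarrow> ('w, 'f) equation \<Rightarrow> bool" where
  "satisfies \<Sigma> M = (\<lambda>(\<Gamma>, t, s, A). sem \<Sigma> M \<Gamma> t = sem \<Sigma> M \<Gamma> s)"

end

theory Submission
  imports Defs
begin

text \<open>
  Soundness rests on the operator \<open>bind f p = f\<^sup>\<star> \<circ> \<tau> \<circ> \<langle>id, p\<rangle>\<close>, which satisfies the laws of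
  \<open>do\<close>, and on the finality of the coalgebras: both sides of the co-iteration rule say that the
  interpretation of \<open>p\<close> is the unique coalgebra morphism out of the coalgebra with carrier \<open>\<Gamma> \<times> A\<close>
  determined by \<open>q\<close>.

  Completeness uses the term model over \<open>\<Phi>\<close>: objects are types, morphisms \<open>A \<rightarrow> B\<close> are terms
  \<open>x : A \<rhd> t : B\<close> up to derivable equality, and composition is substitution. A context is encoded
  as the nested product of its types. Since the signature is countable, so is this model, and hence
  it can be carried by any two infinite types of objects and morphisms. The co-iteration rule, read in
  both directions, says precisely that \<open>unfold\<close> is the mediating morphism into the final coalgebra.
\<close>

section \<open>Categories with products and coproducts\<close>

text \<open>Two mismatches shape the work. The calculus binds variables in contexts of any length,
  while a morphism of the term model has a single variable. Every binder is therefore matched with a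
  morphism out of a product of the context and the bound type, beta rules for pairs mediate between
  the two readings, and completeness needs a final argument that encoding a context as a product
  identifies no terms beyond derivable equality. The interpretation of \<open>unfold\<close> is a
  composite of strength, distributivity, coiteration and relabelling, unwieldy to evaluate on terms.
  It is never evaluated: a lemma valid in every model says that it is the only solution of the
  equation in the co-iteration rule, and this one lemma gives soundness of both directions of the
  rule as well as the value of \<open>unfold\<close> in the term model. Equations between composites
  are left to rewriting: composites are nested to the right, \<open>cross\<close>,
  \<open>cosum\<close> and \<open>mmap\<close> are unfolded, and pairs, copairs and Kleisli liftings
  absorb what is composed with them.\<close>

context category
begin

lemma hom_iff: "f \<in> hom C A B \<longleftrightarrow> f \<in> arr C \<and> src C f = A \<and> trg C f = B"
  by (simp add: hom_def)

lemma homD [dest]: "f \<in> hom C A B \<Longrightarrow> f \<in> arr C \<and> src C f = A \<and> trg C f = B"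
  by (simp add: hom_def)

lemma src_obj [simp]: "f \<in> arr C \<Longrightarrow> src C f \<in> obj C"
  and trg_obj [simp]: "f \<in> arr C \<Longrightarrow> trg C f \<in> obj C"
  using arr_obj by auto

lemma ide_arr [simp]:
  assumes "A \<in> obj C"
  shows "ide C A \<in> arr C" "src C (ide C A) = A" "trg C (ide C A) = A"
  using ide_hom[OF assms] by auto

text \<open>The middle object of a composite in hom-set notation cannot be guessed by rewriting.
  Restated with \<open>arr\<close>, \<open>src\<close> and \<open>trg\<close>, the side conditions
  of the laws become computations of sources and targets.\<close>

lemma comp_arr [simp]:
  assumes "f \<in> arr C" "g \<in> arr C" "src C g = trg C f"
  shows "g \<cdot> f \<in> arr C" "src C (g \<cdot> f) = src C f" "trg C (g \<cdot> f) = trg C g"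
  using comp_hom[of f "src C f" "trg C f" g "trg C g"] assms by (auto simp: hom_iff)

lemma comp_assoc_arr [simp]:
  assumes "f \<in> arr C" "g \<in> arr C" "h \<in> arr C" "src C g = trg C f" "src C h = trg C g"
  shows "(h \<cdot> g) \<cdot> f = h \<cdot> (g \<cdot> f)"
  using comp_assoc[of f "src C f" "trg C f" g "trg C g" h "trg C h"] assms by (auto simp: hom_iff)

lemma comp_ide_arr [simp]: "f \<in> arr C \<Longrightarrow> src C f = A \<Longrightarrow> f \<cdot> ide C A = f"
  using comp_ide by (auto simp: hom_iff)

lemma ide_comp_arr [simp]: "f \<in> arr C \<Longrightarrow> trg C f = A \<Longrightarrow> ide C A \<cdot> f = f"
  using ide_comp by (auto simp: hom_iff)

end

text \<open>The assumptions of \<open>distributive_category\<close> are split so that the calculus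
  of pairs is already available for the term model while its coproducts and its distributivity are
  still to be proved.\<close>

locale cartesian_category = category C
  for C :: "('o, 'm, 'x) dist_data_scheme" (structure) +
  assumes one_obj [simp]: "one C \<in> obj C"
    and terminal: "A \<in> obj C \<Longrightarrow> \<exists>!f. f \<in> hom C A (one C)"
    and prd_obj [simp]: "\<lbrakk>A \<in> obj C; B \<in> obj C\<rbrakk> \<Longrightarrow> prd C A B \<in> obj C"
    and pr1_hom: "\<lbrakk>A \<in> obj C; B \<in> obj C\<rbrakk> \<Longrightarrow> pr1 C A B \<in> hom C (prd C A B) A"
    and pr2_hom: "\<lbrakk>A \<in> obj C; B \<in> obj C\<rbrakk> \<Longrightarrow> pr2 C A B \<in> hom C (prd C A B) B"
    and product: "\<lbrakk>f \<in> hom C X A; g \<in> hom C X B\<rbrakk>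
      \<Longrightarrow> \<exists>!h. h \<in> hom C X (prd C A B) \<and> pr1 C A B \<cdot> h = f \<and> pr2 C A B \<cdot> h = g"
begin

lemma pr_arr [simp]:
  assumes "A \<in> obj C" "B \<in> obj C"
  shows "pr1 C A B \<in> arr C" "src C (pr1 C A B) = prd C A B" "trg C (pr1 C A B) = A"
    "pr2 C A B \<in> arr C" "src C (pr2 C A B) = prd C A B" "trg C (pr2 C A B) = B"
  using pr1_hom[OF assms] pr2_hom[OF assms] by auto

lemma bang_hom: "A \<in> obj C \<Longrightarrow> bang C A \<in> hom C A (one C)"
  unfolding bang_def using theI'[OF terminal] .

lemma bang_arr [simp]:
  assumes "A \<in> obj C"
  shows "bang C A \<in> arr C" "src C (bang C A) = A" "trg C (bang C A) = one C"
  using bang_hom[OF assms] by auto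

lemma bang_unique: "f \<in> arr C \<Longrightarrow> trg C f = one C \<Longrightarrow> src C f = A \<Longrightarrow> f = bang C A"
  using terminal[of A] bang_hom[of A] by (auto simp: hom_iff)

lemma bang_comp [simp]:
  "f \<in> arr C \<Longrightarrow> trg C f = A \<Longrightarrow> bang C A \<cdot> f = bang C (src C f)"
  by (rule bang_unique) auto

lemma bang_one: "bang C (one C) = ide C (one C)"
  by (rule bang_unique[symmetric]) auto

lemma pair_props:
  assumes "f \<in> arr C" "g \<in> arr C" "src C g = src C f"
  shows "pair C f g \<in> hom C (src C f) (prd C (trg C f) (trg C g)) \<and>
    pr1 C (trg C f) (trg C g) \<cdot> pair C f g = f \<and> pr2 C (trg C f) (trg C g) \<cdot> pair C f g = g"
  unfolding pair_def by (rule theI', rule product) (auto simp: hom_iff assms)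

lemma pair_arr [simp]:
  assumes "f \<in> arr C" "g \<in> arr C" "src C g = src C f"
  shows "pair C f g \<in> arr C" "src C (pair C f g) = src C f"
    "trg C (pair C f g) = prd C (trg C f) (trg C g)"
  using pair_props[OF assms] by auto

lemma pr_pair [simp]:
  assumes "f \<in> arr C" "g \<in> arr C" "src C g = src C f" "trg C f = A" "trg C g = B"
  shows "pr1 C A B \<cdot> pair C f g = f" "pr2 C A B \<cdot> pair C f g = g"
  using pair_props[OF assms(1-3)] assms(4,5) by auto

text \<open>Joint monicity of the projections, to which the equations between pairs are
  reduced.\<close>

lemma prd_eqI:
  assumes "h \<in> arr C" "k \<in> arr C" "trg C h = prd C A B" "trg C k = prd C A B" "src C h = src C k"
    and "A \<in> obj C" "B \<in> obj C"
    and "pr1 C A B \<cdot> h = pr1 C A B \<cdot> k" "pr2 C A B \<cdot> h = pr2 C A B \<cdot> k"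
  shows "h = k"
  using product[of "pr1 C A B \<cdot> h" "src C h" A "pr2 C A B \<cdot> h" B] assms
  by (auto simp: hom_iff)

lemma pair_comp [simp]:
  assumes "f \<in> arr C" "g \<in> arr C" "src C g = src C f" "h \<in> arr C" "trg C h = src C f"
  shows "pair C f g \<cdot> h = pair C (f \<cdot> h) (g \<cdot> h)"
  by (rule prd_eqI[of _ _ "trg C f" "trg C g"])
    (use assms in \<open>auto simp: comp_assoc_arr[symmetric] simp del: comp_assoc_arr\<close>)

lemma pair_eta [simp]:
  "\<lbrakk>h \<in> arr C; trg C h = prd C A B; A \<in> obj C; B \<in> obj C\<rbrakk>
    \<Longrightarrow> pair C (pr1 C A B \<cdot> h) (pr2 C A B \<cdot> h) = h"
  by (rule prd_eqI[of _ _ A B]) auto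

lemma pair_pr [simp]:
  "\<lbrakk>A \<in> obj C; B \<in> obj C\<rbrakk> \<Longrightarrow> pair C (pr1 C A B) (pr2 C A B) = ide C (prd C A B)"
  using pair_eta[of "ide C (prd C A B)" A B] by simp

end

lemmas (in cartesian_category) cross_unfold [simp] = cross_def[of C]

section \<open>Finite coproducts\<close>

locale bicartesian_category = cartesian_category C
  for C :: "('o, 'm, 'x) dist_data_scheme" (structure) +
  assumes cpr_obj [simp]: "\<lbrakk>A \<in> obj C; B \<in> obj C\<rbrakk> \<Longrightarrow> cpr C A B \<in> obj C"
    and in1_hom: "\<lbrakk>A \<in> obj C; B \<in> obj C\<rbrakk> \<Longrightarrow> in1 C A B \<in> hom C A (cpr C A B)"
    and in2_hom: "\<lbrakk>A \<in> obj C; B \<in> obj C\<rbrakk> \<Longrightarrow> in2 C A B \<in> hom C B (cpr C A B)"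
    and coproduct: "\<lbrakk>f \<in> hom C A X; g \<in> hom C B X\<rbrakk>
      \<Longrightarrow> \<exists>!h. h \<in> hom C (cpr C A B) X \<and> h \<cdot> in1 C A B = f \<and> h \<cdot> in2 C A B = g"
begin

lemma in_arr [simp]:
  assumes "A \<in> obj C" "B \<in> obj C"
  shows "in1 C A B \<in> arr C" "src C (in1 C A B) = A" "trg C (in1 C A B) = cpr C A B"
    "in2 C A B \<in> arr C" "src C (in2 C A B) = B" "trg C (in2 C A B) = cpr C A B"
  using in1_hom[OF assms] in2_hom[OF assms] by auto

lemma copair_props:
  assumes "f \<in> arr C" "g \<in> arr C" "trg C g = trg C f"
  shows "copair C f g \<in> hom C (cpr C (src C f) (src C g)) (trg C f) \<and>
    copair C f g \<cdot> in1 C (src C f) (src C g) = f \<and> copair C f g \<cdot> in2 C (src C f) (src C g) = g"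
  unfolding copair_def by (rule theI', rule coproduct) (auto simp: hom_iff assms)

lemma copair_arr [simp]:
  assumes "f \<in> arr C" "g \<in> arr C" "trg C g = trg C f"
  shows "copair C f g \<in> arr C" "src C (copair C f g) = cpr C (src C f) (src C g)"
    "trg C (copair C f g) = trg C f"
  using copair_props[OF assms] by auto

lemma copair_in [simp]:
  assumes "f \<in> arr C" "g \<in> arr C" "trg C g = trg C f" "src C f = A" "src C g = B"
  shows "copair C f g \<cdot> in1 C A B = f" "copair C f g \<cdot> in2 C A B = g"
  using copair_props[OF assms(1-3)] assms(4,5) by auto

text \<open>Composites are nested to the right, so the laws of \<open>copair_in\<close> need a
  second form in which a further factor \<open>h\<close> stands to the right of the
  injection.\<close>

lemma copair_in_comp [simp]:
  assumes "f \<in> arr C" "g \<in> arr C" "trg C g = trg C f" "src C f = A" "src C g = B"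
  shows "h \<in> arr C \<Longrightarrow> trg C h = A \<Longrightarrow> copair C f g \<cdot> in1 C A B \<cdot> h = f \<cdot> h"
    "h \<in> arr C \<Longrightarrow> trg C h = B \<Longrightarrow> copair C f g \<cdot> in2 C A B \<cdot> h = g \<cdot> h"
  using assms by (auto simp: comp_assoc_arr[symmetric] simp del: comp_assoc_arr)

lemma cpr_eqI:
  assumes "h \<in> arr C" "k \<in> arr C" "src C h = cpr C A B" "src C k = cpr C A B" "trg C h = trg C k"
    and "A \<in> obj C" "B \<in> obj C"
    and "h \<cdot> in1 C A B = k \<cdot> in1 C A B" "h \<cdot> in2 C A B = k \<cdot> in2 C A B"
  shows "h = k"
  using coproduct[of "h \<cdot> in1 C A B" A "trg C h" "h \<cdot> in2 C A B" B] assms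
  by (auto simp: hom_iff)

lemma comp_copair [simp]:
  assumes "f \<in> arr C" "g \<in> arr C" "trg C g = trg C f" "h \<in> arr C" "src C h = trg C f"
  shows "h \<cdot> copair C f g = copair C (h \<cdot> f) (h \<cdot> g)"
  by (rule cpr_eqI[of _ _ "src C f" "src C g"]) (use assms in auto)

lemma copair_comp [simp]:
  assumes "f \<in> arr C" "g \<in> arr C" "trg C g = trg C f" "h \<in> arr C" "src C h = trg C f"
    "k \<in> arr C" "trg C k = cpr C (src C f) (src C g)"
  shows "h \<cdot> copair C f g \<cdot> k = copair C (h \<cdot> f) (h \<cdot> g) \<cdot> k"
  using assms by (simp flip: comp_copair comp_assoc_arr)

lemma copair_eta [simp]:
  "\<lbrakk>A \<in> obj C; B \<in> obj C\<rbrakk> \<Longrightarrow> copair C (in1 C A B) (in2 C A B) = ide C (cpr C A B)"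
  by (rule cpr_eqI[of _ _ A B]) auto

lemma cosum_unfold [simp]: "cosum C f g = copair C (in1 C (trg C f) (trg C g) \<cdot> f) (in2 C (trg C f) (trg C g) \<cdot> g)"
  by (simp add: cosum_def)

end

sublocale distributive_category \<subseteq> bicartesian_category
  by unfold_locales
    (simp_all add: one_obj terminal prd_obj pr1_hom pr2_hom product cpr_obj in1_hom in2_hom coproduct)

section \<open>Distributivity and the interpretation of case\<close>

context distributive_category
begin

text \<open>\<open>dist\<close> is a definite description; it denotes because an inverse of
  \<open>codist\<close> is unique.\<close>

lemma dist_inverse:
  assumes "X \<in> obj C" "Y \<in> obj C" "Z \<in> obj C"
  shows "inverse_pair C (prd C X (cpr C Y Z)) (cpr C (prd C X Y) (prd C X Z)) (dist C X Y Z) (codist C X Y Z)"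
  unfolding dist_def
proof (rule theI')
  obtain d where d: "inverse_pair C (prd C X (cpr C Y Z)) (cpr C (prd C X Y) (prd C X Z)) d (codist C X Y Z)"
    using distributive[OF assms] by blast
  show "\<exists>!d. inverse_pair C (prd C X (cpr C Y Z)) (cpr C (prd C X Y) (prd C X Z)) d (codist C X Y Z)"
  proof (rule ex1I[of _ d], rule d)
    fix e assume e: "inverse_pair C (prd C X (cpr C Y Z)) (cpr C (prd C X Y) (prd C X Z)) e (codist C X Y Z)"
    have "e = e \<cdot> codist C X Y Z \<cdot> d"
      using d e by (auto simp: inverse_pair_def hom_iff)
    also have "\<dots> = (e \<cdot> codist C X Y Z) \<cdot> d"
      using d e by (intro comp_assoc_arr[symmetric]) (auto simp: inverse_pair_def hom_iff)
    also have "\<dots> = d" using d e by (auto simp: inverse_pair_def hom_iff)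
    finally show "e = d" .
  qed
qed

lemma dist_arr [simp]:
  assumes "X \<in> obj C" "Y \<in> obj C" "Z \<in> obj C"
  shows "dist C X Y Z \<in> arr C" "src C (dist C X Y Z) = prd C X (cpr C Y Z)"
    "trg C (dist C X Y Z) = cpr C (prd C X Y) (prd C X Z)"
  using dist_inverse[OF assms] by (auto simp: inverse_pair_def)

lemma dist_codist:
  assumes "X \<in> obj C" "Y \<in> obj C" "Z \<in> obj C"
  shows "codist C X Y Z \<in> arr C" "src C (codist C X Y Z) = cpr C (prd C X Y) (prd C X Z)"
    "trg C (codist C X Y Z) = prd C X (cpr C Y Z)"
    "codist C X Y Z \<cdot> dist C X Y Z = ide C (prd C X (cpr C Y Z))"
    "dist C X Y Z \<cdot> codist C X Y Z = ide C (cpr C (prd C X Y) (prd C X Z))"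
  using dist_inverse[OF assms] by (auto simp: inverse_pair_def)

text \<open>\<open>codist\<close> sends an injected pair to the pair whose second component is
  injected; cancelling \<open>codist\<close> against \<open>dist\<close> gives both
  equations.\<close>

lemma dist_in [simp]:
  assumes "a \<in> arr C" "b \<in> arr C" "src C a = src C b" "trg C a = X" "Y \<in> obj C" "Z \<in> obj C"
  shows "trg C b = Y \<Longrightarrow> dist C X Y Z \<cdot> pair C a (in1 C Y Z \<cdot> b) = in1 C (prd C X Y) (prd C X Z) \<cdot> pair C a b"
    and "trg C b = Z \<Longrightarrow> dist C X Y Z \<cdot> pair C a (in2 C Y Z \<cdot> b) = in2 C (prd C X Y) (prd C X Z) \<cdot> pair C a b"
proof -
  have X: "X \<in> obj C" using assms by auto
  note cd = dist_codist[OF X assms(5,6)]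
  have "(dist C X Y Z \<cdot> codist C X Y Z) \<cdot> j = j" if "j \<in> arr C" "trg C j = cpr C (prd C X Y) (prd C X Z)" for j
    using cd(5) that by simp
  hence key: "dist C X Y Z \<cdot> codist C X Y Z \<cdot> j = j" if "j \<in> arr C" "trg C j = cpr C (prd C X Y) (prd C X Z)" for j
    using cd(1-3) that X assms by simp
  show "dist C X Y Z \<cdot> pair C a (in1 C Y Z \<cdot> b) = in1 C (prd C X Y) (prd C X Z) \<cdot> pair C a b" if "trg C b = Y"
    using key[of "in1 C (prd C X Y) (prd C X Z) \<cdot> pair C a b"] that assms X by (simp add: codist_def)
  show "dist C X Y Z \<cdot> pair C a (in2 C Y Z \<cdot> b) = in2 C (prd C X Y) (prd C X Z) \<cdot> pair C a b" if "trg C b = Z"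
    using key[of "in2 C (prd C X Y) (prd C X Z) \<cdot> pair C a b"] that assms X by (simp add: codist_def)
qed

text \<open>Precomposition with the isomorphism \<open>codist\<close> turns the claim into
  uniqueness of copairing. This is the semantic principle of case distinction under a
  context.\<close>

lemma prd_cpr_eqI:
  assumes "h \<in> arr C" "k \<in> arr C" "src C h = prd C X (cpr C Y Z)" "src C k = prd C X (cpr C Y Z)"
    "trg C h = trg C k" "X \<in> obj C" "Y \<in> obj C" "Z \<in> obj C"
    and 1: "h \<cdot> pair C (pr1 C X Y) (in1 C Y Z \<cdot> pr2 C X Y) = k \<cdot> pair C (pr1 C X Y) (in1 C Y Z \<cdot> pr2 C X Y)"
    and 2: "h \<cdot> pair C (pr1 C X Z) (in2 C Y Z \<cdot> pr2 C X Z) = k \<cdot> pair C (pr1 C X Z) (in2 C Y Z \<cdot> pr2 C X Z)"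
  shows "h = k"
proof -
  note cd = dist_codist[OF assms(6-8)]
  have "h \<cdot> codist C X Y Z = k \<cdot> codist C X Y Z"
    using assms by (simp add: codist_def)
  hence "(h \<cdot> codist C X Y Z) \<cdot> dist C X Y Z = (k \<cdot> codist C X Y Z) \<cdot> dist C X Y Z" by simp
  thus ?thesis using cd assms by simp
qed

text \<open>Naturality of distributivity in the context: \<open>h\<close> leaves the pairing and
  acts on both summands. The natural square is verified summand by summand and then composed with
  the pairing of the identity and \<open>k\<close>.\<close>

lemma dist_cross:
  assumes "h \<in> arr C" "trg C h = X" "k \<in> arr C" "src C k = src C h" "trg C k = cpr C Y Z"
    "Y \<in> obj C" "Z \<in> obj C"
  shows "dist C X Y Z \<cdot> pair C h k
    = cosum C (cross C h (ide C Y)) (cross C h (ide C Z)) \<cdot> dist C (src C h) Y Z \<cdot> pair C (ide C (src C h)) k"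
proof -
  have X: "X \<in> obj C" using assms by auto
  have "dist C X Y Z \<cdot> cross C h (ide C (cpr C Y Z))
    = cosum C (cross C h (ide C Y)) (cross C h (ide C Z)) \<cdot> dist C (src C h) Y Z"
    by (rule prd_cpr_eqI[of _ _ "src C h" Y Z]) (use assms X in auto)
  hence "(dist C X Y Z \<cdot> cross C h (ide C (cpr C Y Z))) \<cdot> pair C (ide C (src C h)) k
    = (cosum C (cross C h (ide C Y)) (cross C h (ide C Z)) \<cdot> dist C (src C h) Y Z) \<cdot> pair C (ide C (src C h)) k" by simp
  thus ?thesis using assms X by simp
qed

text \<open>Semantic counterpart of substitution into a case term. Under the binders
  \<open>h\<close> becomes \<open>cross C h (ide C A)\<close>, which mirrors
  \<open>lift_sub\<close>.\<close>

lemma case_nat: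
  assumes "t \<in> arr C" "u \<in> arr C" "src C t = prd C X A" "src C u = prd C X B" "trg C u = trg C t"
    "s \<in> arr C" "src C s = X" "trg C s = cpr C A B" "A \<in> obj C" "B \<in> obj C"
    "h \<in> arr C" "trg C h = X"
  shows "(copair C t u \<cdot> dist C X A B \<cdot> pair C (ide C X) s) \<cdot> h
    = copair C (t \<cdot> cross C h (ide C A)) (u \<cdot> cross C h (ide C B)) \<cdot> dist C (src C h) A B
        \<cdot> pair C (ide C (src C h)) (s \<cdot> h)"
proof -
  have "X \<in> obj C" using assms by auto
  thus ?thesis using assms by (simp add: dist_cross[of h X "s \<cdot> h" A B])
qed

text \<open>The eta law of case: a map out of a product with a sum is determined by its restrictions
  to the two summands, here called \<open>t\<close> and \<open>u\<close>.\<close>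

lemma case_unique:
  assumes "h \<in> arr C" "src C h = prd C X (cpr C A B)" "X \<in> obj C" "A \<in> obj C" "B \<in> obj C"
    "h \<cdot> pair C (pr1 C X A) (in1 C A B \<cdot> pr2 C X A) = t"
    "h \<cdot> pair C (pr1 C X B) (in2 C A B \<cdot> pr2 C X B) = u"
  shows "copair C t u \<cdot> dist C X A B = h"
  by (rule prd_cpr_eqI[of _ _ X A B]) (use assms in \<open>auto\<close>)

end

section \<open>Sequencing in a strong monad\<close>

text \<open>The value objects \<open>A\<close> and \<open>B\<close> are arguments because
  \<open>mon\<close> need not be injective, so they cannot be recovered from \<open>mon C A\<close>
  and \<open>mon C B\<close>; the context is the source of \<open>p\<close>.\<close>

definition bind :: "('o, 'm, 'x) monad_data_scheme \<Rightarrow> 'o \<Rightarrow> 'o \<Rightarrow> 'm \<Rightarrow> 'm \<Rightarrow> 'm" where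
  "bind C A B f p = ext C (prd C (src C p) A) B f \<cdot>\<^bsub>C\<^esub> tau C (src C p) A \<cdot>\<^bsub>C\<^esub> pair C (ide C (src C p)) p"

context strong_monad
begin

lemma mon_obj_simp [simp]: "A \<in> obj C \<Longrightarrow> mon C A \<in> obj C" by (rule mon_obj)

lemma eta_arr [simp]:
  assumes "A \<in> obj C"
  shows "eta C A \<in> arr C" "src C (eta C A) = A" "trg C (eta C A) = mon C A"
  using eta_hom[OF assms] by auto

lemma tau_arr [simp]:
  assumes "A \<in> obj C" "B \<in> obj C"
  shows "tau C A B \<in> arr C" "src C (tau C A B) = prd C A (mon C B)" "trg C (tau C A B) = mon C (prd C A B)"
  using tau_hom[OF assms] by auto

lemma ext_arr [simp]:
  assumes "f \<in> arr C" "src C f = A" "trg C f = mon C B" "B \<in> obj C"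
  shows "ext C A B f \<in> arr C" "src C (ext C A B f) = mon C A" "trg C (ext C A B f) = mon C B"
  using ext_hom[of B f A] assms by (auto simp: hom_iff)

lemma ext_eta_simp [simp]: "A \<in> obj C \<Longrightarrow> ext C A A (eta C A) = ide C (mon C A)"
  by (rule ext_eta)

lemma ext_comp_eta_simp [simp]:
  assumes "f \<in> arr C" "src C f = A" "trg C f = mon C B" "B \<in> obj C"
  shows "ext C A B f \<cdot> eta C A = f"
    and "h \<in> arr C \<Longrightarrow> trg C h = A \<Longrightarrow> ext C A B f \<cdot> eta C A \<cdot> h = f \<cdot> h"
proof -
  show 1: "ext C A B f \<cdot> eta C A = f"
    using ext_comp_eta[of B f A] assms by (auto simp: hom_iff)
  have A: "A \<in> obj C" using assms by auto
  show "h \<in> arr C \<Longrightarrow> trg C h = A \<Longrightarrow> ext C A B f \<cdot> eta C A \<cdot> h = f \<cdot> h"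
    using assms A 1 by (auto simp: comp_assoc_arr[symmetric] simp del: comp_assoc_arr)
qed

lemma ext_ext [simp]:
  assumes "f \<in> arr C" "src C f = A" "trg C f = mon C B" "B \<in> obj C"
    and "g \<in> arr C" "src C g = B" "trg C g = mon C D" "D \<in> obj C"
  shows "ext C B D g \<cdot> ext C A B f = ext C A D (ext C B D g \<cdot> f)"
    and "h \<in> arr C \<Longrightarrow> trg C h = mon C A \<Longrightarrow> ext C B D g \<cdot> ext C A B f \<cdot> h = ext C A D (ext C B D g \<cdot> f) \<cdot> h"
proof -
  show 1: "ext C B D g \<cdot> ext C A B f = ext C A D (ext C B D g \<cdot> f)"
    using ext_comp[of B D f A g] assms by (auto simp: hom_iff)
  show "h \<in> arr C \<Longrightarrow> trg C h = mon C A \<Longrightarrow> ext C B D g \<cdot> ext C A B f \<cdot> h = ext C A D (ext C B D g \<cdot> f) \<cdot> h"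
    using assms by (auto simp: comp_assoc_arr[symmetric] 1 simp del: comp_assoc_arr)
qed

lemma mmap_unfold [simp]: "mmap C f = ext C (src C f) (trg C f) (eta C (trg C f) \<cdot> f)"
  by (simp add: mmap_def)

text \<open>Naturality of the strength in its first argument, taken with the identity in the second:
  an arbitrary context map \<open>f\<close> can be moved past the strength, leaving the pairing with
  the identity that \<open>bind\<close> is built from.\<close>

lemma tau_pair_left:
  assumes "f \<in> arr C" "p \<in> arr C" "src C p = src C f" "trg C f = G" "trg C p = mon C A" "A \<in> obj C"
  shows "tau C G A \<cdot> pair C f p
    = mmap C (cross C f (ide C A)) \<cdot> tau C (src C f) A \<cdot> pair C (ide C (src C f)) p"
proof -
  have G: "G \<in> obj C" using assms by auto
  have "tau C G A \<cdot> cross C f (mmap C (ide C A)) = mmap C (cross C f (ide C A)) \<cdot> tau C (src C f) A"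
    using tau_natural[of f "src C f" G "ide C A" A A] assms G by (auto simp: hom_iff)
  hence "(tau C G A \<cdot> cross C f (mmap C (ide C A))) \<cdot> pair C (ide C (src C f)) p
      = (mmap C (cross C f (ide C A)) \<cdot> tau C (src C f) A) \<cdot> pair C (ide C (src C f)) p"
    by simp
  thus ?thesis using assms G by (simp del: mmap_unfold add: mmap_def)
qed

lemma tau_pair_eta:
  assumes "f \<in> arr C" "a \<in> arr C" "src C a = src C f" "trg C f = G" "trg C a = A"
  shows "tau C G A \<cdot> pair C f (eta C A \<cdot> a) = eta C (prd C G A) \<cdot> pair C f a"
proof -
  have o: "G \<in> obj C" "A \<in> obj C" using assms by auto
  have "(tau C G A \<cdot> cross C (ide C G) (eta C A)) \<cdot> pair C f a = eta C (prd C G A) \<cdot> pair C f a"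
    by (simp only: tau_eta[OF o])
  thus ?thesis using assms o by simp
qed

text \<open>The strength axioms speak of the multiplication and of naturality. Factoring the lifting
  of \<open>q\<close> as \<open>mu C B\<close> after \<open>mmap C q\<close> lets the two be
  combined into a law for Kleisli liftings.\<close>

lemma tau_pair_ext:
  assumes "q \<in> arr C" "src C q = A" "trg C q = mon C B" "B \<in> obj C"
    and "f \<in> arr C" "p \<in> arr C" "src C p = src C f" "trg C f = G" "trg C p = mon C A"
  shows "tau C G B \<cdot> pair C f (ext C A B q \<cdot> p)
    = ext C (prd C G A) (prd C G B) (tau C G B \<cdot> cross C (ide C G) q) \<cdot> tau C G A \<cdot> pair C f p"
proof -
  have o: "G \<in> obj C" "A \<in> obj C" using assms by auto
  have 1: "tau C G (mon C B) \<cdot> cross C (ide C G) (mmap C q) = mmap C (cross C (ide C G) q) \<cdot> tau C G A"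
    using tau_natural[of "ide C G" G G q A "mon C B"] assms o by (auto simp: hom_iff)
  have 2: "ext C A B q = mu C B \<cdot> mmap C q"
    using assms o by (simp add: mu_def)
  have "tau C G B \<cdot> pair C f (ext C A B q \<cdot> p)
      = (tau C G B \<cdot> cross C (ide C G) (mu C B)) \<cdot> cross C (ide C G) (mmap C q) \<cdot> pair C f p"
    using assms o by (simp add: mu_def)
  also have "\<dots> = mu C (prd C G B) \<cdot> mmap C (tau C G B) \<cdot> (tau C G (mon C B) \<cdot> cross C (ide C G) (mmap C q))
    \<cdot> pair C f p"
    unfolding tau_mu[OF o(1) assms(4)] using assms o by (simp add: mu_def)
  also have "\<dots> = ext C (prd C G A) (prd C G B) (tau C G B \<cdot> cross C (ide C G) q) \<cdot> tau C G A \<cdot> pair C f p"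
    unfolding 1 using assms o by (simp add: mu_def)
  finally show ?thesis .
qed

lemma tau_assoc_pair:
  assumes "f \<in> arr C" "g \<in> arr C" "p \<in> arr C" "src C g = src C f" "src C p = src C f"
    "trg C f = A" "trg C g = B" "trg C p = mon C D" "D \<in> obj C"
  shows "tau C A (prd C B D) \<cdot> pair C f (tau C B D \<cdot> pair C g p)
    = mmap C (assoc C A B D) \<cdot> tau C (prd C A B) D \<cdot> pair C (pair C f g) p"
proof -
  have o: "A \<in> obj C" "B \<in> obj C" using assms by auto
  have "(mmap C (assoc C A B D) \<cdot> tau C (prd C A B) D) \<cdot> pair C (pair C f g) p
    = (tau C A (prd C B D) \<cdot> cross C (ide C A) (tau C B D) \<cdot> assoc C A B (mon C D)) \<cdot> pair C (pair C f g) p"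
    using tau_assoc[OF o assms(9)] by simp
  thus ?thesis using assms o by (simp add: assoc_def)
qed

text \<open>The unit axiom concerns the terminal object only; naturality along
  \<open>bang C G\<close> carries it to every context.\<close>

lemma mmap_pr2_tau:
  assumes "G \<in> obj C" "A \<in> obj C"
  shows "mmap C (pr2 C G A) \<cdot> tau C G A = pr2 C G (mon C A)"
proof -
  have "tau C (one C) A \<cdot> cross C (bang C G) (mmap C (ide C A)) = mmap C (cross C (bang C G) (ide C A)) \<cdot> tau C G A"
    using tau_natural[of "bang C G" G "one C" "ide C A" A A] assms by (auto simp: hom_iff)
  hence "mmap C (pr2 C (one C) A) \<cdot> tau C (one C) A \<cdot> cross C (bang C G) (mmap C (ide C A))
      = mmap C (pr2 C (one C) A) \<cdot> mmap C (cross C (bang C G) (ide C A)) \<cdot> tau C G A" by simp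
  hence "(mmap C (pr2 C (one C) A) \<cdot> tau C (one C) A) \<cdot> cross C (bang C G) (mmap C (ide C A))
      = mmap C (pr2 C (one C) A) \<cdot> mmap C (cross C (bang C G) (ide C A)) \<cdot> tau C G A"
    using assms by simp
  thus ?thesis unfolding tau_unit[OF assms(2)] using assms by simp
qed

lemma bind_arr [simp]:
  assumes "f \<in> arr C" "p \<in> arr C" "src C f = prd C (src C p) A" "trg C p = mon C A" "trg C f = mon C B"
    "A \<in> obj C" "B \<in> obj C"
  shows "bind C A B f p \<in> arr C" "src C (bind C A B f p) = src C p" "trg C (bind C A B f p) = mon C B"
  using assms by (simp_all add: bind_def)

lemma bind_pair:
  assumes "f \<in> arr C" "g \<in> arr C" "p \<in> arr C" "src C p = src C g" "trg C g = G"
    "src C f = prd C G A" "trg C p = mon C A" "trg C f = mon C B" "A \<in> obj C" "B \<in> obj C"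
  shows "ext C (prd C G A) B f \<cdot> tau C G A \<cdot> pair C g p = bind C A B (f \<cdot> cross C g (ide C A)) p"
proof -
  have "G \<in> obj C" using assms by auto
  thus ?thesis using assms by (simp add: bind_def tau_pair_left[of g p])
qed

text \<open>Semantic counterpart of substitution into a do term, with \<open>h\<close> lifted over
  the bound variable.\<close>

lemma bind_comp:
  assumes "f \<in> arr C" "p \<in> arr C" "src C f = prd C (src C p) A" "trg C p = mon C A" "trg C f = mon C B"
    "A \<in> obj C" "B \<in> obj C" "h \<in> arr C" "trg C h = src C p"
  shows "bind C A B f p \<cdot> h = bind C A B (f \<cdot> cross C h (ide C A)) (p \<cdot> h)"
  using bind_pair[of f h "p \<cdot> h" "src C p" A B] assms by (simp add: bind_def)

lemma bind_eta:
  assumes "f \<in> arr C" "a \<in> arr C" "src C f = prd C (src C a) A" "trg C a = A" "trg C f = mon C B"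
    "B \<in> obj C"
  shows "bind C A B f (eta C A \<cdot> a) = f \<cdot> pair C (ide C (src C a)) a"
proof -
  have "A \<in> obj C" using assms by auto
  thus ?thesis using assms by (simp add: bind_def tau_pair_eta)
qed

lemma bind_ret:
  assumes "p \<in> arr C" "src C p = G" "trg C p = mon C A" "A \<in> obj C"
  shows "bind C A A (eta C A \<cdot> pr2 C G A) p = p"
proof -
  have G: "G \<in> obj C" using assms by auto
  have "bind C A A (eta C A \<cdot> pr2 C G A) p = (mmap C (pr2 C G A) \<cdot> tau C G A) \<cdot> pair C (ide C G) p"
    using assms G by (simp add: bind_def)
  also have "\<dots> = p" unfolding mmap_pr2_tau[OF G assms(4)] using assms G by simp
  finally show ?thesis .
qed

text \<open>The inner strength carries a second copy of the context. \<open>tau_assoc_pair\<close>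
  regroups the product so that the two copies stand together, and naturality along the diagonal
  \<open>pair C (ide C G) (ide C G)\<close> merges them. What remains on \<open>r\<close> is the
  projection that forgets the first bound variable, the semantic form of
  \<open>wk_under\<close>.\<close>

lemma bind_assoc:
  assumes "p \<in> arr C" "src C p = G" "trg C p = mon C A" "A \<in> obj C"
    and "q \<in> arr C" "src C q = prd C G A" "trg C q = mon C B" "B \<in> obj C"
    and "r \<in> arr C" "src C r = prd C G B" "trg C r = mon C D" "D \<in> obj C"
  shows "bind C B D r (bind C A B q p)
    = bind C A D (bind C B D (r \<cdot> cross C (pr1 C G A) (ide C B)) q) p"
proof -
  have G: "G \<in> obj C" using assms by auto
  have "bind C B D r (bind C A B q p)
    = ext C (prd C G (prd C G A)) D (ext C (prd C G B) D r \<cdot> tau C G B \<cdot> cross C (ide C G) q) \<cdot>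
        tau C G (prd C G A) \<cdot> pair C (ide C G) (tau C G A \<cdot> pair C (ide C G) p)"
    using assms G by (simp add: bind_def tau_pair_ext)
  also have "\<dots> = ext C (prd C (prd C G G) A) D (ext C (prd C G B) D r \<cdot> tau C G B \<cdot> cross C (ide C G) q \<cdot> assoc C G G A)
      \<cdot> tau C (prd C G G) A \<cdot> pair C (pair C (ide C G) (ide C G)) p"
    using assms G by (simp add: tau_assoc_pair assoc_def)
  also have "\<dots> = ext C (prd C G A) D (ext C (prd C G B) D r \<cdot> tau C G B \<cdot> pair C (pr1 C G A) q)
      \<cdot> tau C G A \<cdot> pair C (ide C G) p"
    using assms G by (simp add: tau_pair_left[of "pair C (ide C G) (ide C G)" p] assoc_def)
  also have "\<dots> = bind C A D (bind C B D (r \<cdot> cross C (pr1 C G A) (ide C B)) q) p"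
    using assms G by (simp add: bind_pair)
  finally show ?thesis .
qed

end

section \<open>Semilattice structure on generalized elements\<close>

context semi_additive_monad
begin

lemma delta_arr [simp]:
  assumes "A \<in> obj C"
  shows "delta C A \<in> arr C" "src C (delta C A) = one C" "trg C (delta C A) = mon C A"
  using delta_hom[OF assms] by auto

lemma varpi_arr [simp]:
  assumes "A \<in> obj C"
  shows "varpi C A \<in> arr C" "src C (varpi C A) = prd C (mon C A) (mon C A)" "trg C (varpi C A) = mon C A"
  using varpi_hom[OF assms] by auto

lemma bind_delta:
  assumes "f \<in> arr C" "src C f = prd C G A" "trg C f = mon C B" "G \<in> obj C" "A \<in> obj C" "B \<in> obj C"
  shows "bind C A B f (delta C A \<cdot> bang C G) = delta C B \<cdot> bang C G"
proof -
  have "(tau C G A \<cdot> cross C (ide C G) (delta C A)) \<cdot> pair C (ide C G) (bang C G)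
      = (delta C (prd C G A) \<cdot> bang C (prd C G (one C))) \<cdot> pair C (ide C G) (bang C G)"
    using tau_delta[of A "ide C G" G G] assms by (simp add: hom_iff)
  hence 1: "tau C G A \<cdot> pair C (ide C G) (delta C A \<cdot> bang C G) = delta C (prd C G A) \<cdot> bang C G"
    using assms by simp
  have "(ext C (prd C G A) B f \<cdot> delta C (prd C G A)) \<cdot> bang C G = delta C B \<cdot> bang C G"
    using ext_delta[of B f "prd C G A"] assms by (simp add: hom_iff)
  thus ?thesis using assms by (simp add: bind_def 1)
qed

lemma bind_varpi:
  assumes "f \<in> arr C" "src C f = prd C G A" "trg C f = mon C B" "A \<in> obj C" "B \<in> obj C"
    "p \<in> arr C" "q \<in> arr C" "src C p = G" "src C q = G" "trg C p = mon C A" "trg C q = mon C A"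
  shows "bind C A B f (varpi C A \<cdot> pair C p q) = varpi C B \<cdot> pair C (bind C A B f p) (bind C A B f q)"
proof -
  have G: "G \<in> obj C" using assms by auto
  have "(tau C G A \<cdot> cross C (ide C G) (varpi C A)) \<cdot> pair C (ide C G) (pair C p q)
      = (varpi C (prd C G A) \<cdot> pair C (tau C G A \<cdot> cross C (ide C G) (pr1 C (mon C A) (mon C A)))
                                      (tau C G A \<cdot> cross C (ide C G) (pr2 C (mon C A) (mon C A))))
                                        \<cdot> pair C (ide C G) (pair C p q)"
    using tau_varpi[of A "ide C G" G G] G assms by (simp add: hom_iff)
  hence 1: "tau C G A \<cdot> pair C (ide C G) (varpi C A \<cdot> pair C p q)
    = varpi C (prd C G A) \<cdot> pair C (tau C G A \<cdot> pair C (ide C G) p) (tau C G A \<cdot> pair C (ide C G) q)"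
    using G assms by simp
  have "(ext C (prd C G A) B f \<cdot> varpi C (prd C G A)) \<cdot> pair C (tau C G A \<cdot> pair C (ide C G) p) (tau C G A
    \<cdot> pair C (ide C G) q)
    = (varpi C B \<cdot> pair C (ext C (prd C G A) B f \<cdot> pr1 C (mon C (prd C G A)) (mon C (prd C G A)))
         (ext C (prd C G A) B f \<cdot> pr2 C (mon C (prd C G A)) (mon C (prd C G A)))) \<cdot>
         pair C (tau C G A \<cdot> pair C (ide C G) p) (tau C G A \<cdot> pair C (ide C G) q)"
    using ext_varpi[of B f "prd C G A"] assms by (simp add: hom_iff)
  thus ?thesis using assms G by (simp add: bind_def 1)
qed

text \<open>Composing the internal law with \<open>p\<close> yields it for generalized elements, the
  form in which the calculus states it. The three lemmas that follow are obtained alike.\<close>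

lemma varpi_delta_pair:
  assumes "A \<in> obj C" "p \<in> arr C" "trg C p = mon C A"
  shows "varpi C A \<cdot> pair C p (delta C A \<cdot> bang C (src C p)) = p"
proof -
  have "(varpi C A \<cdot> pair C (ide C (mon C A)) (delta C A \<cdot> bang C (mon C A))) \<cdot> p = ide C (mon C A) \<cdot> p"
    using varpi_delta[OF assms(1)] by simp
  thus ?thesis using assms by simp
qed

lemma varpi_comm_pair:
  assumes "A \<in> obj C" "p \<in> arr C" "q \<in> arr C" "trg C p = mon C A" "trg C q = mon C A" "src C q = src C p"
  shows "varpi C A \<cdot> pair C p q = varpi C A \<cdot> pair C q p"
proof -
  have "(varpi C A \<cdot> pair C (pr2 C (mon C A) (mon C A)) (pr1 C (mon C A) (mon C A))) \<cdot> pair C q p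
    = varpi C A \<cdot> pair C q p"
    using varpi_comm[OF assms(1)] by simp
  thus ?thesis using assms by simp
qed

lemma varpi_idem_pair:
  assumes "A \<in> obj C" "p \<in> arr C" "trg C p = mon C A"
  shows "varpi C A \<cdot> pair C p p = p"
proof -
  have "(varpi C A \<cdot> pair C (ide C (mon C A)) (ide C (mon C A))) \<cdot> p = ide C (mon C A) \<cdot> p"
    using varpi_idem[OF assms(1)] by simp
  thus ?thesis using assms by simp
qed

lemma varpi_assoc_pair:
  assumes "A \<in> obj C" "p \<in> arr C" "q \<in> arr C" "r \<in> arr C" "trg C p = mon C A" "trg C q = mon C A" "trg C r = mon C A"
   "src C q = src C p" "src C r = src C p"
  shows "varpi C A \<cdot> pair C p (varpi C A \<cdot> pair C q r) = varpi C A \<cdot> pair C (varpi C A \<cdot> pair C p q) r"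
proof -
  have "(varpi C A \<cdot> cross C (ide C (mon C A)) (varpi C A) \<cdot> assoc C (mon C A) (mon C A) (mon C A))
    \<cdot> pair C (pair C p q) r
     = (varpi C A \<cdot> cross C (varpi C A) (ide C (mon C A))) \<cdot> pair C (pair C p q) r"
    using varpi_assoc[OF assms(1)] by simp
  thus ?thesis using assms by (simp add: assoc_def)
qed

end

section \<open>Coiteration and its fusion laws\<close>

context resumption_category
begin

lemma res_obj_simp [simp]: "A \<in> obj C \<Longrightarrow> res C A \<in> obj C" by (rule res_obj)

lemma out_arr [simp]:
  assumes "A \<in> obj C"
  shows "out C A \<in> arr C" "src C (out C A) = res C A" "trg C (out C A) = mon C (cpr C (res C A) A)"
  using out_hom[OF assms] by auto

lemma coit_mor:
  assumes "A \<in> obj C" "f \<in> arr C" "trg C f = mon C (cpr C (src C f) A)"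
  shows "coalg_mor C A f (coit C A f)"
  unfolding coit_def by (rule theI', rule final) (use assms in \<open>auto simp: hom_iff\<close>)

lemma coit_arr [simp]:
  assumes "A \<in> obj C" "f \<in> arr C" "trg C f = mon C (cpr C (src C f) A)"
  shows "coit C A f \<in> arr C" "src C (coit C A f) = src C f" "trg C (coit C A f) = res C A"
  using coit_mor[OF assms] by (auto simp: coalg_mor_def hom_iff)

lemma coit_unique:
  assumes "A \<in> obj C" "f \<in> arr C" "trg C f = mon C (cpr C (src C f) A)"
    "h \<in> arr C" "src C h = src C f" "trg C h = res C A" "out C A \<cdot> h = mmap C (cosum C h (ide C A)) \<cdot> f"
  shows "h = coit C A f"
proof -
  have "\<exists>!h. coalg_mor C A f h" by (rule final) (use assms in \<open>auto simp: hom_iff\<close>)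
  moreover have "coalg_mor C A f h" using assms by (auto simp: coalg_mor_def hom_iff)
  ultimately show ?thesis using coit_mor[OF assms(1-3)] by blast
qed

lemma out_coit:
  assumes "A \<in> obj C" "f \<in> arr C" "trg C f = mon C (cpr C (src C f) A)"
  shows "out C A \<cdot> coit C A f = mmap C (cosum C (coit C A f) (ide C A)) \<cdot> f"
  using coit_mor[OF assms] by (simp add: coalg_mor_def)

lemma rmap_arr [simp]:
  assumes "g \<in> arr C"
  shows "rmap C g \<in> arr C" "src C (rmap C g) = res C (src C g)" "trg C (rmap C g) = res C (trg C g)"
  using assms by (simp_all add: rmap_def)

lemma out_rmap:
  assumes "g \<in> arr C"
  shows "out C (trg C g) \<cdot> rmap C g = mmap C (cosum C (rmap C g) g) \<cdot> out C (src C g)"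
proof -
  have "out C (trg C g) \<cdot> rmap C g = mmap C (cosum C (rmap C g) (ide C (trg C g)))
      \<cdot> mmap C (cosum C (ide C (res C (src C g))) g) \<cdot> out C (src C g)"
    unfolding rmap_def by (rule out_coit) (use assms in auto)
  thus ?thesis using assms by simp
qed

text \<open>A coalgebra morphism \<open>h\<close> followed by a coiteration is again a coalgebra
  morphism into the final coalgebra, hence the coiteration of \<open>f'\<close> by
  uniqueness.\<close>

lemma coit_coalg_hom:
  assumes "A \<in> obj C" "f \<in> arr C" "trg C f = mon C (cpr C (src C f) A)"
    "f' \<in> arr C" "trg C f' = mon C (cpr C (src C f') A)"
    "h \<in> arr C" "src C h = src C f'" "trg C h = src C f"
    "f \<cdot> h = mmap C (cosum C h (ide C A)) \<cdot> f'"
  shows "coit C A f \<cdot> h = coit C A f'"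
proof (rule coit_unique)
  have "out C A \<cdot> coit C A f \<cdot> h = (out C A \<cdot> coit C A f) \<cdot> h" using assms by simp
  also have "\<dots> = mmap C (cosum C (coit C A f) (ide C A)) \<cdot> f \<cdot> h"
    unfolding out_coit[OF assms(1-3)] using assms(1-8) by simp
  also have "\<dots> = mmap C (cosum C (coit C A f \<cdot> h) (ide C A)) \<cdot> f'"
    unfolding assms(9) using assms(1-8) by simp
  finally show "out C A \<cdot> coit C A f \<cdot> h = mmap C (cosum C (coit C A f \<cdot> h) (ide C A)) \<cdot> f'" .
qed (use assms in auto)

text \<open>Relabelling the final outputs along \<open>g\<close> can be done in the coalgebra
  beforehand: both sides solve the same coalgebra equation.\<close>

lemma rmap_coit:
  assumes "g \<in> arr C" "src C g = A" "trg C g = B" "f \<in> arr C" "trg C f = mon C (cpr C (src C f) A)"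
  shows "rmap C g \<cdot> coit C A f = coit C B (mmap C (cosum C (ide C (src C f)) g) \<cdot> f)"
proof (rule coit_unique)
  have o: "A \<in> obj C" "B \<in> obj C" using assms by auto
  have "out C B \<cdot> rmap C g \<cdot> coit C A f = (out C (trg C g) \<cdot> rmap C g) \<cdot> coit C A f" using assms o by simp
  also have "\<dots> = mmap C (cosum C (rmap C g) g) \<cdot> (out C A \<cdot> coit C A f)"
    unfolding out_rmap[OF assms(1)] using assms o by simp
  also have "\<dots> = mmap C (cosum C (rmap C g \<cdot> coit C A f) (ide C B)) \<cdot> mmap C (cosum C (ide C (src C f)) g) \<cdot> f"
    unfolding out_coit[OF o(1) assms(4,5)] using assms o by simp
  finally show "out C B \<cdot> rmap C g \<cdot> coit C A f
    = mmap C (cosum C (rmap C g \<cdot> coit C A f) (ide C B)) \<cdot> mmap C (cosum C (ide C (src C f)) g) \<cdot> f" .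
qed (use assms in auto)

end

section \<open>Renaming and substitution\<close>

lemma lift_ren_simps [simp]: "lift_ren r 0 = 0" "lift_ren r (Suc n) = Suc (r n)"
  by (simp_all add: lift_ren_def)

lemma lift_sub_simps [simp]: "lift_sub \<sigma> 0 = Var 0" "lift_sub \<sigma> (Suc n) = ren Suc (\<sigma> n)"
  by (simp_all add: lift_sub_def)

lemma lift_sub_Var_ren: "lift_sub (\<lambda>i. Var (r i)) = (\<lambda>i. Var (lift_ren r i))"
  by (rule ext) (simp add: lift_sub_def lift_ren_def split: nat.split)

text \<open>This turns laws of substitution into laws of renaming, syntactically in
  \<open>ren_ren\<close> and semantically in \<open>sem_ren\<close>.\<close>

lemma ren_eq_sub: "ren r t = sub (\<lambda>i. Var (r i)) t"
  by (induction t arbitrary: r) (simp_all add: lift_sub_Var_ren)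

lemma lift_sub_Var: "lift_sub Var = Var"
  by (rule ext) (simp add: lift_sub_def split: nat.split)

lemma sub_Var [simp]: "sub Var t = t"
  by (induction t) (simp_all add: lift_sub_Var)

lemma lift_sub_lift_ren: "(\<lambda>i. lift_sub \<sigma> (lift_ren r i)) = lift_sub (\<lambda>i. \<sigma> (r i))"
  by (rule ext) (simp add: lift_sub_def lift_ren_def split: nat.split)

text \<open>The order of the composition laws is forced by the binders. Since
  \<open>lift_sub\<close> renames the terms it carries, renaming after substitution needs
  \<open>ren_ren\<close>, and substitution after substitution needs both mixed laws.\<close>

lemma sub_ren: "sub \<sigma> (ren r t) = sub (\<lambda>i. \<sigma> (r i)) t"
  by (induction t arbitrary: \<sigma> r) (simp_all add: lift_sub_lift_ren)

lemma ren_ren: "ren r' (ren r t) = ren (\<lambda>i. r' (r i)) t"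
  using sub_ren[of "\<lambda>i. Var (r' i)" r t] by (simp only: ren_eq_sub[symmetric])

lemma ren_lift_sub: "(\<lambda>i. ren (lift_ren r) (lift_sub \<sigma> i)) = lift_sub (\<lambda>i. ren r (\<sigma> i))"
  by (rule ext) (simp add: lift_sub_def ren_ren split: nat.split)

lemma ren_sub: "ren r (sub \<sigma> t) = sub (\<lambda>i. ren r (\<sigma> i)) t"
  by (induction t arbitrary: \<sigma> r) (simp_all add: ren_lift_sub)

lemma sub_lift_sub: "(\<lambda>i. sub (lift_sub \<tau>) (lift_sub \<sigma> i)) = lift_sub (\<lambda>i. sub \<tau> (\<sigma> i))"
  by (rule ext) (simp add: lift_sub_def ren_sub sub_ren split: nat.split)

lemma sub_sub: "sub \<tau> (sub \<sigma> t) = sub (\<lambda>i. sub \<tau> (\<sigma> i)) t"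
  by (induction t arbitrary: \<sigma> \<tau>) (simp_all add: sub_lift_sub)

section \<open>Well-formedness and typing\<close>

lemma wf_ctx_simps [simp]: "wf_ctx \<Sigma> []" "wf_ctx \<Sigma> (A # \<Gamma>) \<longleftrightarrow> wf_ty \<Sigma> A \<and> wf_ctx \<Sigma> \<Gamma>"
  by (simp_all add: wf_ctx_def)

lemma wf_ty_simps [simp]:
  "wf_ty \<Sigma> (TAtom w) \<longleftrightarrow> w \<in> atoms \<Sigma>"
  "wf_ty \<Sigma> TOne"
  "wf_ty \<Sigma> (TProd A B) \<longleftrightarrow> wf_ty \<Sigma> A \<and> wf_ty \<Sigma> B"
  "wf_ty \<Sigma> (TSum A B) \<longleftrightarrow> wf_ty \<Sigma> A \<and> wf_ty \<Sigma> B"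
  "wf_ty \<Sigma> (TMon A) \<longleftrightarrow> wf_ty \<Sigma> A"
  "wf_ty \<Sigma> (TNu A) \<longleftrightarrow> wf_ty \<Sigma> A"
  by (auto simp: wf_ty_def)

lemma wf_ctx_nth: "wf_ctx \<Sigma> \<Gamma> \<Longrightarrow> i < length \<Gamma> \<Longrightarrow> wf_ty \<Sigma> (\<Gamma> ! i)"
  by (simp add: wf_ctx_def)

lemma typed_wf:
  assumes "wf_signature \<Sigma>" "typed \<Sigma> \<Gamma> t A"
  shows "wf_ctx \<Sigma> \<Gamma> \<and> wf_ty \<Sigma> A"
  using assms(2) by induction (use assms(1) in \<open>auto simp: wf_ctx_nth wf_signature_def\<close>)

lemma typed_wf_ctx: "typed \<Sigma> \<Gamma> t A \<Longrightarrow> wf_ctx \<Sigma> \<Gamma>"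
  by (induction rule: typed.induct) auto

lemma all_less_Suc_iff: "(\<forall>i<Suc n. P i) \<longleftrightarrow> P 0 \<and> (\<forall>i<n. P (Suc i))"
  by (metis less_Suc_eq_0_disj Suc_less_eq)

lemma typed_ren:
  assumes "typed \<Sigma> \<Gamma> t A" "wf_ctx \<Sigma> \<Delta>" "\<forall>i<length \<Gamma>. r i < length \<Delta> \<and> \<Delta> ! r i = \<Gamma> ! i"
  shows "typed \<Sigma> \<Delta> (ren r t) A"
  using assms
proof (induction arbitrary: \<Delta> r)
  case (Var \<Gamma> i)
  then show ?case using typed.Var[of \<Sigma> \<Delta> "r i"] by simp
next
  case (Case \<Gamma> s A B t C u)
  have "wf_ty \<Sigma> A" "wf_ty \<Sigma> B" using Case(2,3)[THEN typed_wf_ctx] by auto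
  then show ?case using Case by (auto intro!: typed.Case[where A=A and B=B] simp: all_less_Suc_iff)
next
  case (Do \<Gamma> p A q B)
  have "wf_ty \<Sigma> A" using Do(2)[THEN typed_wf_ctx] by auto
  then show ?case using Do by (auto intro!: typed.Do[where A=A] simp: all_less_Suc_iff)
next
  case (Unfold \<Gamma> p A q B)
  have "wf_ty \<Sigma> A" using Unfold(2)[THEN typed_wf_ctx] by auto
  then show ?case using Unfold by (auto intro!: typed.Unfold[where A=A] simp: all_less_Suc_iff)
qed (auto intro: typed.intros)

lemma typed_weaken: "typed \<Sigma> \<Gamma> t A \<Longrightarrow> wf_ty \<Sigma> B \<Longrightarrow> typed \<Sigma> (B # \<Gamma>) (ren Suc t) A"
  by (rule typed_ren) (auto dest: typed_wf_ctx)

definition typed_sub :: "('w, 'f) signature \<Rightarrow> 'w ctx \<Rightarrow> (nat \<Rightarrow> ('w, 'f) tm) \<Rightarrow> 'w ctx \<Rightarrow> bool" where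
  "typed_sub \<Sigma> \<Delta> \<sigma> \<Gamma> \<longleftrightarrow> wf_ctx \<Sigma> \<Delta> \<and> (\<forall>i<length \<Gamma>. typed \<Sigma> \<Delta> (\<sigma> i) (\<Gamma> ! i))"

lemma typed_sub_lift: "typed_sub \<Sigma> \<Delta> \<sigma> \<Gamma> \<Longrightarrow> wf_ty \<Sigma> A \<Longrightarrow> typed_sub \<Sigma> (A # \<Delta>) (lift_sub \<sigma>) (A # \<Gamma>)"
  using typed.Var[of \<Sigma> "A # \<Delta>" 0] by (auto simp: typed_sub_def all_less_Suc_iff typed_weaken)

lemma typed_subI:
  assumes "typed \<Sigma> \<Gamma> t A" "typed_sub \<Sigma> \<Delta> \<sigma> \<Gamma>"
  shows "typed \<Sigma> \<Delta> (sub \<sigma> t) A"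
  using assms
proof (induction arbitrary: \<Delta> \<sigma>)
  case (Case \<Gamma> s A B t C u)
  have "wf_ty \<Sigma> A" "wf_ty \<Sigma> B" using Case(2,3)[THEN typed_wf_ctx] by auto
  then show ?case using Case by (simp, intro typed.Case[where A=A and B=B] Case.IH typed_sub_lift) auto
next
  case (Do \<Gamma> p A q B)
  have "wf_ty \<Sigma> A" using Do(2)[THEN typed_wf_ctx] by auto
  then show ?case using Do by (simp, intro typed.Do[where A=A] Do.IH typed_sub_lift) auto
next
  case (Unfold \<Gamma> p A q B)
  have "wf_ty \<Sigma> A" using Unfold(2)[THEN typed_wf_ctx] by auto
  then show ?case using Unfold by (simp, intro typed.Unfold[where A=A] Unfold.IH typed_sub_lift) auto
qed (auto simp: typed_sub_def intro: typed.intros)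

lemma typed_sub_inst: "typed \<Sigma> \<Gamma> p A \<Longrightarrow> typed_sub \<Sigma> \<Gamma> (case_nat p Var) (A # \<Gamma>)"
  by (auto simp: typed_sub_def all_less_Suc_iff typed.Var dest: typed_wf_ctx)

lemma typed_inst: "typed \<Sigma> (A # \<Gamma>) q B \<Longrightarrow> typed \<Sigma> \<Gamma> p A \<Longrightarrow> typed \<Sigma> \<Gamma> (inst p q) B"
  unfolding inst_def by (erule typed_subI) (rule typed_sub_inst)

lemma typed_wk_under:
  assumes "typed \<Sigma> (A # \<Gamma>) t C" "wf_ty \<Sigma> B"
  shows "typed \<Sigma> (A # B # \<Gamma>) (wk_under t) C"
  unfolding wk_under_def
  by (rule typed_ren[OF assms(1)]) (use assms typed_wf_ctx[OF assms(1)] in \<open>auto simp: all_less_Suc_iff\<close>)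

lemma typed_Var0: "wf_ctx \<Sigma> \<Gamma> \<Longrightarrow> wf_ty \<Sigma> A \<Longrightarrow> typed \<Sigma> (A # \<Gamma>) (Var 0) A"
  using typed.Var[of \<Sigma> "A # \<Gamma>" 0] by simp

text \<open>The interpretation and the encoding of morphisms both refer to types; from a derivation
  alone this recovers the types of its two sides.\<close>

lemma derivable_typed:
  assumes "wf_signature \<Sigma>" "\<forall>\<phi>\<in>\<Phi>. wt_equation \<Sigma> \<phi>" "derivable \<Sigma> \<Phi> \<Gamma> t s A"
  shows "typed \<Sigma> \<Gamma> t A \<and> typed \<Sigma> \<Gamma> s A"
  using assms(3)
proof induction
  case (subst \<Gamma> t s A \<Delta> \<sigma>)
  then show ?case by (auto intro: typed_subI simp: typed_sub_def)
next
  case (case_sub \<Gamma> p A B q D r t C)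
  have "wf_ty \<Sigma> A" "wf_ty \<Sigma> B" using case_sub(2,3)[THEN typed_wf_ctx] by auto
  then show ?case using case_sub by (auto intro!: typed.Case[where A=A and B=B] typed_inst[where A=D] typed_wk_under)
next
  case (do_assoc \<Gamma> p A q B r C)
  have "wf_ty \<Sigma> A" "wf_ty \<Sigma> B" using do_assoc(2,3)[THEN typed_wf_ctx] by auto
  then show ?case using do_assoc by (meson typed.Do typed_wk_under)
next
  case (coit_unfold A \<Gamma> p B q)
  have "wf_ty \<Sigma> A" "wf_ctx \<Sigma> \<Gamma>" using coit_unfold(1)[THEN typed_wf_ctx] by auto
  then show ?case using coit_unfold by (auto intro!: typed.Unfold[where A=A] typed_wk_under typed_Var0)
next
  case (unfold_coit A \<Gamma> p B q)
  have w: "wf_ty \<Sigma> A" "wf_ctx \<Sigma> \<Gamma>" using unfold_coit(1)[THEN typed_wf_ctx] by auto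
  have "wf_ty \<Sigma> B" using typed_wf[OF assms(1) unfold_coit(1)] by simp
  then show ?case using unfold_coit w by (auto intro!: typed.Do[where A="TSum A B"]
    typed.Case[where A="A" and B="B"] typed.Ret typed.InL typed.InR typed.Out typed_wk_under typed_Var0)
next
  case (hyp \<Gamma> t s A) then show ?case using assms(2) by (auto simp: wt_equation_def)
next
  case (case_id \<Gamma> p A B)
  have "wf_ty \<Sigma> A" "wf_ty \<Sigma> B" "wf_ctx \<Sigma> \<Gamma>" using typed_wf[OF assms(1) case_id] by auto
  then show ?case using case_id by (auto intro!: typed.Case[where A="A" and B="B"] typed.InL typed.InR typed_Var0)
next
  case (do_ret \<Gamma> p A)
  have "wf_ty \<Sigma> A" "wf_ctx \<Sigma> \<Gamma>" using typed_wf[OF assms(1) do_ret] by auto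
  then show ?case using do_ret by (auto intro!: typed.Do[where A="A"] typed.Ret typed_Var0)
next
  case (do_dead A \<Gamma> r B)
  have "wf_ty \<Sigma> B" "wf_ctx \<Sigma> \<Gamma>" using typed_wf[OF assms(1) do_dead(2)] by auto
  then show ?case using do_dead by (auto intro!: typed.Do[where A="A"] typed.Dead)
next
  case (choice_dead \<Gamma> p A)
  then show ?case using typed_wf[OF assms(1) choice_dead] by (auto intro: typed.intros)
next
  case (case_InL \<Gamma> p A q C B r)
  then show ?case by (auto intro!: typed.Case[where A=A and B=B] typed.intros typed_inst dest: typed_wf_ctx)
next
  case (case_InR \<Gamma> p B A q C r)
  then show ?case by (auto intro!: typed.Case[where A=A and B=B] typed.intros typed_inst dest: typed_wf_ctx)
next
  case (do_beta \<Gamma> a A p B)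
  then show ?case by (auto intro!: typed.Do[where A=A] typed.intros typed_inst dest: typed_wf_ctx)
next
  case (do_choice \<Gamma> p A q r B)
  then show ?case by (auto intro!: typed.Do[where A=A] typed.intros dest: typed_wf_ctx)
next
  case (unit \<Gamma> p)
  then show ?case by (auto intro!: typed.intros dest: typed_wf_ctx)
qed (auto intro: typed.intros)

section \<open>Co-iteration with parameters\<close>

context strong_monad
begin

lemma ext_bind:
  assumes "f \<in> arr C" "p \<in> arr C" "src C f = prd C (src C p) A" "trg C p = mon C A" "trg C f = mon C B"
    "A \<in> obj C" "B \<in> obj C" "g \<in> arr C" "src C g = B" "trg C g = mon C D" "D \<in> obj C"
  shows "ext C B D g \<cdot> bind C A B f p = bind C A D (ext C B D g \<cdot> f) p"
  using assms by (simp add: bind_def)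

end

text \<open>
  The coalgebra \<open>f\<close> in the interpretation of \<open>unfold\<close>, with the context discarded from the terminating
  summand; its coiteration absorbs the postcomposition with \<open>R \<pi>\<^sub>2\<close>.
\<close>

definition ctx_step :: "('o, 'm, 'x) monad_data_scheme \<Rightarrow> 'o \<Rightarrow> 'o \<Rightarrow> 'o \<Rightarrow> 'm \<Rightarrow> 'm" where
  "ctx_step C G a b g = bind C (cpr C a b) (cpr C (prd C G a) b)
     (eta C (cpr C (prd C G a) b) \<cdot>\<^bsub>C\<^esub> cosum C (ide C (prd C G a)) (pr2 C G b) \<cdot>\<^bsub>C\<^esub> dist C G a b
       \<cdot>\<^bsub>C\<^esub> cross C (pr1 C G a) (ide C (cpr C a b))) g"

definition ctx_coit :: "('o, 'm, 'x) monad_data_scheme \<Rightarrow> 'o \<Rightarrow> 'o \<Rightarrow> 'o \<Rightarrow> 'm \<Rightarrow> 'm" where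
  "ctx_coit C G a b g = coit C b (ctx_step C G a b g)"

context resumption_category
begin

context
  fixes G a b g
  assumes G [simp]: "G \<in> obj C" and a [simp]: "a \<in> obj C" and b [simp]: "b \<in> obj C"
    and g [simp]: "g \<in> arr C" "src C g = prd C G a" "trg C g = mon C (cpr C a b)"
begin

lemma ctx_step_arr [simp]:
  "ctx_step C G a b g \<in> arr C" "src C (ctx_step C G a b g) = prd C G a"
  "trg C (ctx_step C G a b g) = mon C (cpr C (prd C G a) b)"
  by (simp_all add: ctx_step_def)

lemma ctx_coit_arr [simp]:
  "ctx_coit C G a b g \<in> arr C" "src C (ctx_coit C G a b g) = prd C G a"
  "trg C (ctx_coit C G a b g) = res C b"
  by (simp_all add: ctx_coit_def)

text \<open>By fusion the relabelling along \<open>pr2\<close> enters the coalgebra, where strength,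
  distributivity and relabelling merge into a single \<open>bind\<close>.\<close>

lemma rmap_coit_eq_ctx_coit:
  "rmap C (pr2 C G b) \<cdot> coit C (prd C G b) (mmap C (dist C G a b) \<cdot> tau C G (cpr C a b) \<cdot> pair C (pr1 C G a) g)
    = ctx_coit C G a b g"
proof -
  have "rmap C (pr2 C G b) \<cdot> coit C (prd C G b) (mmap C (dist C G a b) \<cdot> tau C G (cpr C a b) \<cdot> pair C (pr1 C G a) g)
    = coit C b (mmap C (cosum C (ide C (prd C G a)) (pr2 C G b)) \<cdot> mmap C (dist C G a b) \<cdot> tau C G (cpr C a b)
      \<cdot> pair C (pr1 C G a) g)"
    by (subst rmap_coit[where B=b]) simp_all
  also have "\<dots> = ctx_coit C G a b g"
    unfolding ctx_coit_def ctx_step_def by (simp add: bind_pair ext_bind)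
  finally show ?thesis .
qed

text \<open>The long right-hand side is the literal interpretation of the \<open>do\<close> and
  \<open>case\<close> term in the co-iteration rule, over the context extended by \<open>x\<close>,
  \<open>z\<close> and the inner \<open>x\<close>. It simplifies to the functor applied to
  \<open>h\<close> after \<open>ctx_step\<close>, so the equation says that \<open>h\<close> is a
  coalgebra morphism, and finality leaves one such \<open>h\<close>.\<close>

lemma coalg_ctx_step_iff:
  assumes [simp]: "h \<in> arr C" "src C h = prd C G a" "trg C h = res C b"
  shows "out C b \<cdot> h = bind C (cpr C a b) (cpr C (res C b) b)
      (copair C (eta C (cpr C (res C b) b) \<cdot> in1 C (res C b) b \<cdot> h \<cdot> cross C (pr1 C G a
        \<cdot> pr1 C (prd C G a) (cpr C a b)) (ide C a))
                (eta C (cpr C (res C b) b) \<cdot> in2 C (res C b) b \<cdot> pr2 C (prd C (prd C G a) (cpr C a b)) b)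
        \<cdot> dist C (prd C (prd C G a) (cpr C a b)) a b
        \<cdot> pair C (ide C (prd C (prd C G a) (cpr C a b))) (pr2 C (prd C G a) (cpr C a b))) g
    \<longleftrightarrow> h = ctx_coit C G a b g" (is "_ = bind C ?A ?B ?f g \<longleftrightarrow> _")
proof -
  let ?k = "ext C (cpr C (prd C G a) b) ?B (eta C ?B \<cdot> cosum C h (ide C b)) \<cdot>
     (eta C (cpr C (prd C G a) b) \<cdot> cosum C (ide C (prd C G a)) (pr2 C G b) \<cdot> dist C G a b
       \<cdot> cross C (pr1 C G a) (ide C (cpr C a b)))"
  \<comment> \<open>Both sides are maps out of a product with a sum and agree on either summand: the
    left one applies \<open>h\<close> to the retained context and the new state, the right one keeps
    the output.\<close>
  have "?f = ?k"
    by (rule prd_cpr_eqI[of _ _ "prd C G a" a b]) simp_all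
  hence "bind C ?A ?B ?f g = bind C ?A ?B ?k g" by (rule arg_cong)
  also have "\<dots> = ext C (cpr C (prd C G a) b) ?B (eta C ?B \<cdot> cosum C h (ide C b)) \<cdot> ctx_step C G a b g"
    unfolding ctx_step_def by (rule ext_bind[symmetric]) simp_all
  also have "\<dots> = mmap C (cosum C h (ide C b)) \<cdot> ctx_step C G a b g" by simp
  finally have "bind C ?A ?B ?f g = mmap C (cosum C h (ide C b)) \<cdot> ctx_step C G a b g" .
  moreover have "out C b \<cdot> h = mmap C (cosum C h (ide C b)) \<cdot> ctx_step C G a b g \<longleftrightarrow> h = ctx_coit C G a b g"
  proof
    assume "out C b \<cdot> h = mmap C (cosum C h (ide C b)) \<cdot> ctx_step C G a b g"
    thus "h = ctx_coit C G a b g" unfolding ctx_coit_def by (intro coit_unique) simp_all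
  next
    assume h: "h = ctx_coit C G a b g"
    show "out C b \<cdot> h = mmap C (cosum C h (ide C b)) \<cdot> ctx_step C G a b g"
      unfolding h unfolding ctx_coit_def by (rule out_coit) simp_all
  qed
  ultimately show ?thesis by simp
qed

text \<open>Changing the parameter context along \<open>h\<close> is a coalgebra morphism from the
  coalgebra over the source of \<open>h\<close> to the one over \<open>G\<close>, so
  \<open>coit_coalg_hom\<close> applies. This is what substitution into \<open>unfold\<close>
  amounts to.\<close>

lemma ctx_coit_nat:
  assumes h [simp]: "h \<in> arr C" "trg C h = G"
  shows "ctx_coit C G a b g \<cdot> cross C h (ide C a) = ctx_coit C (src C h) a b (g \<cdot> cross C h (ide C a))"
proof -
  let ?H = "src C h" and ?g = "g \<cdot> cross C h (ide C a)"
  let ?s = "ctx_step C (src C h) a b ?g"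
  let ?K = "\<lambda>G. eta C (cpr C (prd C G a) b) \<cdot> cosum C (ide C (prd C G a)) (pr2 C G b) \<cdot> dist C G a b
       \<cdot> cross C (pr1 C G a) (ide C (cpr C a b))"
  have s: "?s \<in> arr C" "src C ?s = prd C ?H a" "trg C ?s = mon C (cpr C (prd C ?H a) b)"
    unfolding ctx_step_def by simp_all
  have "?K G \<cdot> cross C (cross C h (ide C a)) (ide C (cpr C a b))
      = mmap C (cosum C (cross C h (ide C a)) (ide C b)) \<cdot> ?K ?H"
    by (rule prd_cpr_eqI[of _ _ "prd C ?H a" a b]) simp_all
  hence eq: "ctx_step C G a b g \<cdot> cross C h (ide C a) = mmap C (cosum C (cross C h (ide C a)) (ide C b)) \<cdot> ?s"
    unfolding ctx_step_def by (subst bind_comp) (simp_all add: ext_bind del: comp_assoc_arr)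
  show ?thesis
    unfolding ctx_coit_def by (rule coit_coalg_hom) (use s eq in simp_all)
qed

end

end

section \<open>Soundness\<close>

locale me_model =
  fixes \<Sigma> :: "('w, 'f) signature" and M :: "('o, 'm, 'w, 'f) model_data" (structure)
  assumes wf_sig: "wf_signature \<Sigma>" and model: "me_nu_model \<Sigma> M"

sublocale me_model \<subseteq> resumption_category M
  using model by (simp add: me_nu_model_def)

context me_model
begin

lemma ty_sem_obj [simp]: "wf_ty \<Sigma> A \<Longrightarrow> ty_sem M A \<in> obj M"
  using model by (induction A) (auto simp: me_nu_model_def)

lemma ctx_sem_obj [simp]: "wf_ctx \<Sigma> \<Gamma> \<Longrightarrow> ctx_sem M \<Gamma> \<in> obj M"
  by (induction \<Gamma>) auto

lemma fun_int_arr [simp]: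
  assumes "f \<in> funs \<Sigma>"
  shows "fun_int M f \<in> arr M" "src M (fun_int M f) = ty_sem M (fdom \<Sigma> f)"
    "trg M (fun_int M f) = ty_sem M (fcod \<Sigma> f)"
  using model assms by (auto simp: me_nu_model_def)

lemma var_sem_arr [simp]:
  assumes "wf_ctx \<Sigma> \<Gamma>" "i < length \<Gamma>"
  shows "var_sem M \<Gamma> i \<in> arr M \<and> src M (var_sem M \<Gamma> i) = ctx_sem M \<Gamma> \<and> trg M (var_sem M \<Gamma> i) = ty_sem M (\<Gamma> ! i)"
  using assms
proof (induction \<Gamma> arbitrary: i)
  case (Cons A \<Gamma>)
  then show ?case by (cases i) auto
qed simp

text \<open>\<open>sem\<close> computes the types it needs by \<open>ty_of\<close>; under a typing
  hypothesis its clauses become equations over given types.\<close>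

lemma sem_Case:
  assumes "typed \<Sigma> \<Gamma> s (TSum A B)"
  shows "sem \<Sigma> M \<Gamma> (Case s t u) = copair M (sem \<Sigma> M (A # \<Gamma>) t) (sem \<Sigma> M (B # \<Gamma>) u)
    \<cdot> dist M (ctx_sem M \<Gamma>) (ty_sem M A) (ty_sem M B) \<cdot> pair M (ide M (ctx_sem M \<Gamma>)) (sem \<Sigma> M \<Gamma> s)"
  using ty_of_typed[OF assms] by (simp add: Let_def)

lemma sem_Unfold_raw:
  assumes "typed \<Sigma> \<Gamma> p A" "typed \<Sigma> (A # \<Gamma>) q (TMon (TSum A B))"
  shows "sem \<Sigma> M \<Gamma> (Unfold p q) = rmap M (pr2 M (ctx_sem M \<Gamma>) (ty_sem M B)) \<cdot> coit M (prd M (ctx_sem M \<Gamma>) (ty_sem M B))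
     (mmap M (dist M (ctx_sem M \<Gamma>) (ty_sem M A) (ty_sem M B)) \<cdot> tau M (ctx_sem M \<Gamma>) (cpr M (ty_sem M A) (ty_sem M B))
       \<cdot> pair M (pr1 M (ctx_sem M \<Gamma>) (ty_sem M A)) (sem \<Sigma> M (A # \<Gamma>) q)) \<cdot> pair M (ide M (ctx_sem M \<Gamma>)) (sem \<Sigma> M \<Gamma> p)"
  using assms[THEN ty_of_typed] by (simp add: Let_def del: mmap_unfold)

lemma sem_Do_raw:
  assumes "typed \<Sigma> \<Gamma> p (TMon A)" "typed \<Sigma> (A # \<Gamma>) q (TMon B)"
  shows "sem \<Sigma> M \<Gamma> (Do p q) = ext M (prd M (ctx_sem M \<Gamma>) (ty_sem M A)) (ty_sem M B) (sem \<Sigma> M (A # \<Gamma>) q)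
         \<cdot> tau M (ctx_sem M \<Gamma>) (ty_sem M A) \<cdot> pair M (ide M (ctx_sem M \<Gamma>)) (sem \<Sigma> M \<Gamma> p)"
  using assms[THEN ty_of_typed] by (simp add: Let_def)

lemma sem_typed_simps:
  "typed \<Sigma> \<Gamma> t (TProd A B) \<Longrightarrow> sem \<Sigma> M \<Gamma> (Fst t) = pr1 M (ty_sem M A) (ty_sem M B) \<cdot> sem \<Sigma> M \<Gamma> t"
  "typed \<Sigma> \<Gamma> t (TProd A B) \<Longrightarrow> sem \<Sigma> M \<Gamma> (Snd t) = pr2 M (ty_sem M A) (ty_sem M B) \<cdot> sem \<Sigma> M \<Gamma> t"
  "typed \<Sigma> \<Gamma> t A \<Longrightarrow> sem \<Sigma> M \<Gamma> (InL B t) = in1 M (ty_sem M A) (ty_sem M B) \<cdot> sem \<Sigma> M \<Gamma> t"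
  "typed \<Sigma> \<Gamma> t B \<Longrightarrow> sem \<Sigma> M \<Gamma> (InR A t) = in2 M (ty_sem M A) (ty_sem M B) \<cdot> sem \<Sigma> M \<Gamma> t"
  "typed \<Sigma> \<Gamma> t A \<Longrightarrow> sem \<Sigma> M \<Gamma> (Ret t) = eta M (ty_sem M A) \<cdot> sem \<Sigma> M \<Gamma> t"
  "typed \<Sigma> \<Gamma> p (TMon A) \<Longrightarrow> sem \<Sigma> M \<Gamma> (Choice p q) = varpi M (ty_sem M A) \<cdot> pair M (sem \<Sigma> M \<Gamma> p) (sem \<Sigma> M \<Gamma> q)"
  "typed \<Sigma> \<Gamma> p (TNu A) \<Longrightarrow> sem \<Sigma> M \<Gamma> (Out p) = out M (ty_sem M A) \<cdot> sem \<Sigma> M \<Gamma> p"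
  by (drule ty_of_typed, simp add: Let_def)+

lemma sem_arr:
  assumes "typed \<Sigma> \<Gamma> t A"
  shows "sem \<Sigma> M \<Gamma> t \<in> arr M \<and> src M (sem \<Sigma> M \<Gamma> t) = ctx_sem M \<Gamma> \<and> trg M (sem \<Sigma> M \<Gamma> t) = ty_sem M A"
  using assms
proof induction
  case (Case \<Gamma> s A B t C u)
  have "wf_ty \<Sigma> A" "wf_ty \<Sigma> B" "wf_ctx \<Sigma> \<Gamma>" using Case(2,3)[THEN typed_wf_ctx] by auto
  then show ?case using Case by (simp add: sem_Case del: sem.simps)
next
  case (Do \<Gamma> p A q B)
  have "wf_ty \<Sigma> A" "wf_ty \<Sigma> B" "wf_ctx \<Sigma> \<Gamma>" using typed_wf[OF wf_sig Do(2)] by auto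
  then show ?case using Do by (simp add: sem_Do_raw del: sem.simps)
next
  case (Unfold \<Gamma> p A q B)
  have "wf_ty \<Sigma> A" "wf_ty \<Sigma> B" "wf_ctx \<Sigma> \<Gamma>" using typed_wf[OF wf_sig Unfold(2)] by auto
  then show ?case using Unfold by (simp add: sem_Unfold_raw del: sem.simps)
next
  case (Fst \<Gamma> t A B)
  have "wf_ty \<Sigma> A" "wf_ty \<Sigma> B" using typed_wf[OF wf_sig Fst(1)] by auto
  then show ?case using Fst by (simp add: sem_typed_simps del: sem.simps)
next
  case (Snd \<Gamma> t A B)
  have "wf_ty \<Sigma> A" "wf_ty \<Sigma> B" using typed_wf[OF wf_sig Snd(1)] by auto
  then show ?case using Snd by (simp add: sem_typed_simps del: sem.simps)
next
  case (InL \<Gamma> t A B)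
  then show ?case using typed_wf[OF wf_sig InL(1)] by (simp add: sem_typed_simps del: sem.simps)
next
  case (InR \<Gamma> t B A)
  then show ?case using typed_wf[OF wf_sig InR(1)] by (simp add: sem_typed_simps del: sem.simps)
next
  case (Ret \<Gamma> t A)
  then show ?case using typed_wf[OF wf_sig Ret(1)] by (simp add: sem_typed_simps del: sem.simps)
next
  case (Choice \<Gamma> p A q)
  then show ?case using typed_wf[OF wf_sig Choice(1)] by (simp add: sem_typed_simps del: sem.simps)
next
  case (Out \<Gamma> p A)
  then show ?case using typed_wf[OF wf_sig Out(1)] by (simp add: sem_typed_simps del: sem.simps)
qed (auto simp: wf_ctx_nth)

lemma sem_Do:
  assumes "typed \<Sigma> \<Gamma> p (TMon A)" "typed \<Sigma> (A # \<Gamma>) q (TMon B)"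
  shows "sem \<Sigma> M \<Gamma> (Do p q) = bind M (ty_sem M A) (ty_sem M B) (sem \<Sigma> M (A # \<Gamma>) q) (sem \<Sigma> M \<Gamma> p)"
  using sem_arr[OF assms(1)] by (simp add: sem_Do_raw[OF assms] bind_def del: sem.simps)

lemma sem_Unfold:
  assumes "typed \<Sigma> \<Gamma> p A" "typed \<Sigma> (A # \<Gamma>) q (TMon (TSum A B))"
  shows "sem \<Sigma> M \<Gamma> (Unfold p q) = ctx_coit M (ctx_sem M \<Gamma>) (ty_sem M A) (ty_sem M B) (sem \<Sigma> M (A # \<Gamma>) q)
     \<cdot> pair M (ide M (ctx_sem M \<Gamma>)) (sem \<Sigma> M \<Gamma> p)"
proof -
  have w: "wf_ty \<Sigma> A" "wf_ty \<Sigma> B" "wf_ctx \<Sigma> \<Gamma>" using typed_wf[OF wf_sig assms(2)] by auto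
  note p = sem_arr[OF assms(1)] and q = sem_arr[OF assms(2)]
  show ?thesis
    unfolding sem_Unfold_raw[OF assms]
    by (subst rmap_coit_eq_ctx_coit[symmetric], use w q in simp_all)
       (rule comp_assoc_arr[symmetric], use w p q in simp_all)
qed

lemmas sem_simps = sem_typed_simps sem_Case sem_Do sem_Unfold
declare sem.simps(5-) [simp del]

lemma sem_Dead [simp]: "sem \<Sigma> M \<Gamma> (Dead A) = delta M (ty_sem M A) \<cdot> bang M (ctx_sem M \<Gamma>)"
  by (simp add: sem.simps)

text \<open>The morphism between contexts that interprets a substitution. A relation is more
  flexible than a function of \<sigma>: for weakening and for lifting under a binder the morphism is
  at hand as a projection or a \<open>cross\<close>, with no tuple to rebuild.\<close>

definition realizes :: "'w ctx \<Rightarrow> 'w ctx \<Rightarrow> 'm \<Rightarrow> (nat \<Rightarrow> ('w, 'f) tm) \<Rightarrow> bool" where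
  "realizes \<Gamma> \<Delta> h \<sigma> \<longleftrightarrow> h \<in> arr M \<and> src M h = ctx_sem M \<Delta> \<and> trg M h = ctx_sem M \<Gamma> \<and>
     (\<forall>i<length \<Gamma>. var_sem M \<Gamma> i \<cdot> h = sem \<Sigma> M \<Delta> (\<sigma> i))"

text \<open>
  One induction serves renamings and substitutions: \<open>P\<close> is instantiated first with renamings, and the
  resulting weakening lemma then shows that realized substitutions are closed under lifting.
\<close>

lemma sem_sub_closed:
  assumes P: "\<And>\<Gamma> \<Delta> h \<sigma>. P \<Gamma> \<Delta> h \<sigma> \<Longrightarrow> realizes \<Gamma> \<Delta> h \<sigma> \<and> typed_sub \<Sigma> \<Delta> \<sigma> \<Gamma>"
    and lift: "\<And>\<Gamma> \<Delta> h \<sigma> A. P \<Gamma> \<Delta> h \<sigma> \<Longrightarrow> wf_ctx \<Sigma> \<Gamma> \<Longrightarrow> wf_ty \<Sigma> A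
      \<Longrightarrow> P (A # \<Gamma>) (A # \<Delta>) (cross M h (ide M (ty_sem M A))) (lift_sub \<sigma>)"
    and "typed \<Sigma> \<Gamma> t A" "P \<Gamma> \<Delta> h \<sigma>"
  shows "sem \<Sigma> M \<Delta> (sub \<sigma> t) = sem \<Sigma> M \<Gamma> t \<cdot> h"
  using assms(3,4)
proof (induction arbitrary: \<Delta> h \<sigma>)
  case (Var \<Gamma> i)
  then show ?case using P[OF Var(3)] by (simp add: realizes_def)
next
  case (Fn f \<Gamma> t)
  then show ?case using P[OF Fn(4)] sem_arr[OF Fn(2)] by (simp add: realizes_def)
next
  case (Star \<Gamma>)
  then show ?case using P[OF Star(2)] by (simp add: realizes_def)
next
  case (Tup \<Gamma> t A u B)
  then show ?case using P[OF Tup(5)] Tup(1,2)[THEN sem_arr] by (simp add: realizes_def)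
next
  case (Fst \<Gamma> t A B)
  note P = P[OF Fst(3)]
  show ?case using P Fst sem_arr[OF Fst(1)] typed_subI[OF Fst(1), of \<Delta> \<sigma>] typed_wf[OF wf_sig Fst(1)]
    by (simp add: realizes_def sem_simps)
next
  case (Snd \<Gamma> t A B)
  note P = P[OF Snd(3)]
  show ?case using P Snd sem_arr[OF Snd(1)] typed_subI[OF Snd(1), of \<Delta> \<sigma>] typed_wf[OF wf_sig Snd(1)]
    by (simp add: realizes_def sem_simps)
next
  case (InL \<Gamma> t A B)
  note P = P[OF InL(4)]
  show ?case using P InL sem_arr[OF InL(1)] typed_subI[OF InL(1), of \<Delta> \<sigma>] typed_wf[OF wf_sig InL(1)]
    by (simp add: realizes_def sem_simps)
next
  case (InR \<Gamma> t A B)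
  note P = P[OF InR(4)]
  show ?case using P InR sem_arr[OF InR(1)] typed_subI[OF InR(1), of \<Delta> \<sigma>] typed_wf[OF wf_sig InR(1)]
    by (simp add: realizes_def sem_simps)
next
  case (Case \<Gamma> s A B t C u)
  note P = P[OF Case(7)]
  have w: "wf_ty \<Sigma> A" "wf_ty \<Sigma> B" "wf_ctx \<Sigma> \<Gamma>" using typed_wf[OF wf_sig Case(1)] by auto
  note l = lift[OF Case(7) w(3)]
  show ?case using P Case(4)[OF Case(7)] Case(5)[OF l[OF w(1)]] Case(6)[OF l[OF w(2)]]
     Case(1) Case(1-3)[THEN sem_arr] typed_subI[OF Case(1), of \<Delta> \<sigma>] w
    unfolding realizes_def
    by (simp add: sem_simps del: cross_unfold comp_assoc_arr) (subst case_nat, simp_all)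
next
  case (Ret \<Gamma> t A)
  note P = P[OF Ret(3)]
  show ?case using P Ret sem_arr[OF Ret(1)] typed_subI[OF Ret(1), of \<Delta> \<sigma>] typed_wf[OF wf_sig Ret(1)]
    by (simp add: realizes_def sem_simps)
next
  case (Do \<Gamma> p A q B)
  note P = P[OF Do(5)]
  have w: "wf_ty \<Sigma> A" "wf_ty \<Sigma> B" "wf_ctx \<Sigma> \<Gamma>" using typed_wf[OF wf_sig Do(2)] by auto
  note l = lift[OF Do(5) w(3)]
  have t: "typed \<Sigma> \<Delta> (sub \<sigma> p) (TMon A)" "typed \<Sigma> (A # \<Delta>) (sub (lift_sub \<sigma>) q) (TMon B)"
    using P Do(1,2) w by (auto intro!: typed_subI typed_sub_lift)
  show ?case using P Do(3)[OF Do(5)] Do(4)[OF l[OF w(1)]] Do(1-2)[THEN sem_arr] t Do(1,2) w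
    unfolding realizes_def
    by (simp add: sem_simps del: cross_unfold comp_assoc_arr) (subst bind_comp, simp_all)
next
  case (Dead \<Gamma> A)
  then show ?case using P[OF Dead(3)] by (simp add: realizes_def)
next
  case (Choice \<Gamma> p A q)
  note P = P[OF Choice(5)]
  show ?case using P Choice Choice(1,2)[THEN sem_arr] typed_subI[OF Choice(1), of \<Delta> \<sigma>] typed_wf[OF wf_sig Choice(1)]
    by (simp add: realizes_def sem_simps)
next
  case (Out \<Gamma> p A)
  note P = P[OF Out(3)]
  show ?case using P Out sem_arr[OF Out(1)] typed_subI[OF Out(1), of \<Delta> \<sigma>] typed_wf[OF wf_sig Out(1)]
    by (simp add: realizes_def sem_simps)
next
  case (Unfold \<Gamma> p A q B)
  note P = P[OF Unfold(5)]
  have w: "wf_ty \<Sigma> A" "wf_ty \<Sigma> B" "wf_ctx \<Sigma> \<Gamma>" using typed_wf[OF wf_sig Unfold(2)] by auto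
  note l = lift[OF Unfold(5) w(3)]
  let ?a = "ty_sem M A" and ?b = "ty_sem M B" and ?q = "sem \<Sigma> M (A # \<Gamma>) q" and ?p = "sem \<Sigma> M \<Gamma> p"
  let ?D = "ctx_sem M \<Delta>" and ?G = "ctx_sem M \<Gamma>"
  have t: "typed \<Sigma> \<Delta> (sub \<sigma> p) A" "typed \<Sigma> (A # \<Delta>) (sub (lift_sub \<sigma>) q) (TMon (TSum A B))"
    using P Unfold(1,2) w by (auto intro!: typed_subI typed_sub_lift)
  have h: "h \<in> arr M" "src M h = ?D" "trg M h = ?G" "?D \<in> obj M"
    using P by (auto simp: realizes_def typed_sub_def)
  note qa = sem_arr[OF Unfold(2)] and pa = sem_arr[OF Unfold(1)]
  have "sem \<Sigma> M \<Delta> (sub \<sigma> (Unfold p q)) = ctx_coit M ?D ?a ?b (?q \<cdot> cross M h (ide M ?a)) \<cdot> pair M (ide M ?D) (?p \<cdot> h)"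
    using t Unfold(3)[OF Unfold(5)] Unfold(4)[OF l[OF w(1)]] by (simp add: sem_simps del: cross_unfold)
  \<comment> \<open>Coiteration is natural in its parameter context, so \<open>h\<close> can be
    moved out to the right.\<close>
  also have "ctx_coit M ?D ?a ?b (?q \<cdot> cross M h (ide M ?a)) = ctx_coit M ?G ?a ?b ?q \<cdot> cross M h (ide M ?a)"
    using ctx_coit_nat[of ?G ?a ?b ?q h] w qa h by simp
  also have "(ctx_coit M ?G ?a ?b ?q \<cdot> cross M h (ide M ?a)) \<cdot> pair M (ide M ?D) (?p \<cdot> h)
    = (ctx_coit M ?G ?a ?b ?q \<cdot> pair M (ide M ?G) ?p) \<cdot> h"
    using w qa pa h by simp
  also have "\<dots> = sem \<Sigma> M \<Gamma> (Unfold p q) \<cdot> h" using Unfold(1,2) by (simp add: sem_simps)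
  finally show ?case .
qed

definition realizes_ren :: "'w ctx \<Rightarrow> 'w ctx \<Rightarrow> 'm \<Rightarrow> (nat \<Rightarrow> ('w, 'f) tm) \<Rightarrow> bool" where
  "realizes_ren \<Gamma> \<Delta> h \<sigma> \<longleftrightarrow> realizes \<Gamma> \<Delta> h \<sigma> \<and> typed_sub \<Sigma> \<Delta> \<sigma> \<Gamma> \<and> (\<exists>r. \<sigma>
    = (\<lambda>i. Var (r i)) \<and> (\<forall>i<length \<Gamma>. r i < length \<Delta>))"

text \<open>The hypothesis \<open>wk\<close> is weakening for the terms \<sigma> i alone. For
  variables it holds by the recursion of \<open>var_sem\<close>; for other terms it is
  \<open>sem_weaken\<close>, which becomes available once renamings are settled.\<close>

lemma realizes_lift_aux:
  assumes "realizes \<Gamma> \<Delta> h \<sigma>" "wf_ctx \<Sigma> \<Gamma>" "wf_ctx \<Sigma> \<Delta>" "wf_ty \<Sigma> A"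
    and wk: "\<And>i. i < length \<Gamma> \<Longrightarrow> sem \<Sigma> M (A # \<Delta>) (ren Suc (\<sigma> i)) = sem \<Sigma> M \<Delta> (\<sigma> i) \<cdot> pr1 M (ctx_sem M \<Delta>) (ty_sem M A)"
  shows "realizes (A # \<Gamma>) (A # \<Delta>) (cross M h (ide M (ty_sem M A))) (lift_sub \<sigma>)"
proof -
  have "var_sem M (A # \<Gamma>) (Suc i) \<cdot> cross M h (ide M (ty_sem M A)) = sem \<Sigma> M (A # \<Delta>) (ren Suc (\<sigma> i))"
    if i: "i < length \<Gamma>" for i
  proof -
    have "var_sem M (A # \<Gamma>) (Suc i) \<cdot> cross M h (ide M (ty_sem M A))
      = (var_sem M \<Gamma> i \<cdot> h) \<cdot> pr1 M (ctx_sem M \<Delta>) (ty_sem M A)"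
      using assms var_sem_arr[OF assms(2) i] by (simp add: realizes_def)
    also have "var_sem M \<Gamma> i \<cdot> h = sem \<Sigma> M \<Delta> (\<sigma> i)" using assms(1) i by (simp add: realizes_def)
    finally show ?thesis using wk[OF i] by simp
  qed
  thus ?thesis using assms(1-4) by (auto simp: realizes_def all_less_Suc_iff simp del: var_sem.simps(3)
    cross_unfold) auto
qed

lemma realizes_ren_lift:
  assumes "realizes_ren \<Gamma> \<Delta> h \<sigma>" "wf_ctx \<Sigma> \<Gamma>" "wf_ty \<Sigma> A"
  shows "realizes_ren (A # \<Gamma>) (A # \<Delta>) (cross M h (ide M (ty_sem M A))) (lift_sub \<sigma>)"
proof -
  obtain r where r: "\<sigma> = (\<lambda>i. Var (r i))" "\<forall>i<length \<Gamma>. r i < length \<Delta>"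
    using assms by (auto simp: realizes_ren_def)
  have wD: "wf_ctx \<Sigma> \<Delta>" using assms by (auto simp: realizes_ren_def typed_sub_def)
  have "realizes (A # \<Gamma>) (A # \<Delta>) (cross M h (ide M (ty_sem M A))) (lift_sub \<sigma>)"
    by (rule realizes_lift_aux) (use assms wD in \<open>auto simp: realizes_ren_def r(1)\<close>)
  moreover have "typed_sub \<Sigma> (A # \<Delta>) (lift_sub \<sigma>) (A # \<Gamma>)"
    using assms by (auto simp: realizes_ren_def intro: typed_sub_lift)
  moreover have "lift_sub \<sigma> = (\<lambda>i. Var (lift_ren r i))" "\<forall>i<length (A # \<Gamma>). lift_ren r i < length (A # \<Delta>)"
    using r by (auto simp: lift_sub_Var_ren all_less_Suc_iff)
  ultimately show ?thesis unfolding realizes_ren_def by blast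
qed

lemma sem_ren:
  assumes "typed \<Sigma> \<Gamma> t A" "realizes_ren \<Gamma> \<Delta> h (\<lambda>i. Var (r i))"
  shows "sem \<Sigma> M \<Delta> (ren r t) = sem \<Sigma> M \<Gamma> t \<cdot> h"
  unfolding ren_eq_sub
  by (rule sem_sub_closed[where P = realizes_ren, OF _ _ assms])
    (simp add: realizes_ren_def, rule realizes_ren_lift)

lemma sem_weaken:
  assumes "typed \<Sigma> \<Gamma> t A" "wf_ty \<Sigma> B"
  shows "sem \<Sigma> M (B # \<Gamma>) (ren Suc t) = sem \<Sigma> M \<Gamma> t \<cdot> pr1 M (ctx_sem M \<Gamma>) (ty_sem M B)"
proof (rule sem_ren[OF assms(1)])
  have "wf_ctx \<Sigma> \<Gamma>" using typed_wf_ctx[OF assms(1)] .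
  thus "realizes_ren \<Gamma> (B # \<Gamma>) (pr1 M (ctx_sem M \<Gamma>) (ty_sem M B)) (\<lambda>i. Var (Suc i))"
    using assms(2) typed.Var[of \<Sigma> "B # \<Gamma>"]
    by (force simp: realizes_ren_def realizes_def typed_sub_def)
qed

lemma sem_sub:
  assumes "typed \<Sigma> \<Gamma> t A" "realizes \<Gamma> \<Delta> h \<sigma>" "typed_sub \<Sigma> \<Delta> \<sigma> \<Gamma>"
  shows "sem \<Sigma> M \<Delta> (sub \<sigma> t) = sem \<Sigma> M \<Gamma> t \<cdot> h"
proof (rule sem_sub_closed[where P = "\<lambda>\<Gamma> \<Delta> h \<sigma>. realizes \<Gamma> \<Delta> h \<sigma> \<and> typed_sub \<Sigma> \<Delta> \<sigma> \<Gamma>", OF _ _ assms(1)])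
  fix \<Gamma> \<Delta> h \<sigma> A
  assume 1: "realizes \<Gamma> \<Delta> h \<sigma> \<and> typed_sub \<Sigma> \<Delta> \<sigma> \<Gamma>" and w: "wf_ctx \<Sigma> \<Gamma>" "wf_ty \<Sigma> A"
  hence "realizes (A # \<Gamma>) (A # \<Delta>) (cross M h (ide M (ty_sem M A))) (lift_sub \<sigma>)"
    by (intro realizes_lift_aux) (auto simp: typed_sub_def sem_weaken)
  thus "realizes (A # \<Gamma>) (A # \<Delta>) (cross M h (ide M (ty_sem M A))) (lift_sub \<sigma>)
    \<and> typed_sub \<Sigma> (A # \<Delta>) (lift_sub \<sigma>) (A # \<Gamma>)"
    using 1 w by (simp add: typed_sub_lift)
qed (use assms in auto)

lemma realizes_exists:
  assumes "wf_ctx \<Sigma> \<Gamma>" "typed_sub \<Sigma> \<Delta> \<sigma> \<Gamma>"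
  shows "\<exists>h. realizes \<Gamma> \<Delta> h \<sigma>"
  using assms
proof (induction \<Gamma> arbitrary: \<sigma>)
  case Nil
  then show ?case by (auto simp: realizes_def typed_sub_def intro!: exI[of _ "bang M (ctx_sem M \<Delta>)"])
next
  case (Cons A \<Gamma>)
  have "typed_sub \<Sigma> \<Delta> (\<lambda>i. \<sigma> (Suc i)) \<Gamma>" and t: "typed \<Sigma> \<Delta> (\<sigma> 0) A"
    using Cons by (auto simp: typed_sub_def all_less_Suc_iff)
  then obtain h where h: "realizes \<Gamma> \<Delta> h (\<lambda>i. \<sigma> (Suc i))" using Cons by auto
  have "realizes (A # \<Gamma>) \<Delta> (pair M h (sem \<Sigma> M \<Delta> (\<sigma> 0))) \<sigma>"
    using h Cons sem_arr[OF t] by (auto simp: realizes_def all_less_Suc_iff)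
  then show ?case ..
qed

lemma sem_inst:
  assumes "typed \<Sigma> (A # \<Gamma>) q B" "typed \<Sigma> \<Gamma> p A"
  shows "sem \<Sigma> M \<Gamma> (inst p q) = sem \<Sigma> M (A # \<Gamma>) q \<cdot> pair M (ide M (ctx_sem M \<Gamma>)) (sem \<Sigma> M \<Gamma> p)"
  unfolding inst_def
proof (rule sem_sub[OF assms(1)])
  show "realizes (A # \<Gamma>) \<Gamma> (pair M (ide M (ctx_sem M \<Gamma>)) (sem \<Sigma> M \<Gamma> p)) (case_nat p Var)"
    using typed_wf[OF wf_sig assms(2)] sem_arr[OF assms(2)] by (auto simp: realizes_def all_less_Suc_iff)
qed (rule typed_sub_inst[OF assms(2)])

lemma sem_wk_under:
  assumes "typed \<Sigma> (A # \<Gamma>) t C" "wf_ty \<Sigma> B"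
  shows "sem \<Sigma> M (A # B # \<Gamma>) (wk_under t) = sem \<Sigma> M (A # \<Gamma>) t
    \<cdot> cross M (pr1 M (ctx_sem M \<Gamma>) (ty_sem M B)) (ide M (ty_sem M A))"
  unfolding wk_under_def
proof (rule sem_ren[OF assms(1)])
  have w: "wf_ctx \<Sigma> \<Gamma>" "wf_ty \<Sigma> A" using typed_wf_ctx[OF assms(1)] by auto
  have "realizes_ren \<Gamma> (B # \<Gamma>) (pr1 M (ctx_sem M \<Gamma>) (ty_sem M B)) (\<lambda>i. Var (Suc i))"
    using assms(2) typed.Var[of \<Sigma> "B # \<Gamma>"] w
    by (force simp: realizes_ren_def realizes_def typed_sub_def)
  from realizes_ren_lift[OF this w]
  show "realizes_ren (A # \<Gamma>) (A # B # \<Gamma>) (cross M (pr1 M (ctx_sem M \<Gamma>) (ty_sem M B)) (ide M (ty_sem M A))) (\<lambda>i.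
    Var (lift_ren Suc i))"
    by (simp add: lift_sub_Var_ren)
qed

text \<open>Evaluating the right-hand term clause by clause produces exactly the expression in
  \<open>coalg_ctx_step_iff\<close>, so the equation of the co-iteration rule characterizes the
  coiteration of \<open>q\<close>.\<close>

lemma sem_Out_step:
  assumes "typed \<Sigma> (A # \<Gamma>) p (TNu B)" "typed \<Sigma> (A # \<Gamma>) q (TMon (TSum A B))"
  defines "G \<equiv> ctx_sem M \<Gamma>" and "a \<equiv> ty_sem M A" and "b \<equiv> ty_sem M B"
  shows "sem \<Sigma> M (A # \<Gamma>) (Out p) = sem \<Sigma> M (A # \<Gamma>)
      (Do q (Case (Var 0) (Ret (InL B (wk_under (wk_under p)))) (Ret (InR (TNu B) (Var 0)))))
    \<longleftrightarrow> sem \<Sigma> M (A # \<Gamma>) p = ctx_coit M G a b (sem \<Sigma> M (A # \<Gamma>) q)"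
proof -
  have w: "wf_ty \<Sigma> A" "wf_ty \<Sigma> B" "wf_ctx \<Sigma> \<Gamma>"
    using typed_wf[OF wf_sig assms(2)] by auto
  have o: "G \<in> obj M" "a \<in> obj M" "b \<in> obj M" using w by (simp_all add: G_def a_def b_def)
  let ?l = "wk_under (wk_under p)" and ?D = "TSum A B # A # \<Gamma>"
  have p1: "typed \<Sigma> (A # A # \<Gamma>) (wk_under p) (TNu B)"
    and l: "typed \<Sigma> (A # ?D) ?l (TNu B)"
    using assms w by (auto intro!: typed_wk_under)
  have r: "typed \<Sigma> (B # ?D) (Var 0) B" and v: "typed \<Sigma> ?D (Var 0) (TSum A B)"
    using w by (auto intro!: typed_Var0)
  have L: "typed \<Sigma> (A # ?D) (Ret (InL B ?l)) (TMon (TSum (TNu B) B))"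
    and R: "typed \<Sigma> (B # ?D) (Ret (InR (TNu B) (Var 0))) (TMon (TSum (TNu B) B))"
    using l r w by (auto intro!: typed.Ret typed.InL typed.InR)
  have C: "typed \<Sigma> ?D (Case (Var 0) (Ret (InL B ?l)) (Ret (InR (TNu B) (Var 0)))) (TMon (TSum (TNu B) B))"
    by (rule typed.Case[OF v L R])
  note pa = sem_arr[OF assms(1), folded G_def a_def b_def, simplified, folded G_def a_def b_def]
  note qa = sem_arr[OF assms(2), folded G_def a_def b_def, simplified, folded G_def a_def b_def]
  \<comment> \<open>The two weakenings skip the scrutinee and the outer \<open>x\<close>; the
    variable at index 0 stays the inner \<open>x\<close>.\<close>
  have lsem: "sem \<Sigma> M (A # ?D) ?l = sem \<Sigma> M (A # \<Gamma>) p \<cdot>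
      cross M (pr1 M G a \<cdot> pr1 M (prd M G a) (cpr M a b)) (ide M a)"
    using sem_wk_under[OF assms(1) w(1)] sem_wk_under[OF p1, of "TSum A B"] w pa o
    by (simp add: wk_under_def ren_ren flip: G_def a_def b_def)
  have "sem \<Sigma> M (A # \<Gamma>) (Do q (Case (Var 0) (Ret (InL B ?l)) (Ret (InR (TNu B) (Var 0)))))
    = bind M (cpr M a b) (cpr M (res M b) b)
      (copair M (eta M (cpr M (res M b) b) \<cdot> in1 M (res M b) b \<cdot> sem \<Sigma> M (A # \<Gamma>) p \<cdot> cross M (pr1 M G a
        \<cdot> pr1 M (prd M G a) (cpr M a b)) (ide M a))
                (eta M (cpr M (res M b) b) \<cdot> in2 M (res M b) b \<cdot> pr2 M (prd M (prd M G a) (cpr M a b)) b)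
        \<cdot> dist M (prd M (prd M G a) (cpr M a b)) a b
        \<cdot> pair M (ide M (prd M (prd M G a) (cpr M a b))) (pr2 M (prd M G a) (cpr M a b))) (sem \<Sigma> M (A # \<Gamma>) q)"
    using l r L R v C w
    by (simp add: sem_Do[OF assms(2) C] sem_simps(3-5)[OF l] sem_simps(3-5)[OF r] sem_simps(5)[OF typed.InL[OF l]]
        sem_simps(5)[OF typed.InR[OF r]] sem_Case[OF v] lsem del: cross_unfold flip: G_def a_def b_def)
  moreover have "sem \<Sigma> M (A # \<Gamma>) (Out p) = out M b \<cdot> sem \<Sigma> M (A # \<Gamma>) p"
    using assms(1) by (simp add: sem_simps b_def)
  ultimately show ?thesis
    using coalg_ctx_step_iff[OF o, of "sem \<Sigma> M (A # \<Gamma>) q" "sem \<Sigma> M (A # \<Gamma>) p"] pa qa by simp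
qed

text \<open>Weakening \<open>q\<close> under its bound variable precomposes it with a projection of
  the context. By naturality this projection leaves the coiteration and cancels against the pairing
  with the starting variable.\<close>

lemma sem_Unfold_Var:
  assumes "typed \<Sigma> (A # \<Gamma>) q (TMon (TSum A B))"
  shows "sem \<Sigma> M (A # \<Gamma>) (Unfold (Var 0) (wk_under q))
    = ctx_coit M (ctx_sem M \<Gamma>) (ty_sem M A) (ty_sem M B) (sem \<Sigma> M (A # \<Gamma>) q)"
proof -
  have w: "wf_ty \<Sigma> A" "wf_ty \<Sigma> B" "wf_ctx \<Sigma> \<Gamma>"
    using typed_wf[OF wf_sig assms] by auto
  let ?G = "ctx_sem M \<Gamma>" and ?a = "ty_sem M A" and ?b = "ty_sem M B" and ?q = "sem \<Sigma> M (A # \<Gamma>) q"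
  have v: "typed \<Sigma> (A # \<Gamma>) (Var 0) A" using w by (simp add: typed_Var0)
  note qa = sem_arr[OF assms]
  have "sem \<Sigma> M (A # \<Gamma>) (Unfold (Var 0) (wk_under q))
    = ctx_coit M (prd M ?G ?a) ?a ?b (?q \<cdot> cross M (pr1 M ?G ?a) (ide M ?a))
      \<cdot> pair M (ide M (prd M ?G ?a)) (pr2 M ?G ?a)"
    by (simp add: sem_Unfold[OF v typed_wk_under[OF assms w(1)]] sem_wk_under[OF assms w(1)] del: cross_unfold)
  also have "ctx_coit M (prd M ?G ?a) ?a ?b (?q \<cdot> cross M (pr1 M ?G ?a) (ide M ?a))
    = ctx_coit M ?G ?a ?b ?q \<cdot> cross M (pr1 M ?G ?a) (ide M ?a)"
    using ctx_coit_nat[of ?G ?a ?b ?q "pr1 M ?G ?a"] w qa by simp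
  also have "(\<dots>) \<cdot> pair M (ide M (prd M ?G ?a)) (pr2 M ?G ?a) = ctx_coit M ?G ?a ?b ?q"
    using w qa by simp
  finally show ?thesis .
qed

theorem soundness:
  assumes \<Phi>: "\<forall>\<phi>\<in>\<Phi>. wt_equation \<Sigma> \<phi>" "\<forall>\<phi>\<in>\<Phi>. satisfies \<Sigma> M \<phi>"
    and "derivable \<Sigma> \<Phi> \<Gamma> t s A"
  shows "sem \<Sigma> M \<Gamma> t = sem \<Sigma> M \<Gamma> s"
proof -
  have t: "typed \<Sigma> \<Gamma> t A" "typed \<Sigma> \<Gamma> s A" if "derivable \<Sigma> \<Phi> \<Gamma> t s A" for \<Gamma> t s A
    using derivable_typed[OF wf_sig \<Phi>(1) that] by auto
  from assms(3) show ?thesis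
  proof induction
    case (hyp \<Gamma> t s A)
    then show ?case using \<Phi>(2) by (auto simp: satisfies_def)
  next
    case (subst \<Gamma> t s A \<Delta> \<sigma>)
    have t: "typed \<Sigma> \<Gamma> t A" "typed \<Sigma> \<Gamma> s A" using derivable_typed[OF wf_sig \<Phi>(1) subst(1)] by auto
    have s: "typed_sub \<Sigma> \<Delta> \<sigma> \<Gamma>" using subst by (simp add: typed_sub_def)
    then obtain h where "realizes \<Gamma> \<Delta> h \<sigma>" using realizes_exists typed_wf_ctx[OF t(1)] by blast
    then show ?case using t s subst by (simp add: sem_sub)
  next
    case (cong_Tup \<Gamma> t t' A u u' B)
    then show ?case by simp
  next
    case (cong_Case \<Gamma> s s' A B t t' C u u')
    then show ?case using t[OF cong_Case(1)] by (simp add: sem_Case)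
  next
    case (cong_Do \<Gamma> p p' A q q' B)
    have "typed \<Sigma> \<Gamma> p (TMon A)" "typed \<Sigma> \<Gamma> p' (TMon A)" "typed \<Sigma> (A # \<Gamma>) q (TMon B)" "typed \<Sigma> (A # \<Gamma>) q' (TMon B)"
      using derivable_typed[OF wf_sig \<Phi>(1)] cong_Do by blast+
    then show ?case using cong_Do by (simp add: sem_Do)
  next
    case (cong_Unfold \<Gamma> p p' A q q' B)
    have "typed \<Sigma> \<Gamma> p A" "typed \<Sigma> \<Gamma> p' A" "typed \<Sigma> (A # \<Gamma>) q (TMon (TSum A B))" "typed \<Sigma> (A # \<Gamma>) q' (TMon (TSum A B))"
      using derivable_typed[OF wf_sig \<Phi>(1)] cong_Unfold by blast+
    then show ?case using cong_Unfold by (simp add: sem_Unfold)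
  next
    case (cong_Fst \<Gamma> t t' A B)
    then show ?case using t[OF cong_Fst(1)] by (simp add: sem_simps)
  next
    case (cong_Snd \<Gamma> t t' A B)
    then show ?case using t[OF cong_Snd(1)] by (simp add: sem_simps)
  next
    case (cong_InL \<Gamma> t t' A B)
    then show ?case using t[OF cong_InL(1)] by (simp add: sem_simps)
  next
    case (cong_InR \<Gamma> t t' B A)
    then show ?case using t[OF cong_InR(1)] by (simp add: sem_simps)
  next
    case (cong_Ret \<Gamma> t t' A)
    then show ?case using t[OF cong_Ret(1)] by (simp add: sem_simps)
  next
    case (cong_Choice \<Gamma> p p' A q q')
    then show ?case using t[OF cong_Choice(1)] by (simp add: sem_simps)
  next
    case (cong_Out \<Gamma> p p' A)
    then show ?case using t[OF cong_Out(1)] by (simp add: sem_simps)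
  next
    case (case_InL \<Gamma> p A q C B r)
    have w: "wf_ctx \<Sigma> \<Gamma>" "wf_ty \<Sigma> A" "wf_ty \<Sigma> B" using case_InL(2,3)[THEN typed_wf_ctx] by auto
    note a = case_InL[THEN sem_arr]
    show ?case using a w
      by (simp add: sem_Case[OF typed.InL[OF case_InL(1) w(3)]] sem_inst[OF case_InL(2,1)] sem_simps(3)[OF case_InL(1)])
  next
    case (case_InR \<Gamma> p B A q C r)
    have w: "wf_ctx \<Sigma> \<Gamma>" "wf_ty \<Sigma> A" "wf_ty \<Sigma> B" using case_InR(2,3)[THEN typed_wf_ctx] by auto
    note a = case_InR[THEN sem_arr]
    show ?case using a w
      by (simp add: sem_Case[OF typed.InR[OF case_InR(1) w(2)]] sem_inst[OF case_InR(3,1)] sem_simps(4)[OF case_InR(1)])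
  next
    case (case_id \<Gamma> p A B)
    have w: "wf_ctx \<Sigma> \<Gamma>" "wf_ty \<Sigma> A" "wf_ty \<Sigma> B" using typed_wf[OF wf_sig case_id] by auto
    let ?G = "ctx_sem M \<Gamma>" and ?a = "ty_sem M A" and ?b = "ty_sem M B"
    \<comment> \<open>The map \<open>pr2\<close> restricts on the two summands to the injections of
      the bound variables.\<close>
    have "copair M (in1 M ?a ?b \<cdot> pr2 M ?G ?a) (in2 M ?a ?b \<cdot> pr2 M ?G ?b) \<cdot> dist M ?G ?a ?b = pr2 M ?G (cpr M ?a ?b)"
      by (rule case_unique) (use w in simp_all)
    hence "(copair M (in1 M ?a ?b \<cdot> pr2 M ?G ?a) (in2 M ?a ?b \<cdot> pr2 M ?G ?b) \<cdot> dist M ?G ?a ?b)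
      \<cdot> pair M (ide M ?G) (sem \<Sigma> M \<Gamma> p)
        = pr2 M ?G (cpr M ?a ?b) \<cdot> pair M (ide M ?G) (sem \<Sigma> M \<Gamma> p)" by simp
    then show ?case using w sem_arr[OF case_id]
      by (simp add: sem_Case[OF case_id] sem_simps(3)[OF typed_Var0[OF w(1,2)]] sem_simps(4)[OF typed_Var0[OF w(1,3)]])
  next
    case (case_sub \<Gamma> p A B q D r t C)
    have w: "wf_ctx \<Sigma> \<Gamma>" "wf_ty \<Sigma> A" "wf_ty \<Sigma> B" "wf_ty \<Sigma> D"
      using case_sub(2,3,4)[THEN typed_wf_ctx] by auto
    let ?G = "ctx_sem M \<Gamma>" and ?a = "ty_sem M A" and ?b = "ty_sem M B" and ?d = "ty_sem M D"
    let ?p = "sem \<Sigma> M \<Gamma> p" and ?q = "sem \<Sigma> M (A # \<Gamma>) q" and ?r = "sem \<Sigma> M (B # \<Gamma>) r" and ?t = "sem \<Sigma> M (D # \<Gamma>) t"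
    note a = case_sub[THEN sem_arr]
    \<comment> \<open>The eta law for case: the map on the right, which performs the case
      distinction first and \<open>t\<close> afterwards, has the two given branches as its
      restrictions.\<close>
    have "copair M (?t \<cdot> pair M (pr1 M ?G ?a) ?q) (?t \<cdot> pair M (pr1 M ?G ?b) ?r) \<cdot> dist M ?G ?a ?b
      = ?t \<cdot> pair M (pr1 M ?G (cpr M ?a ?b)) (copair M ?q ?r \<cdot> dist M ?G ?a ?b)"
      by (rule case_unique) (use w a in simp_all)
    hence "(copair M (?t \<cdot> pair M (pr1 M ?G ?a) ?q) (?t \<cdot> pair M (pr1 M ?G ?b) ?r) \<cdot> dist M ?G ?a ?b)
      \<cdot> pair M (ide M ?G) ?p
      = (?t \<cdot> pair M (pr1 M ?G (cpr M ?a ?b)) (copair M ?q ?r \<cdot> dist M ?G ?a ?b)) \<cdot> pair M (ide M ?G) ?p" by simp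
    moreover have "sem \<Sigma> M (A # \<Gamma>) (inst q (wk_under t)) = ?t \<cdot> pair M (pr1 M ?G ?a) ?q"
      using sem_inst[OF typed_wk_under[OF case_sub(4) w(2)] case_sub(2)] sem_wk_under[OF case_sub(4) w(2)] w a by simp
    moreover have "sem \<Sigma> M (B # \<Gamma>) (inst r (wk_under t)) = ?t \<cdot> pair M (pr1 M ?G ?b) ?r"
      using sem_inst[OF typed_wk_under[OF case_sub(4) w(3)] case_sub(3)] sem_wk_under[OF case_sub(4) w(3)] w a by simp
    ultimately show ?case using w a
      by (simp add: sem_inst[OF case_sub(4) typed.Case[OF case_sub(1-3)]] sem_Case[OF case_sub(1)])
  next
    case (fst \<Gamma> p A q B)
    then show ?case using fst[THEN sem_arr] by (simp add: sem_simps(1)[OF typed.Tup[OF fst]])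
  next
    case (snd \<Gamma> p A q B)
    then show ?case using snd[THEN sem_arr] by (simp add: sem_simps(2)[OF typed.Tup[OF snd]])
  next
    case (pair \<Gamma> p A B)
    then show ?case using sem_arr[OF pair] typed_wf[OF wf_sig pair] by (simp add: sem_simps)
  next
    case (unit \<Gamma> p)
    then show ?case using sem_arr[OF unit] by (auto intro: bang_unique)
  next
    case (do_ret \<Gamma> p A)
    have w: "wf_ctx \<Sigma> \<Gamma>" "wf_ty \<Sigma> A" using typed_wf[OF wf_sig do_ret] by auto
    then show ?case using sem_arr[OF do_ret]
      by (simp add: sem_Do[OF do_ret typed.Ret[OF typed_Var0]] sem_simps(5)[OF typed_Var0] bind_ret)
  next
    case (do_beta \<Gamma> a A p B)
    have w: "wf_ctx \<Sigma> \<Gamma>" "wf_ty \<Sigma> A" "wf_ty \<Sigma> B" using typed_wf[OF wf_sig do_beta(2)] by auto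
    then show ?case using do_beta[THEN sem_arr]
      by (simp add: sem_Do[OF typed.Ret[OF do_beta(1)] do_beta(2)] sem_simps(5)[OF do_beta(1)] sem_inst[OF
        do_beta(2,1)] bind_eta)
  next
    case (do_assoc \<Gamma> p A q B r C)
    have w: "wf_ctx \<Sigma> \<Gamma>" "wf_ty \<Sigma> A" "wf_ty \<Sigma> B" "wf_ty \<Sigma> C"
      using typed_wf[OF wf_sig do_assoc(2)] typed_wf[OF wf_sig do_assoc(3)] by auto
    note wk = typed_wk_under[OF do_assoc(3) w(2)]
    show ?case using do_assoc[THEN sem_arr] w
      by (simp add: sem_Do[OF typed.Do[OF do_assoc(1,2)] do_assoc(3)] sem_Do[OF do_assoc(1,2)]
        sem_Do[OF do_assoc(1) typed.Do[OF do_assoc(2) wk]] sem_Do[OF do_assoc(2) wk] sem_wk_under[OF do_assoc(3) w(2)]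
        bind_assoc[where G="ctx_sem M \<Gamma>"])
  next
    case (choice_dead \<Gamma> p A)
    then show ?case using sem_arr[OF choice_dead] typed_wf[OF wf_sig choice_dead] varpi_delta_pair[of "ty_sem M
      A" "sem \<Sigma> M \<Gamma> p"]
      by (simp add: sem_simps)
  next
    case (choice_comm \<Gamma> p A q)
    then show ?case using choice_comm[THEN sem_arr] typed_wf[OF wf_sig choice_comm(1)] varpi_comm_pair[of
      "ty_sem M A" "sem \<Sigma> M \<Gamma> p" "sem \<Sigma> M \<Gamma> q"]
      by (simp add: sem_simps)
  next
    case (choice_idem \<Gamma> p A)
    then show ?case using sem_arr[OF choice_idem] typed_wf[OF wf_sig choice_idem] varpi_idem_pair[of "ty_sem M
      A" "sem \<Sigma> M \<Gamma> p"]
      by (simp add: sem_simps)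
  next
    case (choice_assoc \<Gamma> p A q r)
    then show ?case using choice_assoc[THEN sem_arr] typed_wf[OF wf_sig choice_assoc(1)]
        varpi_assoc_pair[of "ty_sem M A" "sem \<Sigma> M \<Gamma> p" "sem \<Sigma> M \<Gamma> q" "sem \<Sigma> M \<Gamma> r"]
      by (simp add: sem_simps(6)[OF choice_assoc(1)] sem_simps(6)[OF choice_assoc(2)] sem_simps(6)[OF
        typed.Choice[OF choice_assoc(1,2)]])
  next
    case (do_dead A \<Gamma> r B)
    have w: "wf_ctx \<Sigma> \<Gamma>" "wf_ty \<Sigma> A" "wf_ty \<Sigma> B" using typed_wf[OF wf_sig do_dead(2)] by auto
    then show ?case using sem_arr[OF do_dead(2)]
      by (simp add: sem_Do[OF typed.Dead do_dead(2)] bind_delta[where G="ctx_sem M \<Gamma>"])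
  next
    case (do_choice \<Gamma> p A q r B)
    have w: "wf_ctx \<Sigma> \<Gamma>" "wf_ty \<Sigma> A" "wf_ty \<Sigma> B" using typed_wf[OF wf_sig do_choice(3)] by auto
    then show ?case using do_choice[THEN sem_arr]
      by (simp add: sem_Do[OF typed.Choice[OF do_choice(1,2)] do_choice(3)] sem_Do[OF do_choice(1,3)] sem_Do[OF
        do_choice(2,3)]
        sem_simps(6)[OF do_choice(1)] sem_simps(6)[OF typed.Do[OF do_choice(1,3)]] bind_varpi[where G="ctx_sem M \<Gamma>"])
  next
    \<comment> \<open>By \<open>sem_Out_step\<close> and \<open>sem_Unfold_Var\<close> premise and
      conclusion have the same meaning, so this case and the next are the two directions of one
      equivalence.\<close>
    case (coit_unfold A \<Gamma> p B q)
    then show ?case using sem_Out_step[OF coit_unfold(1,2)] sem_Unfold_Var[OF coit_unfold(2)] by simp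
  next
    case (unfold_coit A \<Gamma> p B q)
    then show ?case using sem_Out_step[OF unfold_coit(1,2)] sem_Unfold_Var[OF unfold_coit(2)] by simp
  qed (simp_all add: sem_simps)
qed

end

section \<open>Models from calculus operations\<close>

text \<open>
  Deriving the axioms of a model directly in the calculus is laborious. Operators that mirror
  \<open>case\<close> and \<open>do\<close> satisfy few laws, each immediate in the term model, and all remaining axioms follow
  from them by rewriting in the category.
\<close>

locale case_category = cartesian_category C
  for C :: "('o, 'm, 'x) dist_data_scheme" (structure) +
  fixes cas :: "'o \<Rightarrow> 'o \<Rightarrow> 'm \<Rightarrow> 'm \<Rightarrow> 'm \<Rightarrow> 'm"
  assumes cpr_obj [simp]: "\<lbrakk>A \<in> obj C; B \<in> obj C\<rbrakk> \<Longrightarrow> cpr C A B \<in> obj C"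
    and in1_hom: "\<lbrakk>A \<in> obj C; B \<in> obj C\<rbrakk> \<Longrightarrow> in1 C A B \<in> hom C A (cpr C A B)"
    and in2_hom: "\<lbrakk>A \<in> obj C; B \<in> obj C\<rbrakk> \<Longrightarrow> in2 C A B \<in> hom C B (cpr C A B)"
    and cas_hom: "\<lbrakk>A \<in> obj C; B \<in> obj C; s \<in> hom C X (cpr C A B); t \<in> hom C (prd C X A) Y; u \<in> hom C (prd C X B) Y\<rbrakk>
      \<Longrightarrow> cas A B s t u \<in> hom C X Y"
    and cas_nat: "\<lbrakk>A \<in> obj C; B \<in> obj C; s \<in> hom C X (cpr C A B); t \<in> hom C (prd C X A) Y; u \<in> hom C (prd C X B)
      Y; h \<in> hom C Z X\<rbrakk>
      \<Longrightarrow> cas A B s t u \<cdot> h = cas A B (s \<cdot> h) (t \<cdot> cross C h (ide C A)) (u \<cdot> cross C h (ide C B))"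
    and cas_in1: "\<lbrakk>A \<in> obj C; B \<in> obj C; a \<in> hom C X A; t \<in> hom C (prd C X A) Y; u \<in> hom C (prd C X B) Y\<rbrakk>
      \<Longrightarrow> cas A B (in1 C A B \<cdot> a) t u = t \<cdot> pair C (ide C X) a"
    and cas_in2: "\<lbrakk>A \<in> obj C; B \<in> obj C; b \<in> hom C X B; t \<in> hom C (prd C X A) Y; u \<in> hom C (prd C X B) Y\<rbrakk>
      \<Longrightarrow> cas A B (in2 C A B \<cdot> b) t u = u \<cdot> pair C (ide C X) b"
    and cas_eta: "\<lbrakk>A \<in> obj C; B \<in> obj C; s \<in> hom C X (cpr C A B); h \<in> hom C (prd C X (cpr C A B)) Y\<rbrakk>
      \<Longrightarrow> cas A B s (h \<cdot> pair C (pr1 C X A) (in1 C A B \<cdot> pr2 C X A)) (h \<cdot> pair C (pr1 C X B) (in2 C A B \<cdot> pr2 C X B))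
        = h \<cdot> pair C (ide C X) s"
begin

lemma injections_arr [simp]:
  assumes "A \<in> obj C" "B \<in> obj C"
  shows "in1 C A B \<in> arr C" "src C (in1 C A B) = A" "trg C (in1 C A B) = cpr C A B"
    "in2 C A B \<in> arr C" "src C (in2 C A B) = B" "trg C (in2 C A B) = cpr C A B"
  using in1_hom[OF assms] in2_hom[OF assms] by auto

lemma cas_arr [simp]:
  assumes "A \<in> obj C" "B \<in> obj C" "s \<in> arr C" "t \<in> arr C" "u \<in> arr C" "trg C s = cpr C A B"
    "src C t = prd C (src C s) A" "src C u = prd C (src C s) B" "trg C u = trg C t"
  shows "cas A B s t u \<in> arr C" "src C (cas A B s t u) = src C s" "trg C (cas A B s t u) = trg C t"
  using cas_hom[of A B s "src C s" t "trg C t" u] assms by (auto simp: hom_iff)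

lemma cas_comp [simp]:
  assumes "A \<in> obj C" "B \<in> obj C" "s \<in> arr C" "t \<in> arr C" "u \<in> arr C" "trg C s = cpr C A B"
    "src C t = prd C (src C s) A" "src C u = prd C (src C s) B" "trg C u = trg C t" "h \<in> arr C" "trg C h = src C s"
  shows "cas A B s t u \<cdot> h = cas A B (s \<cdot> h) (t \<cdot> cross C h (ide C A)) (u \<cdot> cross C h (ide C B))"
  by (rule cas_nat) (use assms in \<open>auto simp: hom_iff\<close>)

lemma cas_in [simp]:
  assumes "A \<in> obj C" "B \<in> obj C" "a \<in> arr C" "t \<in> arr C" "u \<in> arr C"
    "src C t = prd C (src C a) A" "src C u = prd C (src C a) B" "trg C u = trg C t"
  shows "trg C a = A \<Longrightarrow> cas A B (in1 C A B \<cdot> a) t u = t \<cdot> pair C (ide C (src C a)) a"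
    "trg C a = B \<Longrightarrow> cas A B (in2 C A B \<cdot> a) t u = u \<cdot> pair C (ide C (src C a)) a"
  by (rule cas_in1 cas_in2; use assms in \<open>auto simp: hom_iff\<close>)+

text \<open>A composite with an identity is simplified away, so \<open>cas_in\<close> needs a
  version for bare injections.\<close>

lemma cas_in_ide [simp]:
  assumes "A \<in> obj C" "B \<in> obj C" "t \<in> arr C" "u \<in> arr C" "trg C u = trg C t"
  shows "src C t = prd C A A \<Longrightarrow> src C u = prd C A B \<Longrightarrow> cas A B (in1 C A B) t u = t \<cdot> pair C (ide C A) (ide C A)"
    "src C t = prd C B A \<Longrightarrow> src C u = prd C B B \<Longrightarrow> cas A B (in2 C A B) t u = u \<cdot> pair C (ide C B) (ide C B)"
  using cas_in(1)[of A B "ide C A" t u] cas_in(2)[of A B "ide C B" t u] assms by auto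

text \<open>The principle of \<open>prd_cpr_eqI\<close>, obtained from the eta law of
  \<open>cas\<close> because distributivity is not yet known here.\<close>

lemma prd_cpr_ext:
  assumes "h \<in> arr C" "k \<in> arr C" "src C h = prd C X (cpr C Y Z)" "src C k = prd C X (cpr C Y Z)"
    "trg C h = trg C k" and o [simp]: "X \<in> obj C" "Y \<in> obj C" "Z \<in> obj C"
    and 1: "h \<cdot> pair C (pr1 C X Y) (in1 C Y Z \<cdot> pr2 C X Y) = k \<cdot> pair C (pr1 C X Y) (in1 C Y Z \<cdot> pr2 C X Y)"
    and 2: "h \<cdot> pair C (pr1 C X Z) (in2 C Y Z \<cdot> pr2 C X Z) = k \<cdot> pair C (pr1 C X Z) (in2 C Y Z \<cdot> pr2 C X Z)"
  shows "h = k"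
proof -
  let ?S = "cpr C Y Z" and ?X = "prd C X (cpr C Y Z)"
  \<comment> \<open>The eta law is used in the context \<open>prd C X (cpr C Y Z)\<close> with its
    own second component as scrutinee. It writes \<open>f\<close> as a case over its restrictions to
    the summands, so equal restrictions give equal maps.\<close>
  have "f = cas Y Z (pr2 C X ?S)
      ((f \<cdot> pair C (pr1 C X Y) (in1 C Y Z \<cdot> pr2 C X Y)) \<cdot> pair C (pr1 C X ?S \<cdot> pr1 C ?X Y) (pr2 C ?X Y))
      ((f \<cdot> pair C (pr1 C X Z) (in2 C Y Z \<cdot> pr2 C X Z)) \<cdot> pair C (pr1 C X ?S \<cdot> pr1 C ?X Z) (pr2 C ?X Z))"
    if f: "f \<in> arr C" "src C f = prd C X ?S" for f
    using cas_eta[of Y Z "pr2 C X ?S" ?X "f \<cdot> pair C (pr1 C X ?S \<cdot> pr1 C ?X ?S) (pr2 C ?X ?S)" "trg C f"] f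
    by (simp add: hom_iff)
  from this[of h] this[of k] show ?thesis using assms by metis
qed

sublocale bicartesian_category C
proof unfold_locales
  fix f g A B X
  assume f: "f \<in> hom C A X" and g: "g \<in> hom C B X"
  hence o: "A \<in> obj C" "B \<in> obj C" by auto
  \<comment> \<open>The copair is a case distinction on the identity of the sum whose branches
    ignore the context.\<close>
  let ?h = "cas A B (ide C (cpr C A B)) (f \<cdot> pr2 C (cpr C A B) A) (g \<cdot> pr2 C (cpr C A B) B)"
  show "\<exists>!h. h \<in> hom C (cpr C A B) X \<and> h \<cdot> in1 C A B = f \<and> h \<cdot> in2 C A B = g"
  proof (rule ex1I[of _ ?h])
    show "?h \<in> hom C (cpr C A B) X \<and> ?h \<cdot> in1 C A B = f \<and> ?h \<cdot> in2 C A B = g"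
      using f g o by (auto simp: hom_iff)
  next
    fix h assume h: "h \<in> hom C (cpr C A B) X \<and> h \<cdot> in1 C A B = f \<and> h \<cdot> in2 C A B = g"
    \<comment> \<open>The eta law for \<open>h\<close> composed with the second projection, that is,
      for \<open>h\<close> made to ignore the context.\<close>
    thus "h = ?h"
      using cas_eta[of A B "ide C (cpr C A B)" "cpr C A B" "h \<cdot> pr2 C (cpr C A B) (cpr C A B)" X] o
      by (auto simp: hom_iff)
  qed
qed (simp_all add: in1_hom in2_hom)

sublocale distributive_category C
proof unfold_locales
  fix X Y Z assume o [simp]: "X \<in> obj C" "Y \<in> obj C" "Z \<in> obj C"
  \<comment> \<open>The inverse distinguishes cases on the second component and pairs the first
    component with the bound variable.\<close>
  let ?d = "cas Y Z (pr2 C X (cpr C Y Z))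
    (in1 C (prd C X Y) (prd C X Z) \<cdot> cross C (pr1 C X (cpr C Y Z)) (ide C Y))
    (in2 C (prd C X Y) (prd C X Z) \<cdot> cross C (pr1 C X (cpr C Y Z)) (ide C Z))"
  have "codist C X Y Z \<cdot> ?d = ide C (prd C X (cpr C Y Z))"
    by (rule prd_cpr_ext[of _ _ X Y Z]) (simp_all add: codist_def)
  moreover have "?d \<cdot> codist C X Y Z = ide C (cpr C (prd C X Y) (prd C X Z))"
    by (simp add: codist_def)
  ultimately show "\<exists>d. inverse_pair C (prd C X (cpr C Y Z)) (cpr C (prd C X Y) (prd C X Z)) d (codist C X Y Z)"
    by (intro exI[of _ ?d]) (simp add: inverse_pair_def hom_iff codist_def)
qed (simp_all add: terminal pr1_hom pr2_hom product in1_hom in2_hom coproduct)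

text \<open>Identifies the interpretation of case terms with \<open>cas\<close>. The map
  \<open>copair C t u\<close> after \<open>dist\<close> restricts to \<open>t\<close> and
  \<open>u\<close>, and the eta law evaluates it at \<open>s\<close>.\<close>

lemma copair_dist_eq_cas:
  assumes "A \<in> obj C" "B \<in> obj C" "s \<in> arr C" "t \<in> arr C" "u \<in> arr C" "trg C s = cpr C A B" "src C s = X"
    "src C t = prd C X A" "src C u = prd C X B" "trg C u = trg C t"
  shows "copair C t u \<cdot> dist C X A B \<cdot> pair C (ide C X) s = cas A B s t u"
proof -
  have o: "X \<in> obj C" using assms by auto
  let ?h = "copair C t u \<cdot> dist C X A B"
  have h: "?h \<cdot> pair C (pr1 C X A) (in1 C A B \<cdot> pr2 C X A) = t"
    "?h \<cdot> pair C (pr1 C X B) (in2 C A B \<cdot> pr2 C X B) = u"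
    using o assms by simp_all
  have "cas A B s (?h \<cdot> pair C (pr1 C X A) (in1 C A B \<cdot> pr2 C X A)) (?h \<cdot> pair C (pr1 C X B) (in2 C A B \<cdot> pr2 C X B))
    = ?h \<cdot> pair C (ide C X) s"
    by (rule cas_eta) (use assms o in \<open>simp_all add: hom_iff\<close>)
  thus ?thesis unfolding h using o assms by simp
qed

end

text \<open>A strong monad presented by binding under a context. Since \<open>bnd\<close> carries
  the context, its unit and associativity laws contain those of the strength; the lifting is
  recovered as a bind that ignores the context, the strength as the bind that returns the context
  paired with the bound value.\<close>

locale bind_category = distributive_category C
  for C :: "('o, 'm, 'x) monad_data_scheme" (structure) +
  fixes bnd :: "'o \<Rightarrow> 'o \<Rightarrow> 'm \<Rightarrow> 'm \<Rightarrow> 'm"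
  assumes mon_obj [simp]: "A \<in> obj C \<Longrightarrow> mon C A \<in> obj C"
    and eta_hom: "A \<in> obj C \<Longrightarrow> eta C A \<in> hom C A (mon C A)"
    and bnd_hom: "\<lbrakk>A \<in> obj C; B \<in> obj C; p \<in> hom C X (mon C A); f \<in> hom C (prd C X A) (mon C B)\<rbrakk>
      \<Longrightarrow> bnd A B f p \<in> hom C X (mon C B)"
    and bnd_nat: "\<lbrakk>A \<in> obj C; B \<in> obj C; p \<in> hom C X (mon C A); f \<in> hom C (prd C X A) (mon C B); h \<in> hom C Z X\<rbrakk>
      \<Longrightarrow> bnd A B f p \<cdot> h = bnd A B (f \<cdot> cross C h (ide C A)) (p \<cdot> h)"
    and bnd_beta: "\<lbrakk>A \<in> obj C; B \<in> obj C; a \<in> hom C X A; f \<in> hom C (prd C X A) (mon C B)\<rbrakk>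
      \<Longrightarrow> bnd A B f (eta C A \<cdot> a) = f \<cdot> pair C (ide C X) a"
    and bnd_ret: "\<lbrakk>A \<in> obj C; p \<in> hom C X (mon C A)\<rbrakk> \<Longrightarrow> bnd A A (eta C A \<cdot> pr2 C X A) p = p"
    and bnd_bnd: "\<lbrakk>A \<in> obj C; B \<in> obj C; D \<in> obj C; p \<in> hom C X (mon C A); q \<in> hom C (prd C X A) (mon C B);
        r \<in> hom C (prd C X B) (mon C D)\<rbrakk>
      \<Longrightarrow> bnd B D r (bnd A B q p) = bnd A D (bnd B D (r \<cdot> cross C (pr1 C X A) (ide C B)) q) p"
    and ext_bnd: "\<lbrakk>B \<in> obj C; f \<in> hom C A (mon C B)\<rbrakk> \<Longrightarrow> ext C A B f = bnd A B (f \<cdot> pr2 C (mon C A) A) (ide C (mon C A))"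
    and tau_bnd: "\<lbrakk>A \<in> obj C; B \<in> obj C\<rbrakk>
      \<Longrightarrow> tau C A B = bnd B (prd C A B) (eta C (prd C A B) \<cdot> cross C (pr1 C A (mon C B)) (ide C B)) (pr2 C A (mon C B))"
begin

lemma eta_arr' [simp]:
  assumes "A \<in> obj C"
  shows "eta C A \<in> arr C" "src C (eta C A) = A" "trg C (eta C A) = mon C A"
  using eta_hom[OF assms] by auto

lemma bnd_arr [simp]:
  assumes "A \<in> obj C" "B \<in> obj C" "p \<in> arr C" "trg C p = mon C A" "f \<in> arr C" "src C f = prd C (src C p) A"
    "trg C f = mon C B"
  shows "bnd A B f p \<in> arr C" "src C (bnd A B f p) = src C p" "trg C (bnd A B f p) = mon C B"
  using bnd_hom[of A B p "src C p" f] assms by (auto simp: hom_iff)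

lemma bnd_comp [simp]:
  assumes "A \<in> obj C" "B \<in> obj C" "p \<in> arr C" "trg C p = mon C A" "f \<in> arr C" "src C f = prd C (src C p) A"
    "trg C f = mon C B"
    "h \<in> arr C" "trg C h = src C p"
  shows "bnd A B f p \<cdot> h = bnd A B (f \<cdot> cross C h (ide C A)) (p \<cdot> h)"
  by (rule bnd_nat) (use assms in \<open>auto simp: hom_iff\<close>)

lemma bnd_eta [simp]:
  assumes "A \<in> obj C" "B \<in> obj C" "a \<in> arr C" "trg C a = A" "f \<in> arr C" "src C f = prd C (src C a) A"
    "trg C f = mon C B"
  shows "bnd A B f (eta C A \<cdot> a) = f \<cdot> pair C (ide C (src C a)) a"
  by (rule bnd_beta) (use assms in \<open>auto simp: hom_iff\<close>)

lemma bnd_eta_ide [simp]: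
  assumes "A \<in> obj C" "B \<in> obj C" "f \<in> arr C" "src C f = prd C A A" "trg C f = mon C B"
  shows "bnd A B f (eta C A) = f \<cdot> pair C (ide C A) (ide C A)"
  using bnd_eta[of A B "ide C A" f] assms by simp

lemma bnd_ret_simp [simp]:
  assumes "A \<in> obj C" "p \<in> arr C" "trg C p = mon C A" "src C p = X"
  shows "bnd A A (eta C A \<cdot> pr2 C X A) p = p"
  by (rule bnd_ret) (use assms in \<open>auto simp: hom_iff\<close>)

lemma bnd_assoc [simp]:
  assumes "A \<in> obj C" "B \<in> obj C" "D \<in> obj C" "p \<in> arr C" "trg C p = mon C A" "q \<in> arr C" "src C q = prd C (src C p) A"
    "trg C q = mon C B" "r \<in> arr C" "src C r = prd C (src C p) B" "trg C r = mon C D"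
  shows "bnd B D r (bnd A B q p) = bnd A D (bnd B D (r \<cdot> cross C (pr1 C (src C p) A) (ide C B)) q) p"
  by (rule bnd_bnd) (use assms in \<open>auto simp: hom_iff\<close>)

lemma ext_arr_bnd [simp]:
  assumes "B \<in> obj C" "f \<in> arr C" "src C f = A" "trg C f = mon C B"
  shows "ext C A B f \<in> arr C" "src C (ext C A B f) = mon C A" "trg C (ext C A B f) = mon C B"
proof -
  have "A \<in> obj C" "ext C A B f = bnd A B (f \<cdot> pr2 C (mon C A) A) (ide C (mon C A))"
    using assms by (auto intro!: ext_bnd simp: hom_iff)
  thus "ext C A B f \<in> arr C" "src C (ext C A B f) = mon C A" "trg C (ext C A B f) = mon C B"
    using assms by simp_all
qed

lemma ext_comp_bnd:
  assumes "B \<in> obj C" "f \<in> arr C" "src C f = A" "trg C f = mon C B" "h \<in> arr C" "trg C h = mon C A"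
  shows "ext C A B f \<cdot> h = bnd A B (f \<cdot> pr2 C (src C h) A) h"
proof -
  have "A \<in> obj C" "ext C A B f = bnd A B (f \<cdot> pr2 C (mon C A) A) (ide C (mon C A))"
    using assms by (auto intro!: ext_bnd simp: hom_iff)
  thus ?thesis using assms by simp
qed

lemma mmap_arr_bnd [simp]:
  assumes "f \<in> arr C"
  shows "mmap C f \<in> arr C" "src C (mmap C f) = mon C (src C f)" "trg C (mmap C f) = mon C (trg C f)"
  using assms by (simp_all add: mmap_def)

lemma mmap_comp_bnd:
  assumes "f \<in> arr C" "src C f = A" "h \<in> arr C" "trg C h = mon C A"
  shows "mmap C f \<cdot> h = bnd A (trg C f) (eta C (trg C f) \<cdot> f \<cdot> pr2 C (src C h) A) h"
proof -
  have "A \<in> obj C" using assms by auto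
  thus ?thesis using assms by (simp add: mmap_def ext_comp_bnd)
qed

lemma tau_arr_bnd [simp]:
  assumes "A \<in> obj C" "B \<in> obj C"
  shows "tau C A B \<in> arr C" "src C (tau C A B) = prd C A (mon C B)" "trg C (tau C A B) = mon C (prd C A B)"
  using assms by (simp_all add: tau_bnd)

lemma tau_comp_bnd:
  assumes "A \<in> obj C" "B \<in> obj C" "h \<in> arr C" "trg C h = prd C A (mon C B)"
  shows "tau C A B \<cdot> h = bnd B (prd C A B)
    (eta C (prd C A B) \<cdot> pair C (pr1 C A (mon C B) \<cdot> h \<cdot> pr1 C (src C h) B) (pr2 C (src C h) B)) (pr2 C A (mon C
      B) \<cdot> h)"
  using assms by (simp add: tau_bnd)

lemma tau_pair_bnd:
  assumes "B \<in> obj C" "h \<in> arr C" "trg C h = A" "p \<in> arr C" "src C p = src C h" "trg C p = mon C B"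
  shows "tau C A B \<cdot> pair C h p = bnd B (prd C A B)
    (eta C (prd C A B) \<cdot> pair C (h \<cdot> pr1 C (src C h) B) (pr2 C (src C h) B)) p"
proof -
  have "A \<in> obj C" using assms by auto
  thus ?thesis using assms by (simp add: tau_comp_bnd flip: comp_assoc_arr)
qed

lemma mmap_bnd_eta:
  assumes "A \<in> obj C" "p \<in> arr C" "trg C p = mon C A" "q \<in> arr C" "src C q = prd C (src C p) A" "trg C q = B"
    "f \<in> arr C" "src C f = B"
  shows "mmap C f \<cdot> bnd A B (eta C B \<cdot> q) p = bnd A (trg C f) (eta C (trg C f) \<cdot> f \<cdot> q) p"
proof -
  have "B \<in> obj C" using assms by auto
  thus ?thesis using assms by (simp add: mmap_comp_bnd)
qed

lemma bnd_mmap: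
  assumes "f \<in> arr C" "src C f = A" "p \<in> arr C" "trg C p = mon C A" "trg C f = B" "D \<in> obj C"
    "r \<in> arr C" "src C r = prd C (src C p) B" "trg C r = mon C D"
  shows "bnd B D r (mmap C f \<cdot> p) = bnd A D (r \<cdot> pair C (pr1 C (src C p) A) (f \<cdot> pr2 C (src C p) A)) p"
proof -
  have "A \<in> obj C" "B \<in> obj C" using assms by auto
  thus ?thesis using assms by (simp add: mmap_comp_bnd)
qed

lemma ext_bnd_assoc:
  assumes "D \<in> obj C" "r \<in> arr C" "src C r = B" "trg C r = mon C D"
    "A \<in> obj C" "p \<in> arr C" "trg C p = mon C A" "q \<in> arr C" "src C q = prd C (src C p) A" "trg C q = mon C B"
  shows "ext C B D r \<cdot> bnd A B q p = bnd A D (ext C B D r \<cdot> q) p"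
proof -
  have "B \<in> obj C" using assms by auto
  thus ?thesis using assms by (simp add: ext_comp_bnd)
qed

lemma ext_eta_bnd:
  assumes "D \<in> obj C" "r \<in> arr C" "src C r = B" "trg C r = mon C D"
  shows "ext C B D r \<cdot> eta C B = r" "a \<in> arr C \<Longrightarrow> trg C a = B \<Longrightarrow> ext C B D r \<cdot> eta C B \<cdot> a = r \<cdot> a"
proof -
  have B: "B \<in> obj C" using assms by auto
  thus "ext C B D r \<cdot> eta C B = r" using assms by (simp add: ext_comp_bnd)
  show "a \<in> arr C \<Longrightarrow> trg C a = B \<Longrightarrow> ext C B D r \<cdot> eta C B \<cdot> a = r \<cdot> a"
    using assms B by (simp add: ext_comp_bnd)
qed

text \<open>Once \<open>ext\<close>, \<open>tau\<close>, \<open>mmap\<close> and \<open>mu\<close>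
  are expressed by \<open>bnd\<close>, the laws of \<open>bnd\<close> bring both sides of each
  strength axiom to one common expression.\<close>

sublocale strong_monad C
proof unfold_locales
  fix A A' B B' f g
  assume "f \<in> hom C A A'" "g \<in> hom C B B'"
  then have f: "f \<in> arr C" "src C f = A" "trg C f = A'" and g: "g \<in> arr C" "src C g = B" "trg C g = B'"
    by auto
  then have o: "A \<in> obj C" "B \<in> obj C" "A' \<in> obj C" "B' \<in> obj C" by auto
  have "tau C A' B' \<cdot> cross C f (mmap C g) = bnd B (prd C A' B') (eta C (prd C A' B') \<cdot>
     cross C f g \<cdot> cross C (pr1 C A (mon C B)) (ide C B)) (pr2 C A (mon C B))"
    using f g o by (simp add: tau_pair_bnd bnd_mmap)
  also have "\<dots> = mmap C (cross C f g) \<cdot> tau C A B"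
    using f g o by (simp add: tau_bnd mmap_bnd_eta)
  finally show "tau C A' B' \<cdot> cross C f (mmap C g) = mmap C (cross C f g) \<cdot> tau C A B" .
next
  fix A B D
  assume o: "A \<in> obj C" "B \<in> obj C" "D \<in> obj C"
  have "tau C A (prd C B D) \<cdot> cross C (ide C A) (tau C B D) \<cdot> assoc C A B (mon C D)
    = tau C A (prd C B D) \<cdot> pair C (pr1 C A B \<cdot> pr1 C (prd C A B) (mon C D))
       (tau C B D \<cdot> pair C (pr2 C A B \<cdot> pr1 C (prd C A B) (mon C D)) (pr2 C (prd C A B) (mon C D)))"
    using o by (simp add: assoc_def)
  also have "\<dots> = bnd D (prd C A (prd C B D)) (eta C (prd C A (prd C B D)) \<cdot>
     assoc C A B D \<cdot> cross C (pr1 C (prd C A B) (mon C D)) (ide C D)) (pr2 C (prd C A B) (mon C D))"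
    using o by (simp add: tau_pair_bnd assoc_def)
  also have "\<dots> = mmap C (assoc C A B D) \<cdot> tau C (prd C A B) D"
    using o by (simp add: tau_bnd mmap_bnd_eta assoc_def)
  finally show "mmap C (assoc C A B D) \<cdot> tau C (prd C A B) D =
          tau C A (prd C B D) \<cdot> cross C (ide C A) (tau C B D) \<cdot> assoc C A B (mon C D)" ..
next
  fix A B
  assume "A \<in> obj C" "B \<in> obj C"
  then show "tau C A B \<cdot> cross C (ide C A) (eta C B) = eta C (prd C A B)" by (simp add: tau_pair_bnd)
next
  fix A B
  assume o: "A \<in> obj C" "B \<in> obj C"
  have "tau C A B \<cdot> cross C (ide C A) (mu C B) = bnd (mon C B) (prd C A B)
      (tau C A B \<cdot> cross C (pr1 C A (mon C (mon C B))) (ide C (mon C B))) (pr2 C A (mon C (mon C B)))"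
    using o by (simp add: tau_pair_bnd mu_def ext_comp_bnd)
  moreover have "mu C (prd C A B) \<cdot> mmap C (tau C A B) \<cdot> tau C A (mon C B) = bnd (mon C B) (prd C A B)
      (tau C A B \<cdot> cross C (pr1 C A (mon C (mon C B))) (ide C (mon C B))) (pr2 C A (mon C (mon C B)))"
    using o by (simp add: tau_bnd[of A "mon C B"] mmap_bnd_eta mu_def ext_bnd_assoc ext_eta_bnd)
  ultimately show "tau C A B \<cdot> cross C (ide C A) (mu C B) = mu C (prd C A B) \<cdot> mmap C (tau C A B) \<cdot> tau C A (mon C B)"
    by simp
next
  fix A
  assume "A \<in> obj C"
  then show "mmap C (pr2 C (one C) A) \<cdot> tau C (one C) A = pr2 C (one C) (mon C A)"
    by (simp add: tau_bnd mmap_bnd_eta)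
next
  fix B D f A g
  assume "B \<in> obj C" "D \<in> obj C" "f \<in> hom C A (mon C B)" "g \<in> hom C B (mon C D)"
  moreover then have "A \<in> obj C" by auto
  ultimately show "ext C A D (ext C B D g \<cdot> f) = ext C B D g \<cdot> ext C A B f"
    by (simp add: hom_iff ext_bnd[of _ _ A] ext_bnd_assoc)
next
  fix B f A
  assume "B \<in> obj C" "f \<in> hom C A (mon C B)"
  moreover then have "A \<in> obj C" by auto
  ultimately show "ext C A B f \<in> hom C (mon C A) (mon C B)" "ext C A B f \<cdot> eta C A = f"
    by (auto simp: hom_iff ext_comp_bnd)
next
  fix A assume "A \<in> obj C"
  then show "ext C A A (eta C A) = ide C (mon C A)" by (simp add: ext_bnd hom_iff)
qed (auto simp: hom_iff)

text \<open>Identifies the interpretation of do terms with \<open>bnd\<close>, as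
  \<open>copair_dist_eq_cas\<close> does for case terms.\<close>

lemma bind_eq_bnd:
  assumes "A \<in> obj C" "B \<in> obj C" "p \<in> arr C" "trg C p = mon C A" "f \<in> arr C" "src C f = prd C (src C p) A"
    "trg C f = mon C B"
  shows "bind C A B f p = bnd A B f p"
  using assms by (simp add: bind_def tau_pair_bnd ext_bnd_assoc)

end

locale choice_category = bind_category C bnd
  for C :: "('o, 'm, 'x) monad_data_scheme" (structure) and bnd +
  assumes delta_hom: "A \<in> obj C \<Longrightarrow> delta C A \<in> hom C (one C) (mon C A)"
    and varpi_hom: "A \<in> obj C \<Longrightarrow> varpi C A \<in> hom C (prd C (mon C A) (mon C A)) (mon C A)"
    and choice_dead: "\<lbrakk>A \<in> obj C; p \<in> hom C X (mon C A)\<rbrakk> \<Longrightarrow> varpi C A \<cdot> pair C p (delta C A \<cdot> bang C X) = p"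
    and choice_comm: "\<lbrakk>A \<in> obj C; p \<in> hom C X (mon C A); q \<in> hom C X (mon C A)\<rbrakk>
      \<Longrightarrow> varpi C A \<cdot> pair C p q = varpi C A \<cdot> pair C q p"
    and choice_idem: "\<lbrakk>A \<in> obj C; p \<in> hom C X (mon C A)\<rbrakk> \<Longrightarrow> varpi C A \<cdot> pair C p p = p"
    and choice_assoc: "\<lbrakk>A \<in> obj C; p \<in> hom C X (mon C A); q \<in> hom C X (mon C A); r \<in> hom C X (mon C A)\<rbrakk>
      \<Longrightarrow> varpi C A \<cdot> pair C p (varpi C A \<cdot> pair C q r) = varpi C A \<cdot> pair C (varpi C A \<cdot> pair C p q) r"
    and bnd_dead: "\<lbrakk>A \<in> obj C; B \<in> obj C; X \<in> obj C; f \<in> hom C (prd C X A) (mon C B)\<rbrakk>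
      \<Longrightarrow> bnd A B f (delta C A \<cdot> bang C X) = delta C B \<cdot> bang C X"
    and bnd_choice: "\<lbrakk>A \<in> obj C; B \<in> obj C; f \<in> hom C (prd C X A) (mon C B); p \<in> hom C X (mon C A); q \<in> hom C X
      (mon C A)\<rbrakk>
      \<Longrightarrow> bnd A B f (varpi C A \<cdot> pair C p q) = varpi C B \<cdot> pair C (bnd A B f p) (bnd A B f q)"
begin

lemma delta_varpi_arr [simp]:
  assumes "A \<in> obj C"
  shows "delta C A \<in> arr C" "src C (delta C A) = one C" "trg C (delta C A) = mon C A"
    "varpi C A \<in> arr C" "src C (varpi C A) = prd C (mon C A) (mon C A)" "trg C (varpi C A) = mon C A"
  using delta_hom[OF assms] varpi_hom[OF assms] by auto

lemma bnd_dead_simp [simp]: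
  assumes "A \<in> obj C" "B \<in> obj C" "X \<in> obj C" "f \<in> arr C" "src C f = prd C X A" "trg C f = mon C B"
  shows "bnd A B f (delta C A \<cdot> bang C X) = delta C B \<cdot> bang C X"
  by (rule bnd_dead) (use assms in \<open>auto simp: hom_iff\<close>)

lemma bnd_dead_one [simp]:
  assumes "A \<in> obj C" "B \<in> obj C" "f \<in> arr C" "src C f = prd C (one C) A" "trg C f = mon C B"
  shows "bnd A B f (delta C A) = delta C B"
  using bnd_dead_simp[of A B "one C" f] assms by (simp add: bang_one)

lemma delta_pr2 [simp]:
  assumes "A \<in> obj C" "X \<in> obj C"
  shows "delta C A \<cdot> pr2 C X (one C) = delta C A \<cdot> bang C (prd C X (one C))"
  using assms bang_unique[of "pr2 C X (one C)" "prd C X (one C)"] by simp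

lemma bnd_choice_simp [simp]:
  assumes "A \<in> obj C" "B \<in> obj C" "f \<in> arr C" "src C f = prd C (src C p) A" "trg C f = mon C B"
    "p \<in> arr C" "q \<in> arr C" "src C q = src C p" "trg C p = mon C A" "trg C q = mon C A"
  shows "bnd A B f (varpi C A \<cdot> pair C p q) = varpi C B \<cdot> pair C (bnd A B f p) (bnd A B f q)"
  by (rule bnd_choice) (use assms in \<open>auto simp: hom_iff\<close>)

text \<open>Exhibits \<open>varpi\<close> as a choice between two generalized elements, so that the
  law for binding a choice applies to it.\<close>

lemma varpi_expand: "A \<in> obj C \<Longrightarrow> varpi C A = varpi C A \<cdot> pair C (pr1 C (mon C A) (mon C A)) (pr2 C (mon C A) (mon C A))"
  by simp

lemma bnd_varpi [simp]:
  assumes "A \<in> obj C" "B \<in> obj C" "f \<in> arr C" "src C f = prd C (prd C (mon C A) (mon C A)) A" "trg C f = mon C B"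
  shows "bnd A B f (varpi C A) = varpi C B \<cdot> pair C (bnd A B f (pr1 C (mon C A) (mon C A))) (bnd A B f (pr2 C
    (mon C A) (mon C A)))"
  using assms by (subst varpi_expand) (simp_all del: pair_pr)

lemma bnd_varpi_comp [simp]:
  assumes "A \<in> obj C" "B \<in> obj C" "f \<in> arr C" "src C f = prd C (src C h) A" "trg C f = mon C B" "h \<in> arr C"
    "trg C h = prd C (mon C A) (mon C A)"
  shows "bnd A B f (varpi C A \<cdot> h) = varpi C B \<cdot> pair C (bnd A B f (pr1 C (mon C A) (mon C A)
    \<cdot> h)) (bnd A B f (pr2 C (mon C A) (mon C A) \<cdot> h))"
  using assms bnd_choice_simp[of A B f "pr1 C (mon C A) (mon C A) \<cdot> h" "pr2 C (mon C A) (mon C A) \<cdot> h"]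
  by (simp del: bnd_choice_simp)

text \<open>The internal laws are the laws for generalized elements taken at generic ones, namely
  identities and projections.\<close>

sublocale semi_additive_monad C
proof unfold_locales
  fix A assume A: "A \<in> obj C"
  let ?T = "mon C A"
  show "varpi C A \<cdot> pair C (ide C (mon C A)) (delta C A \<cdot> bang C (mon C A)) = ide C (mon C A)"
    by (rule choice_dead) (use A in \<open>auto simp: hom_iff\<close>)
  show "varpi C A \<cdot> pair C (ide C (mon C A)) (ide C (mon C A)) = ide C (mon C A)"
    by (rule choice_idem) (use A in \<open>auto simp: hom_iff\<close>)
  show "varpi C A \<cdot> pair C (pr2 C (mon C A) (mon C A)) (pr1 C (mon C A) (mon C A)) = varpi C A"
    using A choice_comm[of A "pr2 C ?T ?T" "prd C ?T ?T" "pr1 C ?T ?T"] by (simp add: hom_iff)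
  show "varpi C A \<cdot> cross C (ide C (mon C A)) (varpi C A) \<cdot> assoc C (mon C A) (mon C A) (mon C A) =
          varpi C A \<cdot> cross C (varpi C A) (ide C (mon C A))"
    using A choice_assoc[of A "pr1 C ?T ?T \<cdot> pr1 C (prd C ?T ?T) ?T" "prd C (prd C ?T ?T) ?T"
      "pr2 C ?T ?T \<cdot> pr1 C (prd C ?T ?T) ?T" "pr2 C (prd C ?T ?T) ?T"]
    by (simp add: hom_iff assoc_def)
next
  fix X A B f
  assume "B \<in> obj C" "f \<in> hom C X A"
  moreover then have "A \<in> obj C" "X \<in> obj C" by auto
  ultimately show "tau C A B \<cdot> cross C f (delta C B) = delta C (prd C A B) \<cdot> bang C (prd C X (one C))"
    "tau C A B \<cdot> cross C f (varpi C B) =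
          varpi C (prd C A B) \<cdot> pair C (tau C A B \<cdot> cross C f (pr1 C (mon C B) (mon C B)))
                                       (tau C A B \<cdot> cross C f (pr2 C (mon C B) (mon C B)))"
    by (auto simp: tau_pair_bnd hom_iff)
next
  fix A B f
  assume "B \<in> obj C" "f \<in> hom C A (mon C B)"
  moreover then have "A \<in> obj C" by auto
  ultimately show "ext C A B f \<cdot> delta C A = delta C B"
    "ext C A B f \<cdot> varpi C A =
          varpi C B \<cdot> pair C (ext C A B f \<cdot> pr1 C (mon C A) (mon C A))
                             (ext C A B f \<cdot> pr2 C (mon C A) (mon C A))"
    by (auto simp: ext_comp_bnd hom_iff)
next
  fix A B f
  assume "f \<in> hom C A B"
  moreover then have "A \<in> obj C" "B \<in> obj C" by auto
  ultimately show "mmap C f \<cdot> delta C A = delta C B"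
    "mmap C f \<cdot> varpi C A = varpi C B \<cdot> cross C (mmap C f) (mmap C f)"
    by (auto simp: mmap_comp_bnd hom_iff simp del: mmap_unfold)
qed (simp_all add: delta_hom varpi_hom)

end

section \<open>The calculus on one-variable contexts\<close>

lemma sub_cong_typed:
  assumes "typed \<Sigma> \<Gamma> t A" "\<forall>i<length \<Gamma>. \<sigma> i = \<tau> i"
  shows "sub \<sigma> t = sub \<tau> t"
  using assms
proof (induction arbitrary: \<sigma> \<tau>)
  case (Case \<Gamma> s A B t C u)
  have "\<forall>i<length (X # \<Gamma>). lift_sub \<sigma> i = lift_sub \<tau> i" for X
    using Case(7) by (simp add: all_less_Suc_iff)
  from this[of A] this[of B] show ?case using Case.IH(1)[OF Case.prems] Case.IH(2,3) by simp
next
  case (Do \<Gamma> p A q B)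
  have "\<forall>i<length (X # \<Gamma>). lift_sub \<sigma> i = lift_sub \<tau> i" for X
    using Do(5) by (simp add: all_less_Suc_iff)
  from this[of A] show ?case using Do.IH(1)[OF Do.prems] Do.IH(2) by simp
next
  case (Unfold \<Gamma> p A q B)
  have "\<forall>i<length (X # \<Gamma>). lift_sub \<sigma> i = lift_sub \<tau> i" for X
    using Unfold(5) by (simp add: all_less_Suc_iff)
  from this[of A] show ?case using Unfold.IH(1)[OF Unfold.prems] Unfold.IH(2) by simp
qed simp_all

text \<open>On a term with one free variable a substitution matters only through its value at 0. The
  constant function is the chosen normal form, and composition of morphisms is written with
  it.\<close>

lemma sub_closed1:
  "typed \<Sigma> [A] t B \<Longrightarrow> \<sigma> 0 = s \<Longrightarrow> sub \<sigma> t = sub (\<lambda>_. s) t"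
  by (rule sub_cong_typed) auto

lemma sub_closed1_id:
  "typed \<Sigma> [A] t B \<Longrightarrow> \<sigma> 0 = Var 0 \<Longrightarrow> sub \<sigma> t = t"
  using sub_cong_typed[of \<Sigma> "[A]" t B \<sigma> Var] by simp

lemma typed_sub1: "typed \<Sigma> [A] t B \<Longrightarrow> typed \<Sigma> \<Gamma> s A \<Longrightarrow> typed \<Sigma> \<Gamma> (sub (\<lambda>_. s) t) B"
  by (rule typed_subI) (auto simp: typed_sub_def dest: typed_wf_ctx)

text \<open>De Bruijn index 0 is the most recent variable, so a one-variable term is typed unchanged
  in every longer context with the same head.\<close>

lemma typed_append: "typed \<Sigma> [A] t B \<Longrightarrow> wf_ctx \<Sigma> \<Gamma> \<Longrightarrow> typed \<Sigma> (A # \<Gamma>) t B"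
  using typed_sub1[of \<Sigma> A t B "A # \<Gamma>" "Var 0"] sub_closed1_id[of \<Sigma> A t B "\<lambda>_. Var 0"]
  by (auto simp: typed_Var0 dest: typed_wf_ctx)

text \<open>Branches and continuations are morphisms out of a product of context and bound type,
  whereas binders see two variables: index 1 is the context and index 0 the bound value.\<close>

definition curry_tm :: "('w, 'f) tm \<Rightarrow> ('w, 'f) tm" where
  "curry_tm t = sub (\<lambda>_. Tup (Var (Suc 0)) (Var 0)) t"

lemma typed_VarI: "wf_ctx \<Sigma> \<Gamma> \<Longrightarrow> i < length \<Gamma> \<Longrightarrow> \<Gamma> ! i = A \<Longrightarrow> typed \<Sigma> \<Gamma> (Var i) A"
  using typed.Var by blast

lemma typed_curry_tm:
  assumes "typed \<Sigma> [TProd X A] t B"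
  shows "typed \<Sigma> [A, X] (curry_tm t) B"
proof -
  have "wf_ty \<Sigma> X" "wf_ty \<Sigma> A" using typed_wf_ctx[OF assms] by auto
  thus ?thesis unfolding curry_tm_def by (intro typed_sub1[OF assms] typed.Tup typed_VarI) auto
qed

locale calculus =
  fixes \<Sigma> :: "('w, 'f) signature" and \<Phi> :: "('w, 'f) equation set"
  assumes wf_sig: "wf_signature \<Sigma>" and wt: "\<forall>\<phi>\<in>\<Phi>. wt_equation \<Sigma> \<phi>"
begin

abbreviation D where "D \<equiv> derivable \<Sigma> \<Phi>"
abbreviation T where "T \<equiv> typed \<Sigma>"

lemma D_typed: "D \<Gamma> t s A \<Longrightarrow> T \<Gamma> t A" "D \<Gamma> t s A \<Longrightarrow> T \<Gamma> s A"
  using derivable_typed[OF wf_sig wt] by auto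

lemma D_weaken:
  assumes "D \<Gamma> t s A" "wf_ty \<Sigma> B"
  shows "D (B # \<Gamma>) (ren Suc t) (ren Suc s) A"
  unfolding ren_eq_sub
  by (rule derivable.subst[OF assms(1)]) (use assms D_typed(1)[OF assms(1)] in \<open>auto dest: typed_wf_ctx intro!:
    typed_VarI\<close>)

definition D_sub :: "'w ctx \<Rightarrow> (nat \<Rightarrow> ('w, 'f) tm) \<Rightarrow> (nat \<Rightarrow> ('w, 'f) tm) \<Rightarrow> 'w ctx \<Rightarrow> bool" where
  "D_sub \<Delta> \<sigma> \<tau> \<Gamma> \<longleftrightarrow> wf_ctx \<Sigma> \<Delta> \<and> (\<forall>i<length \<Gamma>. D \<Delta> (\<sigma> i) (\<tau> i) (\<Gamma> ! i))"

lemma D_sub_lift: "D_sub \<Delta> \<sigma> \<tau> \<Gamma> \<Longrightarrow> wf_ty \<Sigma> A \<Longrightarrow> D_sub (A # \<Delta>) (lift_sub \<sigma>) (lift_sub \<tau>) (A # \<Gamma>)"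
  by (auto simp: D_sub_def all_less_Suc_iff D_weaken intro!: derivable.refl typed_VarI)

text \<open>The rule \<open>subst\<close> varies the term under a fixed substitution. Varying the
  substitution instead is an induction on the term through the congruence rules, with weakening of
  derivations at the binders.\<close>

lemma sub_cong_D:
  assumes "T \<Gamma> t A" "D_sub \<Delta> \<sigma> \<tau> \<Gamma>"
  shows "D \<Delta> (sub \<sigma> t) (sub \<tau> t) A"
  using assms
proof (induction arbitrary: \<Delta> \<sigma> \<tau>)
  case (Var \<Gamma> i)
  then show ?case by (simp add: D_sub_def)
next
  case (Star \<Gamma>)
  then show ?case by (auto intro!: derivable.refl typed.Star simp: D_sub_def)
next
  case (Dead \<Gamma> A)
  then show ?case by (auto intro!: derivable.refl typed.Dead simp: D_sub_def)
next
  case (Fst \<Gamma> t A B)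
  show ?case using Fst.IH[OF Fst.prems] by (auto intro: derivable.cong_Fst)
next
  case (Snd \<Gamma> t A B)
  show ?case using Snd.IH[OF Snd.prems] by (auto intro: derivable.cong_Snd)
next
  case (Case \<Gamma> s A B t C u)
  have "wf_ty \<Sigma> A" "wf_ty \<Sigma> B" using Case(2,3)[THEN typed_wf_ctx] by auto
  then show ?case by (simp, intro derivable.cong_Case[where A=A and B=B] Case.IH D_sub_lift Case.prems)
next
  case (Do \<Gamma> p A q B)
  have "wf_ty \<Sigma> A" using Do(2)[THEN typed_wf_ctx] by auto
  then show ?case by (simp, intro derivable.cong_Do[where A=A] Do.IH D_sub_lift Do.prems)
next
  case (Unfold \<Gamma> p A q B)
  have "wf_ty \<Sigma> A" using Unfold(2)[THEN typed_wf_ctx] by auto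
  then show ?case by (simp, intro derivable.cong_Unfold[where A=A] Unfold.IH D_sub_lift Unfold.prems)
qed (auto intro: derivable.intros)

text \<open>Makes composition well defined on classes of terms.\<close>

lemma D_sub1:
  assumes "D [A] t t' B" "D \<Gamma> s s' A"
  shows "D \<Gamma> (sub (\<lambda>_. s) t) (sub (\<lambda>_. s') t') B"
proof (rule derivable.trans)
  have w: "wf_ctx \<Sigma> \<Gamma>" using D_typed(1)[OF assms(2)] by (rule typed_wf_ctx)
  show "D \<Gamma> (sub (\<lambda>_. s) t) (sub (\<lambda>_. s') t) B"
    by (rule sub_cong_D[OF D_typed(1)[OF assms(1)]]) (use assms w in \<open>auto simp: D_sub_def\<close>)
  show "D \<Gamma> (sub (\<lambda>_. s') t) (sub (\<lambda>_. s') t') B"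
    by (rule derivable.subst[OF assms(1) w]) (use D_typed(2)[OF assms(2)] in auto)
qed

lemmas D_refl = derivable.refl
lemmas D_trans [trans] = derivable.trans[of \<Sigma> \<Phi>]

lemma D_append:
  assumes "D [A] t t' B" "wf_ctx \<Sigma> \<Gamma>"
  shows "D (A # \<Gamma>) t t' B"
proof -
  have "wf_ty \<Sigma> A" using D_typed(1)[OF assms(1)] typed_wf_ctx by fastforce
  hence "D (A # \<Gamma>) (sub (\<lambda>_. Var 0) t) (sub (\<lambda>_. Var 0) t') B"
    using assms by (intro D_sub1[OF assms(1)] D_refl typed_VarI) auto
  thus ?thesis using assms(1)[THEN D_typed(1)] assms(1)[THEN D_typed(2)] by (simp add: sub_closed1_id)
qed

lemma D_curry:
  assumes "D [TProd X A] t t' B"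
  shows "D [A, X] (curry_tm t) (curry_tm t') B"
proof -
  have "wf_ty \<Sigma> X" "wf_ty \<Sigma> A" using typed_wf_ctx[OF D_typed(1)[OF assms]] by auto
  thus ?thesis unfolding curry_tm_def by (intro D_sub1[OF assms] D_refl typed.Tup typed_VarI) auto
qed

text \<open>Substituting under a binder agrees, up to the beta rules for pairs, with precomposing
  the uncurried term by \<open>h\<close> times the identity. The naturality of \<open>cas\<close>
  and \<open>bnd\<close> in the term model rests on this.\<close>

lemma D_curry_cross:
  assumes "T [TProd X A] t B" "T [Z] h X"
  shows "D [A, Z] (sub (lift_sub (\<lambda>_. h)) (curry_tm t))
    (curry_tm (sub (\<lambda>_. Tup (sub (\<lambda>_. Fst (Var 0)) h) (Snd (Var 0))) t)) B"
proof -
  have w: "wf_ty \<Sigma> A" "wf_ty \<Sigma> Z" "wf_ty \<Sigma> X" using assms[THEN typed_wf_ctx] by auto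
  have p: "T [A, Z] (Tup (Var (Suc 0)) (Var 0)) (TProd Z A)" and v: "T [A, Z] (Var 0) A" "T [A, Z] (Var (Suc 0)) Z"
    using w by (auto intro!: typed.Tup typed_VarI)
  have "D [A, Z] (sub (\<lambda>_. Tup (sub (\<lambda>_. Var (Suc 0)) h) (Var 0)) t)
    (sub (\<lambda>_. Tup (sub (\<lambda>_. Fst (Tup (Var (Suc 0)) (Var 0))) h) (Snd (Tup (Var (Suc 0)) (Var 0)))) t) B"
    by (rule D_sub1[OF D_refl[OF assms(1)]] derivable.cong_Tup D_sub1[OF D_refl[OF assms(2)]]
        derivable.sym[OF derivable.fst] derivable.sym[OF derivable.snd] v)+
  moreover have "ren Suc h = sub (\<lambda>_. Var (Suc 0)) h"
    unfolding ren_eq_sub by (rule sub_closed1[OF assms(2)]) simp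
  ultimately show ?thesis by (simp add: curry_tm_def sub_sub)
qed

lemma D_case_inl:
  assumes "T [X] a A" "T [TProd X A] t Y" "T [TProd X B] u Y"
  shows "D [X] (Case (InL B a) (curry_tm t) (curry_tm u)) (sub (\<lambda>_. Tup (Var 0) a) t) Y"
  using derivable.case_InL[OF assms(1) typed_curry_tm[OF assms(2)] typed_curry_tm[OF assms(3)]]
  by (simp add: inst_def curry_tm_def sub_sub)

lemma D_case_inr:
  assumes "T [X] b B" "T [TProd X A] t Y" "T [TProd X B] u Y"
  shows "D [X] (Case (InR A b) (curry_tm t) (curry_tm u)) (sub (\<lambda>_. Tup (Var 0) b) u) Y"
  using derivable.case_InR[OF assms(1) typed_curry_tm[OF assms(2)] typed_curry_tm[OF assms(3)]]
  by (simp add: inst_def curry_tm_def sub_sub)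

text \<open>The axiom \<open>case_sub\<close>, with the curried \<open>h\<close> as outer term and
  injections as branches, pulls \<open>h\<close> out of the case; \<open>case_id\<close> collapses
  what is left. Beta rules for pairs adjust the branches beforehand.\<close>

lemma D_case_eta:
  assumes s: "T [X] s (TSum A B)" and h: "T [TProd X (TSum A B)] h Y"
  shows "D [X] (Case s (curry_tm (sub (\<lambda>_. Tup (Fst (Var 0)) (InL B (Snd (Var 0)))) h))
      (curry_tm (sub (\<lambda>_. Tup (Fst (Var 0)) (InR A (Snd (Var 0)))) h))) (sub (\<lambda>_. Tup (Var 0) s) h) Y"
proof -
  have w: "wf_ty \<Sigma> A" "wf_ty \<Sigma> B" "wf_ty \<Sigma> X"
    using typed_wf[OF wf_sig s] by auto
  have l: "T [A, X] (InL B (Var 0)) (TSum A B)" and r: "T [B, X] (InR A (Var 0)) (TSum A B)"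
    using w by (auto intro!: typed.InL typed.InR typed_VarI)
  have v: "T [A, X] (Var 0) A" "T [A, X] (Var (Suc 0)) X" "T [B, X] (Var 0) B" "T [B, X] (Var (Suc 0)) X"
    "T [X] (Var 0) X"
    using w by (auto intro!: typed_VarI)
  have "D [A, X] (curry_tm (sub (\<lambda>_. Tup (Fst (Var 0)) (InL B (Snd (Var 0)))) h)) (inst (InL B (Var 0))
    (wk_under (curry_tm h))) Y"
    unfolding curry_tm_def wk_under_def inst_def ren_eq_sub sub_sub
    by (simp, (rule D_sub1[OF D_refl[OF h]] derivable.cong_Tup derivable.cong_InL derivable.fst derivable.snd v w)+)
  moreover have "D [B, X] (curry_tm (sub (\<lambda>_. Tup (Fst (Var 0)) (InR A (Snd (Var 0)))) h)) (inst (InR A (Var 0))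
    (wk_under (curry_tm h))) Y"
    unfolding curry_tm_def wk_under_def inst_def ren_eq_sub sub_sub
    by (simp, (rule D_sub1[OF D_refl[OF h]] derivable.cong_Tup derivable.cong_InR derivable.fst derivable.snd v w)+)
  ultimately have "D [X] (Case s (curry_tm (sub (\<lambda>_. Tup (Fst (Var 0)) (InL B (Snd (Var 0)))) h))
      (curry_tm (sub (\<lambda>_. Tup (Fst (Var 0)) (InR A (Snd (Var 0)))) h)))
      (Case s (inst (InL B (Var 0)) (wk_under (curry_tm h))) (inst (InR A (Var 0)) (wk_under (curry_tm h)))) Y"
    by (rule derivable.cong_Case[OF D_refl[OF s]])
  also have "D [X] (Case s (inst (InL B (Var 0)) (wk_under (curry_tm h))) (inst (InR A (Var 0)) (wk_under
    (curry_tm h))))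
     (inst (Case s (InL B (Var 0)) (InR A (Var 0))) (curry_tm h)) Y"
    by (rule derivable.case_sub[OF s l r typed_curry_tm[OF h]])
  also have "D [X] (inst (Case s (InL B (Var 0)) (InR A (Var 0))) (curry_tm h)) (sub (\<lambda>_. Tup (Var 0) s) h) Y"
    unfolding curry_tm_def inst_def sub_sub
    by (simp, (rule D_sub1[OF D_refl[OF h]] derivable.cong_Tup derivable.case_id D_refl v s)+)
  finally show ?thesis .
qed

lemma D_do_beta:
  assumes "T [X] a A" "T [TProd X A] f (TMon B)"
  shows "D [X] (Do (Ret a) (curry_tm f)) (sub (\<lambda>_. Tup (Var 0) a) f) (TMon B)"
  using derivable.do_beta[OF assms(1) typed_curry_tm[OF assms(2)]]
  by (simp add: inst_def curry_tm_def sub_sub)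

lemma D_do_ret:
  assumes "T [X] p (TMon A)"
  shows "D [X] (Do p (curry_tm (Ret (Snd (Var 0))))) p (TMon A)"
proof -
  have w: "wf_ty \<Sigma> A" "wf_ty \<Sigma> X" using typed_wf[OF wf_sig assms] by auto
  have "D [A, X] (Ret (Snd (Tup (Var (Suc 0)) (Var 0)))) (Ret (Var 0)) (TMon A)"
    using w by (intro derivable.cong_Ret derivable.snd[where A=X] typed_VarI) auto
  hence "D [X] (Do p (curry_tm (Ret (Snd (Var 0))))) (Do p (Ret (Var 0))) (TMon A)"
    by (auto simp: curry_tm_def intro: derivable.cong_Do[OF D_refl[OF assms]])
  thus ?thesis using derivable.do_ret[OF assms] by (rule derivable.trans)
qed

lemma D_do_assoc:
  assumes p: "T [X] p (TMon A)" and q: "T [TProd X A] q (TMon B)" and r: "T [TProd X B] r (TMon E)"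
  shows "D [X] (Do (Do p (curry_tm q)) (curry_tm r))
    (Do p (curry_tm (Do q (curry_tm (sub (\<lambda>_. Tup (Fst (Fst (Var 0))) (Snd (Var 0))) r))))) (TMon E)"
proof -
  have w: "wf_ty \<Sigma> A" "wf_ty \<Sigma> X" "wf_ty \<Sigma> B" using typed_wf[OF wf_sig p] typed_wf[OF wf_sig q] by auto
  have v: "T [B, A, X] (Var 0) B" "T [B, A, X] (Var (Suc 0)) A" "T [B, A, X] (Var (Suc (Suc 0))) X"
    using w by (auto intro!: typed_VarI)
  let ?c = "Tup (Tup (Var (Suc (Suc 0))) (Var (Suc 0))) (Var 0)"
  \<comment> \<open>The three variables are compared with projections from their nested tuple; this
    is the only discrepancy between \<open>wk_under\<close> and the forgetful projection on
    \<open>r\<close>.\<close>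
  have c: "D [B, A, X] (Tup (Var (Suc (Suc 0))) (Var 0)) (Tup (Fst (Fst ?c)) (Snd ?c)) (TProd X B)"
    by (rule derivable.cong_Tup derivable.sym[OF derivable.snd[where A="TProd X A"]]
       derivable.sym[OF derivable.trans[OF derivable.cong_Fst[OF derivable.fst[where A="TProd X A" and B=B]]
         derivable.fst]] v typed.Tup)+
  have "D [B, A, X] (sub (\<lambda>_. Tup (Var (Suc (Suc 0))) (Var 0)) r) (sub (\<lambda>_. Tup (Fst (Fst ?c)) (Snd ?c)) r) (TMon E)"
    by (rule D_sub1[OF D_refl[OF r] c])
  hence "D [X] (Do p (Do (curry_tm q) (sub (\<lambda>_. Tup (Var (Suc (Suc 0))) (Var 0)) r)))
     (Do p (Do (curry_tm q) (sub (\<lambda>_. Tup (Fst (Fst ?c)) (Snd ?c)) r))) (TMon E)"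
    by (intro derivable.cong_Do[OF D_refl[OF p]] derivable.cong_Do[OF D_refl[OF typed_curry_tm[OF q]]])
  moreover have "D [X] (Do (Do p (curry_tm q)) (curry_tm r)) (Do p (Do (curry_tm q) (wk_under (curry_tm r)))) (TMon E)"
    by (rule derivable.do_assoc[OF p typed_curry_tm[OF q] typed_curry_tm[OF r]])
  moreover have "wk_under (curry_tm r) = sub (\<lambda>_. Tup (Var (Suc (Suc 0))) (Var 0)) r"
    by (simp add: wk_under_def curry_tm_def ren_eq_sub sub_sub)
  moreover have "curry_tm (Do q (curry_tm (sub (\<lambda>_. Tup (Fst (Fst (Var 0))) (Snd (Var 0))) r)))
    = Do (curry_tm q) (sub (\<lambda>_. Tup (Fst (Fst ?c)) (Snd ?c)) r)"
    by (simp add: curry_tm_def sub_sub)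
  ultimately show ?thesis by (auto intro: derivable.trans)
qed

text \<open>The co-iteration rule has \<open>Ret\<close> inside the branches, while the functor of
  the term model puts it outside the case. \<open>case_sub\<close> with \<open>Ret (Var 0)\<close>
  as outer term exchanges the two, and the two directions of the rule over a single variable give
  the equivalence.\<close>

lemma D_out_step:
  assumes q: "T [X] q (TMon (TSum X A))" and h: "T [X] h (TNu A)"
  shows "D [X] (Out h) (Do q (Ret (Case (Var 0) (InL A h) (InR (TNu A) (Var 0))))) (TMon (TSum (TNu A) A))
    \<longleftrightarrow> D [X] h (Unfold (Var 0) q) (TNu A)"
proof -
  have w: "wf_ty \<Sigma> A" "wf_ty \<Sigma> X" using typed_wf[OF wf_sig q] by auto
  have v: "T [TSum X A, X] (Var 0) (TSum X A)" "T [A, TSum X A, X] (Var 0) A"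
    using w by (auto intro!: typed_VarI)
  have h': "T [X, TSum X A, X] h (TNu A)" using typed_append[OF h] w by simp
  let ?C = "Case (Var 0) (Ret (InL A h)) (Ret (InR (TNu A) (Var 0)))"
  have r: "T (TSum (TNu A) A # [TSum X A, X]) (Ret (Var 0)) (TMon (TSum (TNu A) A))"
    using w by (auto intro!: typed.Ret typed_VarI)
  have "D [TSum X A, X] ?C (Ret (Case (Var 0) (InL A h) (InR (TNu A) (Var 0)))) (TMon (TSum (TNu A) A))"
    using derivable.case_sub[OF v(1) typed.InL[OF h' w(1)] typed.InR[OF v(2), of "TNu A"] r] w
    by (simp add: inst_def wk_under_def)
  hence "D [X] (Do q ?C) (Do q (Ret (Case (Var 0) (InL A h) (InR (TNu A) (Var 0))))) (TMon (TSum (TNu A) A))"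
    by (rule derivable.cong_Do[OF D_refl[OF q]])
  note eq = this
  \<comment> \<open>One-variable terms mention only index 0, which \<open>wk_under\<close>
    fixes.\<close>
  have wk: "wk_under h = h" "wk_under q = q"
    unfolding wk_under_def ren_eq_sub by (rule sub_closed1_id[OF h] sub_closed1_id[OF q], simp)+
  show ?thesis
  proof
    assume "D [X] (Out h) (Do q (Ret (Case (Var 0) (InL A h) (InR (TNu A) (Var 0))))) (TMon (TSum (TNu A) A))"
    from derivable.trans[OF this derivable.sym[OF eq]] show "D [X] h (Unfold (Var 0) q) (TNu A)"
      using derivable.coit_unfold[OF h q] by (simp only: wk)
  next
    assume "D [X] h (Unfold (Var 0) q) (TNu A)"
    hence "D [X] (Out h) (Do q ?C) (TMon (TSum (TNu A) A))"
      using derivable.unfold_coit[OF h q] by (simp only: wk)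
    thus "D [X] (Out h) (Do q (Ret (Case (Var 0) (InL A h) (InR (TNu A) (Var 0))))) (TMon (TSum (TNu A) A))"
      using eq by (rule derivable.trans)
  qed
qed

end

section \<open>The term model\<close>

text \<open>\<open>eo\<close> and \<open>em\<close> encode types and classes of terms in the carrier types of the model.\<close>

locale term_model = calculus \<Sigma> \<Phi>
  for \<Sigma> :: "('w, 'f) signature" and \<Phi> :: "('w, 'f) equation set" +
  fixes eo :: "'w ty \<Rightarrow> 'o" and em :: "'w ty \<Rightarrow> 'w ty \<Rightarrow> ('w, 'f) tm \<Rightarrow> 'm"
  assumes eo_inj: "inj_on eo {A. wf_ty \<Sigma> A}"
    and em_eq_iff: "\<lbrakk>typed \<Sigma> [A] t B; typed \<Sigma> [A'] t' B'\<rbrakk>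
      \<Longrightarrow> em A B t = em A' B' t' \<longleftrightarrow> A = A' \<and> B = B' \<and> derivable \<Sigma> \<Phi> [A] t t' B"
begin

definition dec :: "'o \<Rightarrow> 'w ty" where
  "dec = inv_into {A. wf_ty \<Sigma> A} eo"

text \<open>A morphism encodes an equivalence class, and the operations need a representative. The
  chosen one agrees with the original term only up to derivable equality.\<close>

definition rep :: "'m \<Rightarrow> 'w ty \<times> 'w ty \<times> ('w, 'f) tm" where
  "rep m = (SOME (A, B, t). T [A] t B \<and> em A B t = m)"

definition rdom :: "'m \<Rightarrow> 'w ty" where "rdom m = fst (rep m)"
definition rcod :: "'m \<Rightarrow> 'w ty" where "rcod m = fst (snd (rep m))"
definition rtm :: "'m \<Rightarrow> ('w, 'f) tm" where "rtm m = snd (snd (rep m))"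

text \<open>The term for \<open>tau\<close> is kept in the curried shape to which the right-hand
  side of \<open>tau_bnd\<close> reduces. In \<open>ext\<close> the one-variable representative
  stands directly under the binder, where index 0 is the bound value.\<close>

definition TM :: "('o, 'm, 'w, 'f) model_data" where
  "TM = \<lparr>obj = eo ` {A. wf_ty \<Sigma> A}, arr = {em A B t |A B t. T [A] t B},
    src = \<lambda>m. eo (rdom m), trg = \<lambda>m. eo (rcod m),
    ide = \<lambda>X. em (dec X) (dec X) (Var 0),
    comp = \<lambda>g f. em (rdom f) (rcod g) (sub (\<lambda>_. rtm f) (rtm g)),
    one = eo TOne,
    prd = \<lambda>X Y. eo (TProd (dec X) (dec Y)),
    pr1 = \<lambda>X Y. em (TProd (dec X) (dec Y)) (dec X) (Fst (Var 0)),
    pr2 = \<lambda>X Y. em (TProd (dec X) (dec Y)) (dec Y) (Snd (Var 0)),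
    cpr = \<lambda>X Y. eo (TSum (dec X) (dec Y)),
    in1 = \<lambda>X Y. em (dec X) (TSum (dec X) (dec Y)) (InL (dec Y) (Var 0)),
    in2 = \<lambda>X Y. em (dec Y) (TSum (dec X) (dec Y)) (InR (dec X) (Var 0)),
    mon = \<lambda>X. eo (TMon (dec X)),
    eta = \<lambda>X. em (dec X) (TMon (dec X)) (Ret (Var 0)),
    ext = \<lambda>X Y m. em (TMon (dec X)) (TMon (dec Y)) (Do (Var 0) (rtm m)),
    tau = \<lambda>X Y. em (TProd (dec X) (TMon (dec Y))) (TMon (TProd (dec X) (dec Y)))
      (Do (Snd (Var 0)) (curry_tm (Ret (Tup (Fst (Fst (Var 0))) (Snd (Var 0)))))),
    delta = \<lambda>X. em TOne (TMon (dec X)) (Dead (dec X)),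
    varpi = \<lambda>X. em (TProd (TMon (dec X)) (TMon (dec X))) (TMon (dec X)) (Choice (Fst (Var 0)) (Snd (Var 0))),
    res = \<lambda>X. eo (TNu (dec X)),
    out = \<lambda>X. em (TNu (dec X)) (TMon (TSum (TNu (dec X)) (dec X))) (Out (Var 0)),
    atom_int = \<lambda>w. eo (TAtom w),
    fun_int = \<lambda>f. em (fdom \<Sigma> f) (fcod \<Sigma> f) (Fn f (Var 0))\<rparr>"

definition cas :: "'o \<Rightarrow> 'o \<Rightarrow> 'm \<Rightarrow> 'm \<Rightarrow> 'm \<Rightarrow> 'm" where
  "cas X Y s t u = em (rdom s) (rcod t) (Case (rtm s) (curry_tm (rtm t)) (curry_tm (rtm u)))"

definition bnd :: "'o \<Rightarrow> 'o \<Rightarrow> 'm \<Rightarrow> 'm \<Rightarrow> 'm" where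
  "bnd X Y f p = em (rdom p) (rcod f) (Do (rtm p) (curry_tm (rtm f)))"

lemma em_eqI: "D [A] t s B \<Longrightarrow> em A B t = em A B s"
  using em_eq_iff D_typed by blast

lemma rep_em:
  assumes "T [A] t B"
  shows "rdom (em A B t) = A" "rcod (em A B t) = B" "T [A] (rtm (em A B t)) B" "D [A] (rtm (em A B t)) t B"
proof -
  have "case rep (em A B t) of (A', B', t') \<Rightarrow> T [A'] t' B' \<and> em A' B' t' = em A B t"
    unfolding rep_def by (rule someI[of _ "(A, B, t)"]) (use assms in simp)
  thus "rdom (em A B t) = A" "rcod (em A B t) = B" "T [A] (rtm (em A B t)) B" "D [A] (rtm (em A B t)) t B"
    using em_eq_iff[OF _ assms] by (auto simp: rdom_def rcod_def rtm_def split: prod.splits)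
qed

lemma dec_eo [simp]: "wf_ty \<Sigma> A \<Longrightarrow> dec (eo A) = A"
  unfolding dec_def by (rule inv_into_f_f[OF eo_inj]) simp

lemma eo_eq_iff [simp]: "wf_ty \<Sigma> A \<Longrightarrow> wf_ty \<Sigma> B \<Longrightarrow> eo A = eo B \<longleftrightarrow> A = B"
  using dec_eo by metis

lemma obj_eo [simp]: "wf_ty \<Sigma> A \<Longrightarrow> eo A \<in> obj TM"
  by (simp add: TM_def)

lemma objE: "X \<in> obj TM \<Longrightarrow> (\<And>A. X = eo A \<Longrightarrow> wf_ty \<Sigma> A \<Longrightarrow> P) \<Longrightarrow> P"
  by (auto simp: TM_def)

lemma T_wf: "T [A] t B \<Longrightarrow> wf_ty \<Sigma> A \<and> wf_ty \<Sigma> B"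
  using typed_wf[OF wf_sig] by fastforce

lemma em_arr:
  assumes "T [A] t B"
  shows "em A B t \<in> arr TM" "src TM (em A B t) = eo A" "trg TM (em A B t) = eo B"
  using assms by (auto simp: TM_def rep_em)

lemma em_hom: "T [A] t B \<Longrightarrow> em A B t \<in> hom TM (eo A) (eo B)"
  by (simp add: hom_def em_arr)

lemma hom_em:
  assumes "wf_ty \<Sigma> A" "wf_ty \<Sigma> B"
  shows "f \<in> hom TM (eo A) (eo B) \<longleftrightarrow> (\<exists>t. f = em A B t \<and> T [A] t B)"
proof
  assume f: "f \<in> hom TM (eo A) (eo B)"
  then obtain A' B' t where t: "f = em A' B' t" "T [A'] t B'" by (auto simp: hom_def TM_def)
  hence "eo A' = eo A" "eo B' = eo B" using f em_arr[OF t(2)] by (auto simp: hom_def)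
  hence "A' = A" "B' = B" using T_wf[OF t(2)] assms by auto
  thus "\<exists>t. f = em A B t \<and> T [A] t B" using t by blast
qed (auto intro: em_hom)

lemma hom_objs: "f \<in> hom TM X Y \<Longrightarrow> X \<in> obj TM \<and> Y \<in> obj TM"
  using T_wf by (fastforce simp: hom_def TM_def rep_em)

text \<open>Composition is defined on chosen representatives; \<open>D_sub1\<close> makes the choice
  immaterial.\<close>

lemma comp_em:
  assumes "T [A] t B" "T [B] u E"
  shows "comp TM (em B E u) (em A B t) = em A E (sub (\<lambda>_. t) u)"
proof -
  have "D [A] (sub (\<lambda>_. rtm (em A B t)) (rtm (em B E u))) (sub (\<lambda>_. t) u) E"
    using D_sub1 rep_em(4) assms by blast
  thus ?thesis using assms by (simp add: TM_def rep_em em_eqI)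
qed

lemma TM_simps:
  assumes "wf_ty \<Sigma> A" "wf_ty \<Sigma> B"
  shows "ide TM (eo A) = em A A (Var 0)"
    and "prd TM (eo A) (eo B) = eo (TProd A B)"
    and "pr1 TM (eo A) (eo B) = em (TProd A B) A (Fst (Var 0))"
    and "pr2 TM (eo A) (eo B) = em (TProd A B) B (Snd (Var 0))"
    and "cpr TM (eo A) (eo B) = eo (TSum A B)"
    and "in1 TM (eo A) (eo B) = em A (TSum A B) (InL B (Var 0))"
    and "in2 TM (eo A) (eo B) = em B (TSum A B) (InR A (Var 0))"
    and "mon TM (eo A) = eo (TMon A)"
    and "eta TM (eo A) = em A (TMon A) (Ret (Var 0))"
    and "tau TM (eo A) (eo B) = em (TProd A (TMon B)) (TMon (TProd A B))
      (Do (Snd (Var 0)) (curry_tm (Ret (Tup (Fst (Fst (Var 0))) (Snd (Var 0))))))"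
    and "delta TM (eo A) = em TOne (TMon A) (Dead A)"
    and "varpi TM (eo A) = em (TProd (TMon A) (TMon A)) (TMon A) (Choice (Fst (Var 0)) (Snd (Var 0)))"
    and "res TM (eo A) = eo (TNu A)"
    and "out TM (eo A) = em (TNu A) (TMon (TSum (TNu A) A)) (Out (Var 0))"
  using assms by (simp_all add: TM_def)

lemma one_TM: "one TM = eo TOne"
  by (simp add: TM_def)

lemma T_Var0: "wf_ty \<Sigma> A \<Longrightarrow> T [A] (Var 0) A"
  by (rule typed_VarI) auto

lemma T_basic:
  assumes "wf_ty \<Sigma> A" "wf_ty \<Sigma> B"
  shows "T [TProd A B] (Fst (Var 0)) A" "T [TProd A B] (Snd (Var 0)) B"
    "T [A] (InL B (Var 0)) (TSum A B)" "T [B] (InR A (Var 0)) (TSum A B)"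
    "T [A] (Ret (Var 0)) (TMon A)"
    "T [TOne] (Dead A) (TMon A)"
    "T [TProd (TMon A) (TMon A)] (Choice (Fst (Var 0)) (Snd (Var 0))) (TMon A)"
    "T [TNu A] (Out (Var 0)) (TMon (TSum (TNu A) A))"
    "T [A] Star TOne"
proof -
  note v = typed_VarI[of \<Sigma> "[_]" 0, simplified]
  show "T [TProd A B] (Fst (Var 0)) A" by (rule typed.Fst[where B=B], rule v) (use assms in auto)
  show "T [TProd A B] (Snd (Var 0)) B" by (rule typed.Snd[where A=A], rule v) (use assms in auto)
  have "T [TProd (TMon A) (TMon A)] (Fst (Var 0)) (TMon A)" by (rule typed.Fst[where B="TMon A"], rule v) (use
    assms in auto)
  moreover have "T [TProd (TMon A) (TMon A)] (Snd (Var 0)) (TMon A)"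
    by (rule typed.Snd[where A="TMon A"], rule v) (use assms in auto)
  ultimately show "T [TProd (TMon A) (TMon A)] (Choice (Fst (Var 0)) (Snd (Var 0))) (TMon A)" by (rule typed.Choice)
qed (use assms in \<open>auto intro!: typed.intros(3,7,8,10,12,14) T_Var0\<close>)

lemma sub_closed1_simp:
  "T [A] t B \<Longrightarrow> sub (lift_sub \<sigma>) t = t" "T [A] t B \<Longrightarrow> sub (\<lambda>_. Var 0) t = t"
  by (rule sub_closed1_id, assumption, simp)+

section \<open>Finite products of the term model\<close>

sublocale cartesian_category TM
proof unfold_locales
  fix f assume "f \<in> arr TM"
  then show "src TM f \<in> obj TM \<and> trg TM f \<in> obj TM" using hom_objs[of f "src TM f" "trg TM f"] by (simp add: hom_def)
next
  fix X assume "X \<in> obj TM"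
  then show "ide TM X \<in> hom TM X X" by (elim objE) (auto simp: TM_simps hom_em T_Var0)
next
  fix f X Y g Z assume fg: "f \<in> hom TM X Y" "g \<in> hom TM Y Z"
  then obtain A B E where "X = eo A" "Y = eo B" "Z = eo E" "wf_ty \<Sigma> A" "wf_ty \<Sigma> B" "wf_ty \<Sigma> E"
    by (meson hom_objs objE)
  then show "comp TM g f \<in> hom TM X Z" using fg by (auto simp: hom_em comp_em intro: typed_sub1)
next
  fix f X Y assume f: "f \<in> hom TM X Y"
  then obtain A B where "X = eo A" "Y = eo B" "wf_ty \<Sigma> A" "wf_ty \<Sigma> B"
    by (meson hom_objs objE)
  then show "comp TM f (ide TM X) = f" "comp TM (ide TM Y) f = f"
    using f by (auto simp: hom_em comp_em TM_simps T_Var0 sub_closed1_simp)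
next
  fix f X Y g Z h W assume fgh: "f \<in> hom TM X Y" "g \<in> hom TM Y Z" "h \<in> hom TM Z W"
  then obtain A B E F where "X = eo A" "Y = eo B" "Z = eo E" "W = eo F" "wf_ty \<Sigma> A" "wf_ty \<Sigma> B" "wf_ty \<Sigma> E" "wf_ty \<Sigma> F"
    by (meson hom_objs objE)
  then show "comp TM (comp TM h g) f = comp TM h (comp TM g f)"
    using fgh by (auto simp: hom_em comp_em typed_sub1 sub_sub)
next
  show "one TM \<in> obj TM" by (simp add: one_TM)
next
  fix X assume "X \<in> obj TM"
  then obtain A where A: "X = eo A" "wf_ty \<Sigma> A" by (rule objE)
  show "\<exists>!f. f \<in> hom TM X (one TM)"
  proof (rule ex1I[of _ "em A TOne Star"])
    show "em A TOne Star \<in> hom TM X (one TM)" using A by (auto simp: one_TM hom_em T_basic)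
    show "f = em A TOne Star" if "f \<in> hom TM X (one TM)" for f
      using that A by (auto simp: one_TM hom_em intro: em_eqI derivable.unit)
  qed
next
  fix X Y assume "X \<in> obj TM" "Y \<in> obj TM"
  then obtain A B where AB: "X = eo A" "wf_ty \<Sigma> A" "Y = eo B" "wf_ty \<Sigma> B" by (metis objE)
  then show "prd TM X Y \<in> obj TM" "pr1 TM X Y \<in> hom TM (prd TM X Y) X" "pr2 TM X Y \<in> hom TM (prd TM X Y) Y"
    by (auto simp: TM_simps hom_em T_basic)
next
  fix f X Y g Z assume fg: "f \<in> hom TM X Y" "g \<in> hom TM X Z"
  then obtain A B E where ty: "X = eo A" "Y = eo B" "Z = eo E" and wf: "wf_ty \<Sigma> A" "wf_ty \<Sigma> B" "wf_ty \<Sigma> E"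
    by (meson hom_objs objE)
  with fg obtain t u where tu: "f = em A B t" "g = em A E u" "T [A] t B" "T [A] u E" by (auto simp: hom_em)
  show "\<exists>!h. h \<in> hom TM X (prd TM Y Z) \<and> comp TM (pr1 TM Y Z) h = f \<and> comp TM (pr2 TM Y Z) h = g"
  proof (rule ex1I[of _ "em A (TProd B E) (Tup t u)"])
    show "em A (TProd B E) (Tup t u) \<in> hom TM X (prd TM Y Z) \<and> comp TM (pr1 TM Y Z) (em A (TProd B E) (Tup t u)) = f
      \<and> comp TM (pr2 TM Y Z) (em A (TProd B E) (Tup t u)) = g"
      using ty wf tu by (auto simp: TM_simps comp_em T_basic typed.Tup intro!: em_eqI derivable.fst
        derivable.snd em_hom)
  next
    fix h assume h: "h \<in> hom TM X (prd TM Y Z) \<and> comp TM (pr1 TM Y Z) h = f \<and> comp TM (pr2 TM Y Z) h = g"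
    then obtain v where v: "h = em A (TProd B E) v" "T [A] v (TProd B E)" using ty wf by (auto simp: TM_simps hom_em)
    have "em A B (Fst v) = em A B t" "em A E (Snd v) = em A E u"
      using h tu v(2) ty wf unfolding v(1) by (auto simp: TM_simps comp_em T_basic)
    hence "D [A] (Fst v) t B" "D [A] (Snd v) u E"
      using em_eq_iff typed.Fst[OF v(2)] typed.Snd[OF v(2)] tu by auto
    \<comment> \<open>Uniqueness of the mediating term is surjective pairing.\<close>
    hence "D [A] v (Tup t u) (TProd B E)"
      by (intro derivable.trans[OF derivable.sym[OF derivable.pair[OF v(2)]] derivable.cong_Tup])
    thus "h = em A (TProd B E) (Tup t u)" using v em_eqI by blast
  qed
qed

text \<open>\<open>pair\<close> is a definite description, so its value is found by uniqueness:
  \<open>Tup t u\<close> has the required projections.\<close>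

lemma pair_em:
  assumes "T [A] t B" "T [A] u E"
  shows "pair TM (em A B t) (em A E u) = em A (TProd B E) (Tup t u)"
proof (rule prd_eqI[of _ _ "eo B" "eo E"])
  note w = T_wf[OF assms(1)] T_wf[OF assms(2)]
  note tu = typed.Tup[OF assms]
  show "comp TM (pr1 TM (eo B) (eo E)) (pair TM (em A B t) (em A E u))
    = comp TM (pr1 TM (eo B) (eo E)) (em A (TProd B E) (Tup t u))"
    "comp TM (pr2 TM (eo B) (eo E)) (pair TM (em A B t) (em A E u))
      = comp TM (pr2 TM (eo B) (eo E)) (em A (TProd B E) (Tup t u))"
    using w assms tu by (simp_all add: em_arr) (auto simp: TM_simps comp_em T_basic intro!: em_eqI[symmetric]
      derivable.fst derivable.snd)
qed (use assms T_wf[OF assms(1)] T_wf[OF assms(2)] typed.Tup[OF assms] in \<open>auto simp: em_arr TM_simps\<close>)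

lemma bang_em: "wf_ty \<Sigma> A \<Longrightarrow> bang TM (eo A) = em A TOne Star"
  by (rule bang_unique[symmetric]) (auto simp: em_arr T_basic one_TM)

lemma cas_em:
  assumes "T [X] s (TSum A B)" "T [TProd X A] t Y" "T [TProd X B] u Y"
  shows "cas P Q (em X (TSum A B) s) (em (TProd X A) Y t) (em (TProd X B) Y u)
    = em X Y (Case s (curry_tm t) (curry_tm u))"
  unfolding cas_def rep_em[OF assms(1)] rep_em[OF assms(2)]
  by (intro em_eqI derivable.cong_Case[where A=A and B=B] rep_em assms D_curry)

lemma bnd_em:
  assumes "T [X] p (TMon A)" "T [TProd X A] f (TMon B)"
  shows "bnd P Q (em (TProd X A) (TMon B) f) (em X (TMon A) p) = em X (TMon B) (Do p (curry_tm f))"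
  unfolding bnd_def rep_em[OF assms(1)] rep_em[OF assms(2)]
  by (intro em_eqI derivable.cong_Do[where A=A] rep_em assms D_curry)

lemma T_Case_curry: "T [X] s (TSum A B) \<Longrightarrow> T [TProd X A] t Y \<Longrightarrow> T [TProd X B] u Y
  \<Longrightarrow> T [X] (Case s (curry_tm t) (curry_tm u)) Y"
  by (intro typed.Case[where A=A and B=B] typed_curry_tm)

lemma T_Do_curry: "T [X] p (TMon A) \<Longrightarrow> T [TProd X A] t (TMon B) \<Longrightarrow> T [X] (Do p (curry_tm t)) (TMon B)"
  by (intro typed.Do[where A=A] typed_curry_tm)

lemma cross_em:
  assumes "T [A] t B" "wf_ty \<Sigma> E"
  shows "cross TM (em A B t) (ide TM (eo E)) = em (TProd A E) (TProd B E) (Tup (sub (\<lambda>_. Fst (Var 0)) t) (Snd (Var 0)))"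
  using assms T_wf[OF assms(1)]
  by (simp add: em_arr) (simp add: TM_simps comp_em T_basic pair_em typed_sub1)

lemma T_cross: "T [A] t B \<Longrightarrow> wf_ty \<Sigma> E \<Longrightarrow> T [TProd A E] (Tup (sub (\<lambda>_. Fst (Var 0)) t) (Snd (Var 0))) (TProd B E)"
  using T_wf[of A t B] by (intro typed.Tup typed_sub1) (auto simp: T_basic)

lemma T_inj_pair:
  assumes "wf_ty \<Sigma> X" "wf_ty \<Sigma> A" "wf_ty \<Sigma> B"
  shows "T [TProd X A] (Tup (Fst (Var 0)) (InL B (Snd (Var 0)))) (TProd X (TSum A B))"
    "T [TProd X B] (Tup (Fst (Var 0)) (InR A (Snd (Var 0)))) (TProd X (TSum A B))"
  using assms by (auto intro!: typed.Tup typed.InL typed.InR T_basic)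

lemma inj_pair_em:
  assumes "wf_ty \<Sigma> X" "wf_ty \<Sigma> A" "wf_ty \<Sigma> B"
  shows "pair TM (pr1 TM (eo X) (eo A)) (comp TM (in1 TM (eo A) (eo B)) (pr2 TM (eo X) (eo A)))
      = em (TProd X A) (TProd X (TSum A B)) (Tup (Fst (Var 0)) (InL B (Snd (Var 0))))"
    "pair TM (pr1 TM (eo X) (eo B)) (comp TM (in2 TM (eo A) (eo B)) (pr2 TM (eo X) (eo B)))
      = em (TProd X B) (TProd X (TSum A B)) (Tup (Fst (Var 0)) (InR A (Snd (Var 0))))"
  using assms by (simp_all add: TM_simps comp_em T_basic pair_em typed.InL typed.InR)

lemma pair_ide_em:
  "T [X] a A \<Longrightarrow> pair TM (ide TM (eo X)) (em X A a) = em X (TProd X A) (Tup (Var 0) a)"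
  by (frule T_wf) (auto simp: TM_simps pair_em T_Var0)

lemma T_pair_ide: "T [X] a A \<Longrightarrow> T [X] (Tup (Var 0) a) (TProd X A)"
  using T_wf[of X a A] by (simp add: typed.Tup T_Var0)

section \<open>Coproducts and distributivity of the term model\<close>

sublocale case_category TM cas
proof unfold_locales
  fix X Y assume "X \<in> obj TM" "Y \<in> obj TM"
  then obtain A B where AB: "X = eo A" "wf_ty \<Sigma> A" "Y = eo B" "wf_ty \<Sigma> B" by (metis objE)
  then show "cpr TM X Y \<in> obj TM" "in1 TM X Y \<in> hom TM X (cpr TM X Y)" "in2 TM X Y \<in> hom TM Y (cpr TM X Y)"
    by (auto simp: TM_simps intro!: em_hom T_basic)
next
  fix P Q X s t Y u
  assume h: "P \<in> obj TM" "Q \<in> obj TM" "s \<in> hom TM X (cpr TM P Q)" "t \<in> hom TM (prd TM X P) Y"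
    "u \<in> hom TM (prd TM X Q) Y"
  then obtain A B x y where ty: "P = eo A" "Q = eo B" "X = eo x" "Y = eo y" "wf_ty \<Sigma> A" "wf_ty \<Sigma> B" "wf_ty \<Sigma> x"
    "wf_ty \<Sigma> y"
    by (meson hom_objs objE)
  with h obtain s' t' u' where
    tm: "s = em x (TSum A B) s'" "T [x] s' (TSum A B)" "t = em (TProd x A) y t'" "T [TProd x A] t' y"
      "u = em (TProd x B) y u'" "T [TProd x B] u' y"
    by (auto simp: hom_em TM_simps)
  show "cas P Q s t u \<in> hom TM X Y"
    using tm ty by (simp add: cas_em em_hom T_Case_curry)
  fix h Z
  assume "h \<in> hom TM Z X"
  then obtain z h' where z: "Z = eo z" "wf_ty \<Sigma> z" "h = em z x h'" "T [z] h' x"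
    using ty hom_objs by (metis objE hom_em)
  show "comp TM (cas P Q s t u) h = cas P Q (comp TM s h) (comp TM t (cross TM h (ide TM P))) (comp TM u (cross
    TM h (ide TM Q)))"
    unfolding tm(1,3,5) z(3) ty(1,2) cas_em[OF tm(2,4,6)] cross_em[OF z(4) ty(5)] cross_em[OF z(4) ty(6)]
    using tm(2,4,6) z(4) ty
    by (simp add: comp_em T_Case_curry T_cross cas_em typed_sub1 del: cross_unfold)
      (intro em_eqI derivable.cong_Case[where A=A and B=B] D_refl typed_sub1 D_curry_cross)
next
  fix P Q a X t Y u
  assume h: "P \<in> obj TM" "Q \<in> obj TM" "a \<in> hom TM X P" "t \<in> hom TM (prd TM X P) Y" "u \<in> hom TM (prd TM X Q) Y"
  then obtain A B x y where ty: "P = eo A" "Q = eo B" "X = eo x" "Y = eo y" "wf_ty \<Sigma> A" "wf_ty \<Sigma> B" "wf_ty \<Sigma> x"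
    "wf_ty \<Sigma> y"
    by (meson hom_objs objE)
  with h obtain a' t' u' where
    tm: "a = em x A a'" "T [x] a' A" "t = em (TProd x A) y t'" "T [TProd x A] t' y"
      "u = em (TProd x B) y u'" "T [TProd x B] u' y"
    by (auto simp: hom_em TM_simps)
  show "cas P Q (comp TM (in1 TM P Q) a) t u = comp TM t (pair TM (ide TM X) a)"
    unfolding tm(1,3,5) ty(1-3) pair_ide_em[OF tm(2)] using tm(2,4,6) ty
    by (simp add: TM_simps comp_em T_basic cas_em typed.InL T_pair_ide em_eqI D_case_inl)
next
  fix P Q a X t Y u
  assume h: "P \<in> obj TM" "Q \<in> obj TM" "a \<in> hom TM X Q" "t \<in> hom TM (prd TM X P) Y" "u \<in> hom TM (prd TM X Q) Y"
  then obtain A B x y where ty: "P = eo A" "Q = eo B" "X = eo x" "Y = eo y" "wf_ty \<Sigma> A" "wf_ty \<Sigma> B" "wf_ty \<Sigma> x"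
    "wf_ty \<Sigma> y"
    by (meson hom_objs objE)
  with h obtain a' t' u' where
    tm: "a = em x B a'" "T [x] a' B" "t = em (TProd x A) y t'" "T [TProd x A] t' y"
      "u = em (TProd x B) y u'" "T [TProd x B] u' y"
    by (auto simp: hom_em TM_simps)
  show "cas P Q (comp TM (in2 TM P Q) a) t u = comp TM u (pair TM (ide TM X) a)"
    unfolding tm(1,3,5) ty(1-3) pair_ide_em[OF tm(2)] using tm(2,4,6) ty
    by (simp add: TM_simps comp_em T_basic cas_em typed.InR T_pair_ide em_eqI D_case_inr)
next
  fix P Q s X h Y
  assume hyp: "P \<in> obj TM" "Q \<in> obj TM" "s \<in> hom TM X (cpr TM P Q)" "h \<in> hom TM (prd TM X (cpr TM P Q)) Y"
  then obtain A B x y where ty: "P = eo A" "Q = eo B" "X = eo x" "Y = eo y" "wf_ty \<Sigma> A" "wf_ty \<Sigma> B" "wf_ty \<Sigma> x"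
    "wf_ty \<Sigma> y"
    by (meson hom_objs objE)
  with hyp obtain s' h' where
    tm: "s = em x (TSum A B) s'" "T [x] s' (TSum A B)" "h = em (TProd x (TSum A B)) y h'" "T [TProd x (TSum A B)] h' y"
    by (auto simp: hom_em TM_simps)
  show "cas P Q s (comp TM h (pair TM (pr1 TM X P) (comp TM (in1 TM P Q) (pr2 TM X P))))
     (comp TM h (pair TM (pr1 TM X Q) (comp TM (in2 TM P Q) (pr2 TM X Q)))) = comp TM h (pair TM (ide TM X) s)"
    unfolding tm(1,3) ty(1-3) inj_pair_em[OF ty(7,5,6)] pair_ide_em[OF tm(2)] using tm(2,4) ty
    by (simp add: comp_em T_inj_pair cas_em typed_sub1 T_pair_ide em_eqI D_case_eta)
qed

section \<open>Monad, strength and choice of the term model\<close>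

lemma ext_em:
  assumes "T [A] f (TMon B)"
  shows "ext TM (eo A) (eo B) (em A (TMon B) f) = em (TMon A) (TMon B) (Do (Var 0) f)"
proof -
  have w: "wf_ty \<Sigma> A" "wf_ty \<Sigma> B" using T_wf[OF assms] by auto
  have "D [TMon A] (Do (Var 0) (rtm (em A (TMon B) f))) (Do (Var 0) f) (TMon B)"
    by (rule derivable.cong_Do[OF D_refl[OF T_Var0] D_append[OF rep_em(4)[OF assms]]]) (use w in auto)
  thus ?thesis using w by (simp add: TM_def em_eqI)
qed

lemma T_Do_Var: "T [A] f (TMon B) \<Longrightarrow> T [TMon A] (Do (Var 0) f) (TMon B)"
  using T_wf[of A f "TMon B"] by (intro typed.Do[OF T_Var0 typed_append]) auto

text \<open>\<open>ext\<close> binds \<open>f\<close> directly, whereas \<open>ext_bnd\<close> asks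
  for the curried composite of \<open>f\<close> with the second projection; a beta step reconciles
  the two.\<close>

lemma D_curry_snd:
  assumes "T [A] f B" "wf_ty \<Sigma> X"
  shows "D [A, X] (curry_tm (sub (\<lambda>_. Snd (Var 0)) f)) f B"
proof -
  have w: "wf_ty \<Sigma> A" using T_wf[OF assms(1)] by auto
  have "D [A, X] (sub (\<lambda>_. Snd (Tup (Var (Suc 0)) (Var 0))) f) (sub (\<lambda>_. Var 0) f) B"
    by (rule D_sub1[OF D_refl[OF assms(1)]], rule derivable.snd[where A=X]) (use w assms in \<open>auto intro!: typed_VarI\<close>)
  thus ?thesis using assms by (simp add: curry_tm_def sub_sub sub_closed1_simp)
qed

lemma T_strength: "wf_ty \<Sigma> A \<Longrightarrow> wf_ty \<Sigma> B \<Longrightarrow>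
  T [TProd (TProd A X) B] (Ret (Tup (Fst (Fst (Var 0))) (Snd (Var 0)))) (TMon (TProd A B))"
  if "wf_ty \<Sigma> X" for X
  using that by (intro typed.Ret typed.Tup typed.Fst[where B=X] T_basic) auto

sublocale bind_category TM bnd
proof unfold_locales
  fix X assume "X \<in> obj TM"
  then obtain A where A: "X = eo A" "wf_ty \<Sigma> A" by (metis objE)
  then show "mon TM X \<in> obj TM" "eta TM X \<in> hom TM X (mon TM X)"
    by (auto simp: TM_simps intro!: em_hom T_basic)
  fix p Y assume "p \<in> hom TM Y (mon TM X)"
  then obtain y p' where p: "Y = eo y" "wf_ty \<Sigma> y" "p = em y (TMon A) p'" "T [y] p' (TMon A)"
    using A hom_objs by (auto simp: TM_simps) (metis objE hom_em wf_ty_simps(5))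
  show "bnd X X (comp TM (eta TM X) (pr2 TM Y X)) p = p"
    using p A by (simp add: TM_simps comp_em T_basic bnd_em typed.Ret em_eqI D_do_ret)
next
  fix P Q p X f
  assume h: "P \<in> obj TM" "Q \<in> obj TM" "p \<in> hom TM X (mon TM P)" "f \<in> hom TM (prd TM X P) (mon TM Q)"
  then obtain A B x where ty: "P = eo A" "Q = eo B" "X = eo x" "wf_ty \<Sigma> A" "wf_ty \<Sigma> B" "wf_ty \<Sigma> x"
    by (meson hom_objs objE)
  with h obtain p' f' where
    tm: "p = em x (TMon A) p'" "T [x] p' (TMon A)" "f = em (TProd x A) (TMon B) f'" "T [TProd x A] f' (TMon B)"
    by (auto simp: hom_em TM_simps)
  show "bnd P Q f p \<in> hom TM X (mon TM Q)"
    using tm ty by (simp add: bnd_em TM_simps em_hom T_Do_curry)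
  fix h Z
  assume "h \<in> hom TM Z X"
  then obtain z h' where z: "Z = eo z" "wf_ty \<Sigma> z" "h = em z x h'" "T [z] h' x"
    using ty hom_objs by (metis objE hom_em)
  show "comp TM (bnd P Q f p) h = bnd P Q (comp TM f (cross TM h (ide TM P))) (comp TM p h)"
    unfolding tm(1,3) z(3) ty(1,2) bnd_em[OF tm(2,4)] cross_em[OF z(4) ty(4)]
    using tm(2,4) z(4) ty
    by (simp add: comp_em T_Do_curry T_cross bnd_em typed_sub1 del: cross_unfold)
      (intro em_eqI derivable.cong_Do[where A=A] D_refl typed_sub1 D_curry_cross)
next
  fix P Q a X f
  assume h: "P \<in> obj TM" "Q \<in> obj TM" "a \<in> hom TM X P" "f \<in> hom TM (prd TM X P) (mon TM Q)"
  then obtain A B x where ty: "P = eo A" "Q = eo B" "X = eo x" "wf_ty \<Sigma> A" "wf_ty \<Sigma> B" "wf_ty \<Sigma> x"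
    by (meson hom_objs objE)
  with h obtain a' f' where
    tm: "a = em x A a'" "T [x] a' A" "f = em (TProd x A) (TMon B) f'" "T [TProd x A] f' (TMon B)"
    by (auto simp: hom_em TM_simps)
  show "bnd P Q f (comp TM (eta TM P) a) = comp TM f (pair TM (ide TM X) a)"
    unfolding tm(1,3) ty(1-3) pair_ide_em[OF tm(2)] using tm(2,4) ty
    by (simp add: TM_simps comp_em T_basic bnd_em typed.Ret T_pair_ide em_eqI D_do_beta)
next
  fix P Q R p X q r
  assume h: "P \<in> obj TM" "Q \<in> obj TM" "R \<in> obj TM" "p \<in> hom TM X (mon TM P)" "q \<in> hom TM (prd TM X P) (mon TM Q)"
    "r \<in> hom TM (prd TM X Q) (mon TM R)"
  then obtain A B E x where ty: "P = eo A" "Q = eo B" "R = eo E" "X = eo x" "wf_ty \<Sigma> A" "wf_ty \<Sigma> B" "wf_ty \<Sigma> E"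
    "wf_ty \<Sigma> x"
    by (meson hom_objs objE)
  with h obtain p' q' r' where
    tm: "p = em x (TMon A) p'" "T [x] p' (TMon A)" "q = em (TProd x A) (TMon B) q'" "T [TProd x A] q' (TMon B)"
      "r = em (TProd x B) (TMon E) r'" "T [TProd x B] r' (TMon E)"
    by (auto simp: hom_em TM_simps)
  have c: "T [TProd x A] (Fst (Var 0)) x" using ty by (simp add: T_basic)
  have "cross TM (pr1 TM (eo x) (eo A)) (ide TM (eo B))
    = em (TProd (TProd x A) B) (TProd x B) (Tup (Fst (Fst (Var 0))) (Snd (Var 0)))"
    using cross_em[OF c ty(6)] ty by (simp add: TM_simps del: cross_unfold)
  thus "bnd Q R r (bnd P Q q p) = bnd P R (bnd Q R (comp TM r (cross TM (pr1 TM X P) (ide TM Q))) q) p"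
    unfolding tm(1,3,5) ty(1-4) using tm(2,4,6) T_cross[OF c ty(6)]
    by (simp add: bnd_em T_Do_curry comp_em typed_sub1 em_eqI D_do_assoc del: cross_unfold)
next
  fix Q f P
  assume h: "Q \<in> obj TM" "f \<in> hom TM P (mon TM Q)"
  then obtain A B where ty: "P = eo A" "Q = eo B" "wf_ty \<Sigma> A" "wf_ty \<Sigma> B"
    by (meson hom_objs objE)
  with h obtain f' where tm: "f = em A (TMon B) f'" "T [A] f' (TMon B)"
    by (auto simp: hom_em TM_simps)
  have v: "T [TMon A] (Var 0) (TMon A)" using ty by (simp add: T_Var0)
  show "ext TM P Q f = bnd P Q (comp TM f (pr2 TM (mon TM P) P)) (ide TM (mon TM P))"
    unfolding tm(1) ty(1,2) ext_em[OF tm(2)] using tm ty v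
    by (simp add: TM_simps comp_em T_basic bnd_em typed_sub1)
      (auto intro!: em_eqI derivable.cong_Do[where A=A] D_refl derivable.sym[OF D_curry_snd])
next
  fix P Q
  assume "P \<in> obj TM" "Q \<in> obj TM"
  then obtain A B where ty: "P = eo A" "Q = eo B" "wf_ty \<Sigma> A" "wf_ty \<Sigma> B" by (metis objE)
  let ?M = "TProd A (TMon B)"
  have c: "T [?M] (Fst (Var 0)) A" using ty by (simp add: T_basic)
  have "cross TM (pr1 TM (eo A) (eo (TMon B))) (ide TM (eo B))
    = em (TProd ?M B) (TProd A B) (Tup (Fst (Fst (Var 0))) (Snd (Var 0)))"
    using cross_em[OF c ty(4)] ty by (simp add: TM_simps del: cross_unfold)
  moreover have "comp TM (eta TM (eo (TProd A B))) (em (TProd ?M B) (TProd A B) (Tup (Fst (Fst (Var 0))) (Snd (Var 0))))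
    = em (TProd ?M B) (TMon (TProd A B)) (Ret (Tup (Fst (Fst (Var 0))) (Snd (Var 0))))"
    using T_cross[OF c ty(4)] ty by (simp add: TM_simps comp_em T_basic)
  ultimately show "tau TM P Q = bnd Q (prd TM P Q) (comp TM (eta TM (prd TM P Q)) (cross TM (pr1 TM P (mon TM
    Q)) (ide TM Q))) (pr2 TM P (mon TM Q))"
    using ty by (simp add: TM_simps bnd_em T_basic T_strength del: cross_unfold)
qed

lemma choice_em:
  assumes "T [X] p (TMon A)" "T [X] q (TMon A)"
  shows "comp TM (varpi TM (eo A)) (pair TM (em X (TMon A) p) (em X (TMon A) q)) = em X (TMon A) (Choice p q)"
proof -
  have w: "wf_ty \<Sigma> A" using T_wf[OF assms(1)] by simp
  show ?thesis using assms w
    by (simp add: TM_simps pair_em comp_em T_basic typed.Tup)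
      (intro em_eqI derivable.cong_Choice derivable.fst derivable.snd)
qed

lemma dead_em:
  assumes "wf_ty \<Sigma> A" "wf_ty \<Sigma> X"
  shows "comp TM (delta TM (eo A)) (bang TM (eo X)) = em X (TMon A) (Dead A)" "T [X] (Dead A) (TMon A)"
  using assms by (simp_all add: TM_simps bang_em comp_em T_basic typed.Dead)

sublocale choice_category TM bnd
proof unfold_locales
  fix P assume "P \<in> obj TM"
  then obtain A where A: "P = eo A" "wf_ty \<Sigma> A" by (metis objE)
  then show "delta TM P \<in> hom TM (one TM) (mon TM P)" "varpi TM P \<in> hom TM (prd TM (mon TM P) (mon TM P)) (mon TM P)"
    by (auto simp: TM_simps one_TM intro!: em_hom T_basic)
  have ex: "\<exists>p'. p = em x (TMon A) p' \<and> T [x] p' (TMon A)" if "p \<in> hom TM (eo x) (mon TM P)" "wf_ty \<Sigma> x" for p x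
    using that A by (auto simp: hom_em TM_simps)
  fix p X assume p: "p \<in> hom TM X (mon TM P)"
  then obtain x where x: "X = eo x" "wf_ty \<Sigma> x" using hom_objs by (metis objE)
  obtain p' where p': "p = em x (TMon A) p'" "T [x] p' (TMon A)" using ex p x by blast
  show "comp TM (varpi TM P) (pair TM p (comp TM (delta TM P) (bang TM X))) = p"
    "comp TM (varpi TM P) (pair TM p p) = p"
    using p' x A by (auto simp: dead_em choice_em intro!: em_eqI derivable.choice_dead derivable.choice_idem)
  fix q assume q: "q \<in> hom TM X (mon TM P)"
  obtain q' where q': "q = em x (TMon A) q'" "T [x] q' (TMon A)" using ex q x by blast
  show "comp TM (varpi TM P) (pair TM p q) = comp TM (varpi TM P) (pair TM q p)"
    using p' q' A by (auto simp: choice_em intro!: em_eqI derivable.choice_comm)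
  fix r assume r: "r \<in> hom TM X (mon TM P)"
  obtain r' where r': "r = em x (TMon A) r'" "T [x] r' (TMon A)" using ex r x by blast
  show "comp TM (varpi TM P) (pair TM p (comp TM (varpi TM P) (pair TM q r)))
    = comp TM (varpi TM P) (pair TM (comp TM (varpi TM P) (pair TM p q)) r)"
    using p' q' r' A by (auto simp: choice_em typed.Choice intro!: em_eqI derivable.choice_assoc)
next
  fix P Q X f
  assume h: "P \<in> obj TM" "Q \<in> obj TM" "X \<in> obj TM" "f \<in> hom TM (prd TM X P) (mon TM Q)"
  then obtain A B x where ty: "P = eo A" "Q = eo B" "X = eo x" "wf_ty \<Sigma> A" "wf_ty \<Sigma> B" "wf_ty \<Sigma> x"
    by (meson objE)
  with h obtain f' where tm: "f = em (TProd x A) (TMon B) f'" "T [TProd x A] f' (TMon B)"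
    by (auto simp: hom_em TM_simps)
  show "bnd P Q f (comp TM (delta TM P) (bang TM X)) = comp TM (delta TM Q) (bang TM X)"
    using ty tm by (auto simp: dead_em bnd_em intro!: em_eqI derivable.do_dead typed_curry_tm)
next
  fix P Q f X p q
  assume h: "P \<in> obj TM" "Q \<in> obj TM" "f \<in> hom TM (prd TM X P) (mon TM Q)" "p \<in> hom TM X (mon TM P)"
    "q \<in> hom TM X (mon TM P)"
  then obtain A B x where ty: "P = eo A" "Q = eo B" "X = eo x" "wf_ty \<Sigma> A" "wf_ty \<Sigma> B" "wf_ty \<Sigma> x"
    by (meson hom_objs objE)
  with h obtain f' p' q' where tm: "f = em (TProd x A) (TMon B) f'" "T [TProd x A] f' (TMon B)"
    "p = em x (TMon A) p'" "T [x] p' (TMon A)" "q = em x (TMon A) q'" "T [x] q' (TMon A)"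
    by (auto simp: hom_em TM_simps)
  show "bnd P Q f (comp TM (varpi TM P) (pair TM p q)) = comp TM (varpi TM Q) (pair TM (bnd P Q f p) (bnd P Q f q))"
    unfolding tm(1,3,5) ty(1,2) using tm(2,4,6)
    by (auto simp: choice_em bnd_em typed.Choice T_Do_curry intro!: em_eqI derivable.do_choice[where A=A]
      typed_curry_tm)
qed

section \<open>Final coalgebras of the term model\<close>

lemma T_Case_Var:
  assumes "T [A] f Y" "T [B] g Y"
  shows "T [TSum A B] (Case (Var 0) f g) Y"
  using T_wf[OF assms(1)] T_wf[OF assms(2)]
  by (intro typed.Case[OF T_Var0 typed_append[OF assms(1)] typed_append[OF assms(2)]]) auto

text \<open>As for \<open>pair_em\<close>: the case term restricts to \<open>f\<close> and
  \<open>g\<close> along the injections by the beta rules, and copairs are unique.\<close>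

lemma copair_em:
  assumes "T [A] f Y" "T [B] g Y"
  shows "copair TM (em A Y f) (em B Y g) = em (TSum A B) Y (Case (Var 0) f g)"
proof (rule cpr_eqI[of _ _ "eo A" "eo B"])
  have w: "wf_ty \<Sigma> A" "wf_ty \<Sigma> B" using T_wf[OF assms(1)] T_wf[OF assms(2)] by auto
  note c = T_Case_Var[OF assms]
  have l: "D [A] (Case (InL B (Var 0)) f g) f Y" and r: "D [B] (Case (InR A (Var 0)) f g) g Y"
    using derivable.case_InL[OF T_Var0[OF w(1)] typed_append[OF assms(1), of "[A]"] typed_append[OF assms(2), of "[A]"]]
      derivable.case_InR[OF T_Var0[OF w(2)] typed_append[OF assms(1), of "[B]"] typed_append[OF assms(2), of "[B]"]] w
    by (simp_all add: inst_def sub_closed1_id[OF assms(1)] sub_closed1_id[OF assms(2)])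
  show "comp TM (copair TM (em A Y f) (em B Y g)) (in1 TM (eo A) (eo B))
    = comp TM (em (TSum A B) Y (Case (Var 0) f g)) (in1 TM (eo A) (eo B))"
    "comp TM (copair TM (em A Y f) (em B Y g)) (in2 TM (eo A) (eo B))
      = comp TM (em (TSum A B) Y (Case (Var 0) f g)) (in2 TM (eo A) (eo B))"
    using assms w c by (simp_all add: em_arr)
     (simp_all add: TM_simps comp_em T_basic sub_closed1_simp[OF assms(1)] sub_closed1_simp[OF assms(2)]
       em_eqI[OF l] em_eqI[OF r])
  show "copair TM (em A Y f) (em B Y g) \<in> arr TM" "em (TSum A B) Y (Case (Var 0) f g) \<in> arr TM"
    "src TM (copair TM (em A Y f) (em B Y g)) = cpr TM (eo A) (eo B)"
    "src TM (em (TSum A B) Y (Case (Var 0) f g)) = cpr TM (eo A) (eo B)"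
    "trg TM (copair TM (em A Y f) (em B Y g)) = trg TM (em (TSum A B) Y (Case (Var 0) f g))"
    "eo A \<in> obj TM" "eo B \<in> obj TM"
    using assms w c by (simp_all add: em_arr TM_simps)
qed

lemma mmap_em:
  assumes "T [A] f B"
  shows "mmap TM (em A B f) = em (TMon A) (TMon B) (Do (Var 0) (Ret f))"
proof -
  have w: "wf_ty \<Sigma> A" "wf_ty \<Sigma> B" using T_wf[OF assms] by auto
  have "comp TM (eta TM (eo B)) (em A B f) = em A (TMon B) (Ret f)"
    using assms w by (simp add: TM_simps comp_em T_basic)
  thus ?thesis using assms by (simp add: mmap_def em_arr ext_em typed.Ret del: mmap_unfold)
qed

text \<open>Written out on terms, the coalgebra square for \<open>h\<close> is the equation of
  \<open>D_out_step\<close>. Hence the coalgebra morphisms are the terms derivably equal to one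
  \<open>Unfold\<close> term, which makes existence and uniqueness immediate.\<close>

lemma coalg_mor_em:
  assumes q: "T [X] q (TMon (TSum X A))"
  shows "coalg_mor TM (eo A) (em X (TMon (TSum X A)) q) k \<longleftrightarrow>
    (\<exists>h. k = em X (TNu A) h \<and> T [X] h (TNu A) \<and> D [X] h (Unfold (Var 0) q) (TNu A))"
proof -
  have w: "wf_ty \<Sigma> A" "wf_ty \<Sigma> X" using T_wf[OF q] by auto
  have "comp TM (out TM (eo A)) (em X (TNu A) h)
      = comp TM (mmap TM (cosum TM (em X (TNu A) h) (ide TM (eo A)))) (em X (TMon (TSum X A)) q)
    \<longleftrightarrow> D [X] h (Unfold (Var 0) q) (TNu A)" if h: "T [X] h (TNu A)" for h
  proof -
    let ?C = "Case (Var 0) (InL A h) (InR (TNu A) (Var 0))"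
    have l: "T [X] (InL A h) (TSum (TNu A) A)" and r: "T [A] (InR (TNu A) (Var 0)) (TSum (TNu A) A)"
      using h w by (auto intro: typed.InL T_basic)
    note c = T_Case_Var[OF l r]
    have "cosum TM (em X (TNu A) h) (ide TM (eo A)) = em (TSum X A) (TSum (TNu A) A) ?C"
      using h w l r by (simp add: em_arr) (simp add: TM_simps comp_em T_basic copair_em sub_closed1_simp(2)[OF
        T_basic(4)])
    moreover have "comp TM (mmap TM (em (TSum X A) (TSum (TNu A) A) ?C)) (em X (TMon (TSum X A)) q)
      = em X (TMon (TSum (TNu A) A)) (Do q (Ret ?C))"
      using comp_em[OF q T_Do_Var[OF typed.Ret[OF c]]] sub_closed1_simp(1)[OF typed.Ret[OF c]]
      by (simp add: mmap_em[OF c] del: mmap_unfold)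
    moreover have "comp TM (out TM (eo A)) (em X (TNu A) h) = em X (TMon (TSum (TNu A) A)) (Out h)"
      using h w by (simp add: TM_simps comp_em T_basic)
    moreover have "T [X] (Do q (Ret ?C)) (TMon (TSum (TNu A) A))"
      using typed.Do[OF q typed_append[OF typed.Ret[OF c]]] w by simp
    ultimately show ?thesis
      using D_out_step[OF q h] em_eq_iff[OF typed.Out[OF h]] by simp
  qed
  moreover have "src TM (em X (TMon (TSum X A)) q) = eo X" using q by (simp add: em_arr)
  ultimately show ?thesis
    using w unfolding coalg_mor_def by (auto simp: TM_simps(13) hom_em simp del: cosum_unfold mmap_unfold)
qed

sublocale resumption_category TM
proof unfold_locales
  fix P assume "P \<in> obj TM"
  then obtain A where A: "P = eo A" "wf_ty \<Sigma> A" by (metis objE)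
  then show "res TM P \<in> obj TM" "out TM P \<in> hom TM (res TM P) (mon TM (cpr TM (res TM P) P))"
    by (auto simp: TM_simps intro!: em_hom T_basic)
  fix X f assume "X \<in> obj TM" and f: "f \<in> hom TM X (mon TM (cpr TM X P))"
  then obtain x where x: "X = eo x" "wf_ty \<Sigma> x" by (metis objE)
  then obtain q where q: "f = em x (TMon (TSum x A)) q" "T [x] q (TMon (TSum x A))"
    using f A by (auto simp: TM_simps hom_em)
  have t: "T [x] (Unfold (Var 0) q) (TNu A)"
    by (rule typed.Unfold[OF T_Var0 typed_append[OF q(2)]]) (use x in auto)
  show "\<exists>!h. coalg_mor TM P f h"
    unfolding A(1) q(1) coalg_mor_em[OF q(2)]
    by (rule ex1I[of _ "em x (TNu A) (Unfold (Var 0) q)"]) (use t in \<open>auto intro: D_refl em_eqI\<close>)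
qed

section \<open>Interpretation of arbitrary contexts in the term model\<close>

lemma ty_sem_TM: "wf_ty \<Sigma> A \<Longrightarrow> ty_sem TM A = eo A"
  by (induction A) (auto simp: TM_simps one_TM TM_def)

lemma me_nu_model_TM: "me_nu_model \<Sigma> TM"
proof -
  have "fun_int TM f \<in> hom TM (ty_sem TM (fdom \<Sigma> f)) (ty_sem TM (fcod \<Sigma> f))" if "f \<in> funs \<Sigma>" for f
  proof -
    have "wf_ty \<Sigma> (fdom \<Sigma> f)" "wf_ty \<Sigma> (fcod \<Sigma> f)" using wf_sig that by (auto simp: wf_signature_def)
    moreover then have "T [fdom \<Sigma> f] (Fn f (Var 0)) (fcod \<Sigma> f)" using that by (auto intro: typed.Fn T_Var0)
    ultimately show ?thesis by (auto simp: ty_sem_TM em_hom) (simp add: TM_def em_hom[unfolded TM_def])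
  qed
  moreover have "atom_int TM w \<in> obj TM" if "w \<in> atoms \<Sigma>" for w
    using that by (simp add: TM_def)
  ultimately show ?thesis using resumption_category_axioms by (simp add: me_nu_model_def)
qed

sublocale model: me_model \<Sigma> TM
  by unfold_locales (rule wf_sig me_nu_model_TM)+

primrec cty :: "'w ctx \<Rightarrow> 'w ty" where
  "cty [] = TOne"
| "cty (A # \<Gamma>) = TProd (cty \<Gamma>) A"

lemma wf_cty [simp]: "wf_ty \<Sigma> (cty \<Gamma>) \<longleftrightarrow> wf_ctx \<Sigma> \<Gamma>"
  by (induction \<Gamma>) auto

lemma ctx_sem_TM: "wf_ctx \<Sigma> \<Gamma> \<Longrightarrow> ctx_sem TM \<Gamma> = eo (cty \<Gamma>)"
  by (induction \<Gamma>) (auto simp: one_TM ty_sem_TM TM_simps)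

text \<open>\<open>proj i\<close> is the \<open>i\<close>-th variable of a context \<open>\<Gamma>\<close>, as a term over the product \<open>cty \<Gamma>\<close>.\<close>

primrec proj :: "nat \<Rightarrow> ('w, 'f) tm" where
  "proj 0 = Snd (Var 0)"
| "proj (Suc i) = sub (\<lambda>_. Fst (Var 0)) (proj i)"

text \<open>\<open>Var 0\<close> is the only variable of \<open>proj i\<close>.\<close>

lemma sub_proj: "sub \<sigma> (proj i) = sub (\<lambda>_. \<sigma> 0) (proj i)"
  by (induction i arbitrary: \<sigma>) (auto simp: sub_sub)

lemma typed_proj: "wf_ctx \<Sigma> \<Gamma> \<Longrightarrow> i < length \<Gamma> \<Longrightarrow> T [cty \<Gamma>] (proj i) (\<Gamma> ! i)"
proof (induction \<Gamma> arbitrary: i)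
  case (Cons A \<Gamma>)
  then show ?case by (cases i) (auto intro!: T_basic typed_sub1)
qed simp

lemma typed_sub_proj: "wf_ctx \<Sigma> \<Gamma> \<Longrightarrow> typed_sub \<Sigma> [cty \<Gamma>] proj \<Gamma>"
  by (simp add: typed_sub_def typed_proj)

lemma T_gen: "T \<Gamma> t A \<Longrightarrow> T [cty \<Gamma>] (sub proj t) A"
  by (rule typed_subI) (auto simp: typed_sub_proj dest: typed_wf_ctx)

text \<open>\<open>gen \<Gamma> A t\<close> turns out to be the interpretation of \<open>t\<close> in the term model.\<close>

definition gen :: "'w ctx \<Rightarrow> 'w ty \<Rightarrow> ('w, 'f) tm \<Rightarrow> 'm" where
  "gen \<Gamma> A t = em (cty \<Gamma>) A (sub proj t)"

lemma gen_eqI: "D \<Gamma> t s A \<Longrightarrow> gen \<Gamma> A t = gen \<Gamma> A s"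
  unfolding gen_def using typed_sub_proj[of \<Gamma>] D_typed(1)[of \<Gamma> t s A]
  by (intro em_eqI derivable.subst) (auto simp: typed_sub_def dest: typed_wf_ctx)

text \<open>Encoding the context as a product commutes with passing under a binder, up to the beta
  rules for pairs.\<close>

lemma D_curry_proj:
  assumes "T (A # \<Gamma>) t C"
  shows "D [A, cty \<Gamma>] (curry_tm (sub proj t)) (sub (lift_sub proj) t) C"
  unfolding curry_tm_def sub_sub
proof (rule sub_cong_D[OF assms])
  have w: "wf_ctx \<Sigma> \<Gamma>" "wf_ty \<Sigma> A" using typed_wf_ctx[OF assms] by auto
  have v: "T [A, cty \<Gamma>] (Var 0) A" "T [A, cty \<Gamma>] (Var (Suc 0)) (cty \<Gamma>)"
    using w by (auto intro!: typed_VarI)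
  have "D [A, cty \<Gamma>] (sub (\<lambda>_. Fst (Tup (Var (Suc 0)) (Var 0))) (proj i)) (ren Suc (proj i)) (\<Gamma> ! i)" if "i <
    length \<Gamma>" for i
    unfolding ren_eq_sub sub_proj[of "\<lambda>i. Var (Suc i)"]
    by (rule D_sub1[OF D_refl[OF typed_proj]], rule w, rule that, rule derivable.fst, (rule v)+)
  moreover have "D [A, cty \<Gamma>] (Snd (Tup (Var (Suc 0)) (Var 0))) (Var 0) A"
    by (rule derivable.snd, (rule v)+)
  ultimately show "D_sub [A, cty \<Gamma>] (\<lambda>i. sub (\<lambda>_. Tup (Var (Suc 0)) (Var 0)) (proj i)) (lift_sub proj) (A # \<Gamma>)"
    using w by (auto simp: D_sub_def all_less_Suc_iff sub_sub)
qed

text \<open>\<open>gen\<close> is shown to obey the recursion of \<open>sem\<close>. Here the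
  branches are first curried by \<open>D_curry_proj\<close>, which turns the class into a value of
  \<open>cas\<close>, and \<open>copair_dist_eq_cas\<close> yields the semantic clause.\<close>

lemma gen_Case:
  assumes "T \<Gamma> s (TSum A B)" "T (A # \<Gamma>) t C" "T (B # \<Gamma>) u C"
  shows "gen \<Gamma> C (Case s t u) = copair TM (gen (A # \<Gamma>) C t) (gen (B # \<Gamma>) C u)
    \<cdot>\<^bsub>TM\<^esub> dist TM (eo (cty \<Gamma>)) (eo A) (eo B) \<cdot>\<^bsub>TM\<^esub> pair TM (ide TM (eo (cty \<Gamma>))) (gen \<Gamma> (TSum A B) s)"
proof -
  have w: "wf_ctx \<Sigma> \<Gamma>" "wf_ty \<Sigma> A" "wf_ty \<Sigma> B" using assms(2,3)[THEN typed_wf_ctx] by auto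
  note g = assms(1)[THEN T_gen] assms(2)[THEN T_gen, simplified] assms(3)[THEN T_gen, simplified]
  have "gen \<Gamma> C (Case s t u) = em (cty \<Gamma>) C (Case (sub proj s) (curry_tm (sub proj t)) (curry_tm (sub proj u)))"
    unfolding gen_def sub.simps
    by (rule em_eqI, rule derivable.sym, rule derivable.cong_Case[OF D_refl[OF g(1)]]) (rule D_curry_proj assms)+
  also have "\<dots> = cas (eo A) (eo B) (gen \<Gamma> (TSum A B) s) (gen (A # \<Gamma>) C t) (gen (B # \<Gamma>) C u)"
    unfolding gen_def using g by (simp add: cas_em)
  also have "\<dots> = copair TM (gen (A # \<Gamma>) C t) (gen (B # \<Gamma>) C u)
    \<cdot>\<^bsub>TM\<^esub> dist TM (eo (cty \<Gamma>)) (eo A) (eo B) \<cdot>\<^bsub>TM\<^esub> pair TM (ide TM (eo (cty \<Gamma>))) (gen \<Gamma> (TSum A B) s)"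
    by (rule copair_dist_eq_cas[symmetric]) (use g w in \<open>simp_all add: gen_def em_arr TM_simps\<close>)
  finally show ?thesis .
qed

lemma gen_Do:
  assumes "T \<Gamma> p (TMon A)" "T (A # \<Gamma>) q (TMon B)"
  shows "gen \<Gamma> (TMon B) (Do p q) = bind TM (eo A) (eo B) (gen (A # \<Gamma>) (TMon B) q) (gen \<Gamma> (TMon A) p)"
proof -
  have w: "wf_ctx \<Sigma> \<Gamma>" "wf_ty \<Sigma> A" "wf_ty \<Sigma> B" using typed_wf[OF wf_sig assms(2)] by auto
  note g = assms(1)[THEN T_gen] assms(2)[THEN T_gen, simplified]
  have "gen \<Gamma> (TMon B) (Do p q) = em (cty \<Gamma>) (TMon B) (Do (sub proj p) (curry_tm (sub proj q)))"
    unfolding gen_def sub.simps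
    by (rule em_eqI, rule derivable.sym, rule derivable.cong_Do[OF D_refl[OF g(1)]]) (rule D_curry_proj assms)+
  also have "\<dots> = bnd (eo A) (eo B) (gen (A # \<Gamma>) (TMon B) q) (gen \<Gamma> (TMon A) p)"
    unfolding gen_def using g by (simp add: bnd_em)
  also have "\<dots> = bind TM (eo A) (eo B) (gen (A # \<Gamma>) (TMon B) q) (gen \<Gamma> (TMon A) p)"
    by (rule bind_eq_bnd[symmetric]) (use g w in \<open>simp_all add: gen_def em_arr TM_simps\<close>)
  finally show ?thesis .
qed

lemma gen_InL: "T \<Gamma> t A \<Longrightarrow> wf_ty \<Sigma> B \<Longrightarrow> gen \<Gamma> (TSum A B) (InL B t) = comp TM (in1 TM (eo A) (eo B)) (gen \<Gamma> A t)"
  using typed_wf[OF wf_sig, of \<Gamma> t A] by (auto simp: gen_def TM_simps comp_em T_basic T_gen)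

lemma gen_InR: "T \<Gamma> t B \<Longrightarrow> wf_ty \<Sigma> A \<Longrightarrow> gen \<Gamma> (TSum A B) (InR A t) = comp TM (in2 TM (eo A) (eo B)) (gen \<Gamma> B t)"
  using typed_wf[OF wf_sig, of \<Gamma> t B] by (auto simp: gen_def TM_simps comp_em T_basic T_gen)

lemma gen_Ret: "T \<Gamma> t A \<Longrightarrow> gen \<Gamma> (TMon A) (Ret t) = comp TM (eta TM (eo A)) (gen \<Gamma> A t)"
  using typed_wf[OF wf_sig, of \<Gamma> t A] by (auto simp: gen_def TM_simps comp_em T_basic T_gen)

lemma gen_Out: "T \<Gamma> t (TNu A) \<Longrightarrow> gen \<Gamma> (TMon (TSum (TNu A) A)) (Out t) = comp TM (out TM (eo A)) (gen \<Gamma> (TNu A) t)"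
  using typed_wf[OF wf_sig, of \<Gamma> t "TNu A"] by (auto simp: gen_def TM_simps comp_em T_basic T_gen)

lemma gen_Var0: "wf_ctx \<Sigma> \<Gamma> \<Longrightarrow> wf_ty \<Sigma> A \<Longrightarrow> gen (A # \<Gamma>) A (Var 0) = pr2 TM (eo (cty \<Gamma>)) (eo A)"
  by (simp add: gen_def TM_simps)

text \<open>A substitution lemma for \<open>gen\<close>: \<kappa> represents \<sigma> as a term
  between encoded contexts, which is tested componentwise with \<open>proj\<close>.\<close>

lemma gen_sub:
  assumes "T \<Gamma> t A" "T [cty \<Delta>] \<kappa> (cty \<Gamma>)"
    and "\<forall>i<length \<Gamma>. D [cty \<Delta>] (sub (\<lambda>_. \<kappa>) (proj i)) (sub proj (\<sigma> i)) (\<Gamma> ! i)"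
  shows "gen \<Delta> A (sub \<sigma> t) = comp TM (gen \<Gamma> A t) (em (cty \<Delta>) (cty \<Gamma>) \<kappa>)"
proof -
  have "D [cty \<Delta>] (sub (\<lambda>_. \<kappa>) (sub proj t)) (sub proj (sub \<sigma> t)) A"
    unfolding sub_sub by (rule sub_cong_D[OF assms(1)]) (use assms(3) typed_wf_ctx[OF assms(2)] in \<open>simp add:
      D_sub_def\<close>)
  thus ?thesis unfolding gen_def using assms(1,2) by (simp add: comp_em T_gen em_eqI)
qed

lemma gen_inst:
  assumes "T (A # \<Gamma>) q B" "T \<Gamma> p A"
  shows "gen \<Gamma> B (inst p q) = comp TM (gen (A # \<Gamma>) B q) (pair TM (ide TM (eo (cty \<Gamma>))) (gen \<Gamma> A p))"
proof -
  let ?k = "Tup (Var 0) (sub proj p)"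
  have w: "wf_ctx \<Sigma> \<Gamma>" "wf_ty \<Sigma> A" using typed_wf_ctx[OF assms(1)] by auto
  note g = T_gen[OF assms(2)]
  have v: "T [cty \<Gamma>] (Var 0) (cty \<Gamma>)" using w by (simp add: T_Var0)
  have "gen \<Gamma> B (inst p q) = comp TM (gen (A # \<Gamma>) B q) (em (cty \<Gamma>) (cty (A # \<Gamma>)) ?k)"
    unfolding inst_def
  proof (rule gen_sub[OF assms(1)])
    show "T [cty \<Gamma>] ?k (cty (A # \<Gamma>))" using g by (simp add: T_pair_ide)
    have "D [cty \<Gamma>] (sub (\<lambda>_. Fst ?k) (proj i)) (sub (\<lambda>_. Var 0) (proj i)) (\<Gamma> ! i)" if "i < length \<Gamma>" for i
      by (rule D_sub1[OF D_refl[OF typed_proj]], rule w, rule that, rule derivable.fst, rule v, rule g)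
    hence "D [cty \<Gamma>] (sub (\<lambda>_. Fst ?k) (proj i)) (proj i) (\<Gamma> ! i)" if "i < length \<Gamma>" for i
      using that by (simp flip: sub_proj[of Var])
    moreover have "D [cty \<Gamma>] (Snd ?k) (sub proj p) A" by (rule derivable.snd, rule v, rule g)
    ultimately show "\<forall>i<length (A # \<Gamma>). D [cty \<Gamma>] (sub (\<lambda>_. ?k) (proj i)) (sub proj (case_nat p Var i)) ((A # \<Gamma>) ! i)"
      by (auto simp: all_less_Suc_iff sub_sub)
  qed
  thus ?thesis using g by (simp add: gen_def pair_ide_em)
qed

lemma gen_wk_under2:
  assumes "T (A # \<Gamma>) p B" "wf_ty \<Sigma> S"
  shows "gen (A # S # A # \<Gamma>) B (wk_under (wk_under p)) = comp TM (gen (A # \<Gamma>) B p)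
    (cross TM (comp TM (pr1 TM (eo (cty \<Gamma>)) (eo A)) (pr1 TM (eo (TProd (cty \<Gamma>) A)) (eo S))) (ide TM (eo A)))"
proof -
  let ?k = "Tup (Fst (Fst (Fst (Var 0)))) (Snd (Var 0))" and ?\<Delta> = "A # S # A # \<Gamma>"
  let ?\<sigma> = "\<lambda>i. Var (lift_ren Suc (lift_ren Suc i)) :: ('w, 'f) tm"
  have w: "wf_ctx \<Sigma> \<Gamma>" "wf_ty \<Sigma> A" using typed_wf_ctx[OF assms(1)] by auto
  have f: "T [cty ?\<Delta>] (Fst (Fst (Fst (Var 0)))) (cty \<Gamma>)" and s: "T [cty ?\<Delta>] (Snd (Var 0)) A"
    by (simp_all, rule typed.Fst[where B=A], rule typed.Fst[where B=S], rule T_basic(1))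
      (use w assms(2) in \<open>auto intro: T_basic\<close>)
  have k: "T [cty ?\<Delta>] ?k (cty (A # \<Gamma>))" using typed.Tup[OF f s] by simp
  have "wk_under (wk_under p) = sub ?\<sigma> p"
    by (simp add: wk_under_def ren_eq_sub sub_sub)
  also have "gen ?\<Delta> B \<dots> = comp TM (gen (A # \<Gamma>) B p) (em (cty ?\<Delta>) (cty (A # \<Gamma>)) ?k)"
  proof (rule gen_sub[OF assms(1) k])
    \<comment> \<open>Variable \<open>i\<close> of \<Gamma> has index \<open>i + 3\<close> behind
      the inner \<open>x\<close>, the scrutinee and the outer \<open>x\<close>, hence three first
      projections.\<close>
    have "D [cty ?\<Delta>] (sub (\<lambda>_. Fst ?k) (proj i)) (proj (Suc (Suc (Suc i)))) (\<Gamma> ! i)" if "i < length \<Gamma>" for i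
    proof -
      have "D [cty ?\<Delta>] (sub (\<lambda>_. Fst ?k) (proj i)) (sub (\<lambda>_. Fst (Fst (Fst (Var 0)))) (proj i)) (\<Gamma> ! i)"
        by (rule D_sub1[OF D_refl[OF typed_proj]], rule w, rule that, rule derivable.fst, rule f, rule s)
      thus ?thesis by (simp add: sub_sub)
    qed
    moreover have "D [cty ?\<Delta>] (Snd ?k) (Snd (Var 0)) A" by (rule derivable.snd, rule f, rule s)
    ultimately show "\<forall>i<length (A # \<Gamma>). D [cty ?\<Delta>] (sub (\<lambda>_. ?k) (proj i)) (sub proj (?\<sigma> i)) ((A # \<Gamma>) ! i)"
      by (auto simp: all_less_Suc_iff sub_sub)
  qed
  also have "em (cty ?\<Delta>) (cty (A # \<Gamma>)) ?k = cross TM (comp TM (pr1 TM (eo (cty \<Gamma>)) (eo A)) (pr1 TM (eo (TProd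
    (cty \<Gamma>) A)) (eo S))) (ide TM (eo A))"
  proof -
    have ff: "T [TProd (TProd (cty \<Gamma>) A) S] (Fst (Fst (Var 0))) (cty \<Gamma>)"
      by (rule typed.Fst[where B=A], rule T_basic(1)) (use w assms(2) in auto)
    have "comp TM (pr1 TM (eo (cty \<Gamma>)) (eo A)) (pr1 TM (eo (TProd (cty \<Gamma>) A)) (eo S))
      = em (TProd (TProd (cty \<Gamma>) A) S) (cty \<Gamma>) (Fst (Fst (Var 0)))"
      using w assms(2) by (simp add: TM_simps comp_em T_basic)
    thus ?thesis using cross_em[OF ff w(2)] by (simp del: cross_unfold)
  qed
  finally show ?thesis .
qed

text \<open>Finality replaces evaluation. The class of the \<open>Unfold\<close> term started at a
  variable satisfies the equation in \<open>coalg_ctx_step_iff\<close>, so it is the coiteration; an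
  arbitrary starting term \<open>p\<close> is then reached by instantiation.\<close>

lemma gen_Unfold:
  assumes "T \<Gamma> p A" "T (A # \<Gamma>) q (TMon (TSum A B))"
  shows "gen \<Gamma> (TNu B) (Unfold p q) = comp TM (ctx_coit TM (eo (cty \<Gamma>)) (eo A) (eo B) (gen (A # \<Gamma>) (TMon (TSum A B)) q))
    (pair TM (ide TM (eo (cty \<Gamma>))) (gen \<Gamma> A p))"
proof -
  have w: "wf_ctx \<Sigma> \<Gamma>" "wf_ty \<Sigma> A" "wf_ty \<Sigma> B" using typed_wf[OF wf_sig assms(2)] by auto
  let ?h = "Unfold (Var 0) (wk_under q)" and ?G = "eo (cty \<Gamma>)" and ?g = "gen (A # \<Gamma>) (TMon (TSum A B)) q"
  let ?l = "wk_under (wk_under ?h)" and ?\<Delta> = "TSum A B # A # \<Gamma>"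
  let ?C = "Case (Var 0) (Ret (InL B ?l)) (Ret (InR (TNu B) (Var 0)))"
  let ?S = "TSum (TNu B) B"
  have h: "T (A # \<Gamma>) ?h (TNu B)"
    using w by (intro typed.Unfold[OF typed_Var0 typed_wk_under[OF assms(2)]])
  have l: "T (A # ?\<Delta>) ?l (TNu B)" using typed_wk_under[OF typed_wk_under[OF h], of A "TSum A B"] w by simp
  have r: "T (B # ?\<Delta>) (Var 0) B" and v: "T ?\<Delta> (Var 0) (TSum A B)"
    using w by (auto intro!: typed_Var0)
  have L: "T (A # ?\<Delta>) (Ret (InL B ?l)) (TMon ?S)" and R: "T (B # ?\<Delta>) (Ret (InR (TNu B) (Var 0))) (TMon ?S)"
    using l r w by (auto intro!: typed.Ret typed.InL typed.InR)
  note C = typed.Case[OF v L R]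
  have hg: "gen (A # \<Gamma>) (TNu B) ?h \<in> arr TM" "src TM (gen (A # \<Gamma>) (TNu B) ?h) = prd TM ?G (eo A)"
      "trg TM (gen (A # \<Gamma>) (TNu B) ?h) = res TM (eo B)"
    and gg: "?g \<in> arr TM" "src TM ?g = prd TM ?G (eo A)" "trg TM ?g = mon TM (cpr TM (eo A) (eo B))"
    using T_gen[OF h] T_gen[OF assms(2)] w by (simp_all add: gen_def em_arr TM_simps)
  have S: "eo (TProd (cty \<Gamma>) A) = prd TM ?G (eo A)" "eo (TSum A B) = cpr TM (eo A) (eo B)"
    "eo (cty ?\<Delta>) = prd TM (prd TM ?G (eo A)) (cpr TM (eo A) (eo B))" "eo ?S = cpr TM (res TM (eo B)) (eo B)"
    "eo (TNu B) = res TM (eo B)"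
    using w by (simp_all add: TM_simps)
  \<comment> \<open>The rule \<open>unfold_coit\<close> applied to the \<open>Unfold\<close> term
    itself, whose premise is then reflexivity.\<close>
  have out: "comp TM (out TM (eo B)) (gen (A # \<Gamma>) (TNu B) ?h) = gen (A # \<Gamma>) (TMon ?S) (Do q ?C)"
    unfolding gen_Out[OF h, symmetric]
    by (rule gen_eqI, rule derivable.unfold_coit[OF h assms(2)], rule D_refl[OF h])
  have cong: "gen (A # \<Gamma>) (TMon ?S) (Do q ?C) = bind TM (cpr TM (eo A) (eo B)) (cpr TM (res TM (eo B)) (eo B))
    (copair TM (eta TM (eo ?S) \<cdot>\<^bsub>TM\<^esub> in1 TM (res TM (eo B)) (eo B) \<cdot>\<^bsub>TM\<^esub> gen (A # \<Gamma>) (TNu B) ?h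
        \<cdot>\<^bsub>TM\<^esub> cross TM (pr1 TM ?G (eo A) \<cdot>\<^bsub>TM\<^esub> pr1 TM (prd TM ?G (eo A)) (cpr TM (eo A) (eo B))) (ide TM (eo A)))
      (eta TM (eo ?S) \<cdot>\<^bsub>TM\<^esub> in2 TM (res TM (eo B)) (eo B) \<cdot>\<^bsub>TM\<^esub> pr2 TM (eo (cty ?\<Delta>)) (eo B))
      \<cdot>\<^bsub>TM\<^esub> dist TM (eo (cty ?\<Delta>)) (eo A) (eo B) \<cdot>\<^bsub>TM\<^esub> pair TM (ide TM (eo (cty ?\<Delta>))) (pr2 TM (prd TM ?G (eo A))
        (cpr TM (eo A) (eo B)))) ?g"
    using w l r
    by (simp only: gen_Do[OF assms(2) C] gen_Case[OF v L R] gen_Ret[OF typed.InL[OF l]] gen_Ret[OF typed.InR[OF r]]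
        gen_InL[OF l] gen_InR[OF r] gen_Var0 wf_ctx_simps wf_ty_simps cty.simps S(1,2,5)[symmetric] S(4)
        gen_wk_under2[OF h] simp_thms)
  have "gen (A # \<Gamma>) (TNu B) ?h = ctx_coit TM ?G (eo A) (eo B) ?g"
    using coalg_ctx_step_iff[OF _ _ _ gg hg] out cong w by (simp only: S) simp
  \<comment> \<open>The weakening of \<open>q\<close> under its bound variable leaves nothing of the
    instantiated variable in it, so only the starting term changes.\<close>
  moreover have "inst p ?h = Unfold p q"
    by (simp add: inst_def wk_under_def sub_ren) (simp add: ren_eq_sub lift_sub_lift_ren lift_sub_Var)
  ultimately show ?thesis using gen_inst[OF h assms(1)] by simp
qed

lemma var_sem_TM: "wf_ctx \<Sigma> \<Gamma> \<Longrightarrow> i < length \<Gamma> \<Longrightarrow> var_sem TM \<Gamma> i = em (cty \<Gamma>) (\<Gamma> ! i) (proj i)"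
proof (induction \<Gamma> arbitrary: i)
  case (Cons A \<Gamma>)
  then have w: "wf_ctx \<Sigma> \<Gamma>" "wf_ty \<Sigma> A" by auto
  show ?case
  proof (cases i)
    case 0
    then show ?thesis using w by (simp add: ctx_sem_TM ty_sem_TM TM_simps)
  next
    case (Suc j)
    then show ?thesis using Cons w by (simp add: ctx_sem_TM ty_sem_TM TM_simps comp_em T_basic typed_proj)
  qed
qed simp

lemma sem_TM: "T \<Gamma> t A \<Longrightarrow> sem \<Sigma> TM \<Gamma> t = gen \<Gamma> A t"
proof (induction rule: typed.induct)
  case (Var \<Gamma> i)
  then show ?case by (simp add: var_sem_TM gen_def)
next
  case (Fn f \<Gamma> t)
  have w: "wf_ty \<Sigma> (fdom \<Sigma> f)" using typed_wf[OF wf_sig Fn(2)] by simp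
  have "T [fdom \<Sigma> f] (Fn f (Var 0)) (fcod \<Sigma> f)" using Fn(1) w by (auto intro: typed.Fn T_Var0)
  moreover have "fun_int TM f = em (fdom \<Sigma> f) (fcod \<Sigma> f) (Fn f (Var 0))" by (simp add: TM_def)
  ultimately show ?case using Fn by (simp add: gen_def comp_em T_gen)
next
  case (Star \<Gamma>)
  then show ?case by (simp add: ctx_sem_TM bang_em gen_def)
next
  case (Tup \<Gamma> t A u B)
  then show ?case by (simp add: gen_def pair_em T_gen)
next
  case (Fst \<Gamma> t A B)
  have "wf_ty \<Sigma> A" "wf_ty \<Sigma> B" using typed_wf[OF wf_sig Fst(1)] by auto
  then show ?case using Fst T_gen[OF Fst(1)] by (simp add: model.sem_simps(1) ty_sem_TM gen_def TM_simps comp_em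
    T_basic)
next
  case (Snd \<Gamma> t A B)
  have "wf_ty \<Sigma> A" "wf_ty \<Sigma> B" using typed_wf[OF wf_sig Snd(1)] by auto
  then show ?case using Snd T_gen[OF Snd(1)] by (simp add: model.sem_simps(2) ty_sem_TM gen_def TM_simps comp_em
    T_basic)
next
  case (InL \<Gamma> t A B)
  then show ?case using typed_wf[OF wf_sig InL(1)] by (simp add: model.sem_simps(3)[OF InL(1)] ty_sem_TM gen_InL)
next
  case (InR \<Gamma> t B A)
  then show ?case using typed_wf[OF wf_sig InR(1)] by (simp add: model.sem_simps(4)[OF InR(1)] ty_sem_TM gen_InR)
next
  case (Case \<Gamma> s A B t C u)
  have "wf_ctx \<Sigma> \<Gamma>" "wf_ty \<Sigma> A" "wf_ty \<Sigma> B" using Case(2,3)[THEN typed_wf_ctx] by auto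
  then show ?case using Case by (simp add: model.sem_Case[OF Case(1)] gen_Case ty_sem_TM ctx_sem_TM)
next
  case (Ret \<Gamma> t A)
  then show ?case using typed_wf[OF wf_sig Ret(1)] by (simp add: model.sem_simps(5)[OF Ret(1)] ty_sem_TM gen_Ret)
next
  case (Do \<Gamma> p A q B)
  have "wf_ty \<Sigma> A" "wf_ty \<Sigma> B" using typed_wf[OF wf_sig Do(2)] by auto
  then show ?case using Do by (simp add: model.sem_Do[OF Do(1,2)] gen_Do ty_sem_TM)
next
  case (Dead \<Gamma> A)
  then show ?case by (simp add: ty_sem_TM ctx_sem_TM dead_em gen_def)
next
  case (Choice \<Gamma> p A q)
  then show ?case using typed_wf[OF wf_sig Choice(1)] Choice(1,2)[THEN T_gen]
    by (simp add: model.sem_simps(6)[OF Choice(1)] ty_sem_TM gen_def choice_em)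
next
  case (Out \<Gamma> p A)
  then show ?case using typed_wf[OF wf_sig Out(1)] by (simp add: model.sem_simps(7)[OF Out(1)] ty_sem_TM gen_Out)
next
  case (Unfold \<Gamma> p A q B)
  have "wf_ctx \<Sigma> \<Gamma>" "wf_ty \<Sigma> A" "wf_ty \<Sigma> B" using typed_wf[OF wf_sig Unfold(2)] by auto
  then show ?case using Unfold by (simp add: model.sem_Unfold[OF Unfold(1,2)] gen_Unfold[OF Unfold(1,2)]
    ty_sem_TM ctx_sem_TM)
qed

section \<open>Decoding of encoded contexts\<close>

primrec vars_tup :: "nat \<Rightarrow> ('w, 'f) tm" where
  "vars_tup 0 = Star"
| "vars_tup (Suc n) = Tup (ren Suc (vars_tup n)) (Var 0)"

lemma typed_vars_tup: "wf_ctx \<Sigma> \<Gamma> \<Longrightarrow> T \<Gamma> (vars_tup (length \<Gamma>)) (cty \<Gamma>)"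
  by (induction \<Gamma>) (auto intro!: typed.Star typed.Tup typed_weaken typed_Var0)

text \<open>The tuple of all variables of a context undoes the encoding: its projections are the
  variables by the beta rules for pairs.\<close>

lemma D_proj_vars_tup:
  "wf_ctx \<Sigma> \<Gamma> \<Longrightarrow> i < length \<Gamma> \<Longrightarrow> D \<Gamma> (sub (\<lambda>_. vars_tup (length \<Gamma>)) (proj i)) (Var i) (\<Gamma> ! i)"
proof (induction \<Gamma> arbitrary: i)
  case (Cons A \<Gamma>)
  then have w: "wf_ctx \<Sigma> \<Gamma>" "wf_ty \<Sigma> A" by auto
  let ?t = "vars_tup (length \<Gamma>)"
  have t: "T (A # \<Gamma>) (ren Suc ?t) (cty \<Gamma>)" "T (A # \<Gamma>) (Var 0) A"
    using w by (auto intro!: typed_weaken typed_vars_tup typed_Var0)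
  show ?case
  proof (cases i)
    case 0
    then show ?thesis using derivable.snd[OF t] by simp
  next
    case (Suc j)
    hence j: "j < length \<Gamma>" using Cons by simp
    have "D (A # \<Gamma>) (sub (\<lambda>_. Fst (Tup (ren Suc ?t) (Var 0))) (proj j)) (sub (\<lambda>_. ren Suc ?t) (proj j)) (\<Gamma> ! j)"
      by (rule D_sub1[OF D_refl[OF typed_proj[OF w(1) j]] derivable.fst[OF t]])
    moreover have "D (A # \<Gamma>) (sub (\<lambda>_. ren Suc ?t) (proj j)) (Var (Suc j)) (\<Gamma> ! j)"
      using D_weaken[OF Cons.IH[OF w(1) j] w(2)] by (simp add: ren_sub)
    ultimately show ?thesis using Suc by (auto simp: sub_sub intro: D_trans)
  qed
qed simp

text \<open>Substituting the tuple of variables for the encoded context turns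
  \<open>sub proj t\<close> back into \<open>t\<close> up to derivability, so the encoding
  identifies no further terms.\<close>

theorem gen_eq_iff:
  assumes t: "T \<Gamma> t A" and s: "T \<Gamma> s A"
  shows "gen \<Gamma> A t = gen \<Gamma> A s \<longleftrightarrow> D \<Gamma> t s A"
proof
  assume "gen \<Gamma> A t = gen \<Gamma> A s"
  hence "D [cty \<Gamma>] (sub proj t) (sub proj s) A"
    using t s by (simp add: gen_def em_eq_iff T_gen)
  moreover have w: "wf_ctx \<Sigma> \<Gamma>" using t by (rule typed_wf_ctx)
  ultimately have eq: "D \<Gamma> (sub (\<lambda>_. vars_tup (length \<Gamma>)) (sub proj t)) (sub (\<lambda>_. vars_tup (length \<Gamma>)) (sub proj s)) A"
    by (intro D_sub1[where A="cty \<Gamma>"] D_refl typed_vars_tup)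
  have "D \<Gamma> (sub (\<lambda>_. vars_tup (length \<Gamma>)) (sub proj r)) r A" if r: "T \<Gamma> r A" for r
    using sub_cong_D[OF r, of \<Gamma> "\<lambda>i. sub (\<lambda>_. vars_tup (length \<Gamma>)) (proj i)" Var] w
    by (simp add: sub_sub D_sub_def D_proj_vars_tup)
  from this[OF t] this[OF s] eq show "D \<Gamma> t s A" by (meson D_trans derivable.sym)
qed (rule gen_eqI)

text \<open>Used twice for completeness: on the equations of \<Phi> it makes \<open>TM\<close> a
  model of them, and on the goal it turns satisfaction into a derivation.\<close>

lemma satisfies_TM:
  assumes "wt_equation \<Sigma> (\<Gamma>, t, s, A)"
  shows "satisfies \<Sigma> TM (\<Gamma>, t, s, A) \<longleftrightarrow> D \<Gamma> t s A"
proof -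
  have t: "T \<Gamma> t A" "T \<Gamma> s A" using assms by (simp_all add: wt_equation_def)
  show ?thesis unfolding satisfies_def by (simp add: t[THEN sem_TM] gen_eq_iff[OF t])
qed

end

section \<open>Countability of the term model\<close>

instance ty :: (countable) countable
  by countable_datatype

instance tm :: (countable, countable) countable
  by countable_datatype

text \<open>The ambient type of atoms may be uncountable. Numbering the atoms of \<open>W\<close>
  embeds these types into types over \<open>nat\<close>, which form a countable datatype;
  \<open>countable_tm\<close> argues alike.\<close>

lemma countable_ty:
  assumes "countable W"
  shows "countable {A. ty_atoms A \<subseteq> W}"
proof (rule countableI'[where f = "\<lambda>A. to_nat (map_ty (to_nat_on W) A)"], rule inj_onI)
  fix A B assume "A \<in> {A. ty_atoms A \<subseteq> W}" "B \<in> {A. ty_atoms A \<subseteq> W}"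
    "to_nat (map_ty (to_nat_on W) A) = to_nat (map_ty (to_nat_on W) B)"
  then have AB: "ty_atoms A \<subseteq> W" "ty_atoms B \<subseteq> W" "map_ty (to_nat_on W) A = map_ty (to_nat_on W) B"
    by simp_all
  show "A = B"
    by (rule ty.inj_map_strong[OF _ AB(3)])
      (meson AB(1,2) inj_onD[OF inj_on_to_nat_on[OF assms]] subsetD)
qed

lemma countable_tm:
  assumes "countable W" "countable F"
  shows "countable {t. set1_tm t \<subseteq> W \<and> set2_tm t \<subseteq> F}"
proof (rule countableI'[where f = "\<lambda>t. to_nat (map_tm (to_nat_on W) (to_nat_on F) t)"], rule inj_onI)
  fix s t assume "s \<in> {t. set1_tm t \<subseteq> W \<and> set2_tm t \<subseteq> F}" "t \<in> {t. set1_tm t \<subseteq> W \<and> set2_tm t \<subseteq> F}"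
    "to_nat (map_tm (to_nat_on W) (to_nat_on F) s) = to_nat (map_tm (to_nat_on W) (to_nat_on F) t)"
  then have st: "set1_tm s \<subseteq> W" "set2_tm s \<subseteq> F" "set1_tm t \<subseteq> W" "set2_tm t \<subseteq> F"
    "map_tm (to_nat_on W) (to_nat_on F) s = map_tm (to_nat_on W) (to_nat_on F) t"
    by simp_all
  show "s = t"
    by (rule tm.inj_map_strong[OF _ _ st(5)])
      (meson st(1-4) assms[THEN inj_on_to_nat_on, THEN inj_onD] subsetD)+
qed

lemma typed_symbols: "typed \<Sigma> \<Gamma> t A \<Longrightarrow> set1_tm t \<subseteq> atoms \<Sigma> \<and> set2_tm t \<subseteq> funs \<Sigma>"
  by (induction rule: typed.induct) (auto simp: wf_ty_def)

text \<open>A morphism is encoded by the number of the triple of its domain, codomain and class.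
  Typed terms use only symbols of \<Sigma>, so there are countably many such triples, and an
  infinite type contains a copy of the natural numbers.\<close>

lemma term_model_exists:
  fixes \<Sigma> :: "('w, 'f) signature"
  assumes "wf_signature \<Sigma>" "countable_signature \<Sigma>" "\<forall>\<phi>\<in>\<Phi>. wt_equation \<Sigma> \<phi>"
    "infinite (UNIV :: 'o set)" "infinite (UNIV :: 'm set)"
  shows "\<exists>(eo :: 'w ty \<Rightarrow> 'o) (em :: 'w ty \<Rightarrow> 'w ty \<Rightarrow> ('w, 'f) tm \<Rightarrow> 'm). term_model \<Sigma> \<Phi> eo em"
proof -
  obtain go :: "nat \<Rightarrow> 'o" where go: "inj go" using infinite_countable_subset[OF assms(4)] by blast
  obtain gm :: "nat \<Rightarrow> 'm" where gm: "inj gm" using infinite_countable_subset[OF assms(5)] by blast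
  interpret calculus \<Sigma> \<Phi> by unfold_locales (use assms in auto)
  \<comment> \<open>The types are stored with the class because one raw term, such as
    \<open>Var 0\<close>, is a morphism on many objects.\<close>
  let ?W = "{A. wf_ty \<Sigma> A}" and ?cls = "\<lambda>A B t. (A, B, {s. D [A] t s B})"
  let ?T = "{t. set1_tm t \<subseteq> atoms \<Sigma> \<and> set2_tm t \<subseteq> funs \<Sigma>}"
  \<comment> \<open>The classes are indexed by all terms over the symbols of \<Sigma>, typed or not:
    this index set is visibly countable and covers the typed ones.\<close>
  let ?Q = "(\<lambda>(A, B, t). ?cls A B t) ` (?W \<times> ?W \<times> ?T)"
  have W: "countable ?W" and "countable ?T"
    using assms(2) countable_ty[of "atoms \<Sigma>"] countable_tm[of "atoms \<Sigma>" "funs \<Sigma>"]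
    by (simp_all add: countable_signature_def wf_ty_def)
  hence Q: "countable ?Q" by (intro countable_image countable_SIGMA)
  have in_Q: "?cls A B t \<in> ?Q" if "T [A] t B" for A B t
  proof -
    have "(A, B, t) \<in> ?W \<times> ?W \<times> ?T" using typed_symbols[OF that] typed_wf[OF wf_sig that] by simp
    thus ?thesis by (intro image_eqI[of _ _ "(A, B, t)"]) simp_all
  qed
  have "term_model \<Sigma> \<Phi> (\<lambda>A. go (to_nat_on ?W A)) (\<lambda>A B t. gm (to_nat_on ?Q (?cls A B t)))"
  proof unfold_locales
    show "inj_on (\<lambda>A. go (to_nat_on ?W A)) ?W"
      using inj_on_to_nat_on[OF W] go by (auto intro!: inj_onI dest: inj_onD injD)
  next
    fix A B t A' B' t' assume t: "T [A] t B" "T [A'] t' B'"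
    have "gm (to_nat_on ?Q (?cls A B t)) = gm (to_nat_on ?Q (?cls A' B' t')) \<longleftrightarrow> ?cls A B t = ?cls A' B' t'"
      using inj_on_eq_iff[OF inj_on_to_nat_on[OF Q] in_Q[OF t(1)] in_Q[OF t(2)]] inj_eq[OF gm] by blast
    also have "\<dots> \<longleftrightarrow> A = A' \<and> B = B' \<and> D [A] t t' B"
      using t by (auto intro: D_refl D_trans derivable.sym)
    finally show "gm (to_nat_on ?Q (?cls A B t)) = gm (to_nat_on ?Q (?cls A' B' t')) \<longleftrightarrow> A = A' \<and> B = B' \<and> D [A] t t' B" .
  qed
  thus ?thesis by blast
qed

text \<open>Validity ranges over models on the fixed carrier types \<open>'o\<close> and
  \<open>'m\<close>; the completeness half takes them infinite so that a copy of the term model is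
  among these models.\<close>

theorem theorem1:
  fixes \<Sigma> :: "('w, 'f) signature" and \<Phi> :: "('w, 'f) equation set"
  assumes "wf_signature \<Sigma>" and "countable_signature \<Sigma>"
    and "\<forall>\<phi>\<in>\<Phi>. wt_equation \<Sigma> \<phi>"
    and "wt_equation \<Sigma> (\<Gamma>, t, s, A)"
  shows
    "(derivable \<Sigma> \<Phi> \<Gamma> t s A \<longrightarrow>
       (\<forall>M :: ('o, 'm, 'w, 'f) model_data. me_nu_model \<Sigma> M \<longrightarrow>
          (\<forall>\<phi>\<in>\<Phi>. satisfies \<Sigma> M \<phi>) \<longrightarrow> satisfies \<Sigma> M (\<Gamma>, t, s, A))) \<and>
     (infinite (UNIV :: 'o set) \<and> infinite (UNIV :: 'm set) \<longrightarrow>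
       (\<forall>M :: ('o, 'm, 'w, 'f) model_data. me_nu_model \<Sigma> M \<longrightarrow>
          (\<forall>\<phi>\<in>\<Phi>. satisfies \<Sigma> M \<phi>) \<longrightarrow> satisfies \<Sigma> M (\<Gamma>, t, s, A)) \<longrightarrow>
       derivable \<Sigma> \<Phi> \<Gamma> t s A)"
proof (intro conjI impI allI)
  fix M :: "('o, 'm, 'w, 'f) model_data"
  assume D: "derivable \<Sigma> \<Phi> \<Gamma> t s A" and M: "me_nu_model \<Sigma> M" "\<forall>\<phi>\<in>\<Phi>. satisfies \<Sigma> M \<phi>"
  interpret me_model \<Sigma> M by unfold_locales (use assms(1) M(1) in auto)
  show "satisfies \<Sigma> M (\<Gamma>, t, s, A)"
    using soundness[OF assms(3) M(2) D] by (simp add: satisfies_def)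
next
  assume inf: "infinite (UNIV :: 'o set) \<and> infinite (UNIV :: 'm set)"
    and all: "\<forall>M :: ('o, 'm, 'w, 'f) model_data. me_nu_model \<Sigma> M \<longrightarrow>
          (\<forall>\<phi>\<in>\<Phi>. satisfies \<Sigma> M \<phi>) \<longrightarrow> satisfies \<Sigma> M (\<Gamma>, t, s, A)"
  obtain eo :: "'w ty \<Rightarrow> 'o" and em :: "'w ty \<Rightarrow> 'w ty \<Rightarrow> ('w, 'f) tm \<Rightarrow> 'm" where "term_model \<Sigma> \<Phi> eo em"
    using term_model_exists[OF assms(1-3)] inf by blast
  then interpret term_model \<Sigma> \<Phi> eo em .
  \<comment> \<open>Equations of \<Phi> are derivable as hypotheses, hence true in the term
    model.\<close>
  have "satisfies \<Sigma> TM \<phi>" if "\<phi> \<in> \<Phi>" for \<phi>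
  proof (cases \<phi>)
    case (fields \<Delta> u v B)
    then show ?thesis using that assms(3) satisfies_TM[of \<Delta> u v B] by (auto intro: derivable.hyp)
  qed
  hence "satisfies \<Sigma> TM (\<Gamma>, t, s, A)" using all me_nu_model_TM by blast
  thus "derivable \<Sigma> \<Phi> \<Gamma> t s A" using satisfies_TM[OF assms(4)] by blast
qed

end
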